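(* Let $\mathbb X$ be a virtual equipment and let $j\colon A\to E$ be a tight-cell. The functor $\Lambda^R_j\colon\mathbf{RAdj}_R(j)\to\mathbf{RMnd}(j)$, sending a $j$-relative adjunction to its induced $j$-relative monad, admits a partial left-adjoint section, defined on those $j$-relative monads $T$ admitting opalgebra objects, and sending such a $T$ to $k_T\dashv_j v_T$. That is: for every $j$-relative monad $T$ admitting an opalgebra object $k_T\colon A\to\mathbf{Opalg}(T)$, there is a $j$-relative adjunction $k_T\dashv_j v_T$ (with unit the unit of $T$) whose induced $j$-relative monad is $T$, and for every $j$-relative adjunction $\ell'\dashv_j r'$ with induced $j$-relative monad $T'$, the function $$\mathbf{RAdj}_R(j)\big(k_T\dashv_j v_T,\;\ell'\dashv_j r'\big)\to\mathbf{RMnd}(j)(T,T')$$ given by the action of $\Lambda^R_j$ is a bijection. Moreover, a right-morphism out of $k_T\dashv_j v_T$ is strict if and only if its transpose (its image under this bijection) is the identity $j$-relative monad morphism.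
   Context: Virtual equipments. A virtual double category has objects; a category of tight-cells $f\colon A\to B$ (the composite of $f\colon A\to B$ and $g\colon B\to C$ is $gf$); loose-cells $p\colon A\nrightarrow B$; and 2-cells, each having as frame a chain of loose-cells $p_1\colon A_1\nrightarrow A_0,\dots,p_n\colon A_n\nrightarrow A_{n-1}$ ($n\ge 0$; chains are always listed in this order, and called a chain from $A_n$ to $A_0$), a loose-cell $q\colon B_n\nrightarrow B_0$, and tight-cells $f_0\colon A_0\to B_0$ (left) and $f_n\colon A_n\to B_n$ (right); 2-cells have identities and associative unital multicategory-style composition. $\phi\colon p_1,\dots,p_n\Rightarrow q$ denotes a 2-cell whose tight-cells are identities; $(\phi_1,\dots,\phi_n)$ denotes juxtaposition. A 2-cell $q_1,\dots,q_m\Rightarrow q$ is opcartesian if every 2-cell (with any tight-cells) with domain $p_1,\dots,p_l,q_1,\dots,q_m,r_1,\dots,r_n$ factors uniquely through it; then $q$ is the loose-composite $q_1\odot\cdots\odot q_m$ (the loose-identity $A(1,1)\colon A\nrightarrow A$ if $m=0$). A unary 2-cell from $p$ to $q$ with left $f$ and right $g$ is cartesian if every 2-cell into $q$ with left $ff'$ and right $gg'$ factors uniquely through it via a 2-cell with left $f'$ and right $g'$; then $p$ is the restriction $q(f,g)$. A virtual equipment has all loose-identities and restrictions. Write $E(f,g):=E(1,1)(f,g)$; for $f\colon D\to E$, $g\colon A\to E$ it is a loose-cell $A\nrightarrow D$. The canonical isomorphisms $q(f,g)\cong C(f,1)\odot q\odot B(1,g)$ are used implicitly. A 2-cell $f\Rightarrow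 g$ between tight-cells $A\to B$ is equivalently a 2-cell $B(1,f)\Rightarrow B(1,g)$, or $B(g,1)\Rightarrow B(f,1)$, or $()\Rightarrow B(f,g)$; objects, tight-cells and these 2-cells form a 2-category. Restriction is functorial in 2-cells (contravariantly in the first argument, covariantly in the second). For $f\colon A\to B$, $\frown_f\colon ()\Rightarrow B(f,f)$ (corresponding to $1_f$) and $\smile_f\colon B(1,f),B(f,1)\Rightarrow B(1,1)$ are the canonical 2-cells. $\phi(f,g)$ denotes the 2-cell obtained from $\phi$ by restricting along $f$ on the left and $g$ on the right; e.g. $\smile_t(x,y)\colon E(x,t),E(t,y)\Rightarrow E(x,y)$ is composition and $\frown_c(x,y)\colon C(x,y)\Rightarrow C'(cx,cy)$ is the action of $c\colon C\to C'$. For $\phi\colon p_1,\dots,p_n\Rightarrow C(x,y)$ and $c\colon C\to C'$, $\phi;c:=\frown_c(x,y)\circ\phi$. Relative monads. A $j$-relative monad $T=(t,\dagger,\eta)$ comprises a tight-cell $t\colon A\to E$, a 2-cell $\dagger\colon E(j,t)\Rightarrow E(t,t)$ and a 2-cell $\eta\colon j\Rightarrow t$ such that: (i) $E(\eta,t)\circ\dagger=1$; (ii) $\dagger\circ E(j,\eta)\circ\frown_j=\frown_t$; (iii) the 2-cells $E(j,t),E(j,t)\Rightarrow E(t,t)$ given by $(\dagger,\dagger)$ followed by $\smile_t(t,t)$, and by $(1,\dagger)$ followed by $\smile_t(j,t)$ followed by $\dagger$, are equal. A morphism is a 2-cell $\tau\colon t\Rightarrow t'$ with $\tau\circ\eta=\eta'$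 and $E(t,\tau)\circ\dagger=E(\tau,t')\circ\dagger'\circ E(j,\tau)$. These form $\mathbf{RMnd}(j)$. Relative adjunctions. A $j$-relative adjunction $\ell\dashv_j r$ consists of tight-cells $\ell\colon A\to C$, $r\colon C\to E$ and an isomorphism $\sharp\colon C(\ell,1)\cong E(j,r):\flat$; its unit $\eta\colon j\Rightarrow r\ell$ corresponds to $\sharp(1,\ell)\circ\frown_\ell$ (and determines $\sharp$). A right-morphism from $\ell\dashv_j r$ to $\ell'\dashv_j r'$ is a pair $(c\colon C\to C',\rho\colon r\Rightarrow r'c)$ with $c\ell=\ell'$ and $E(j,\rho)\circ\sharp=\sharp'(1,c)\circ\frown_c(\ell,1)$; it is strict if $\rho$ is an identity. These form $\mathbf{RAdj}_R(j)$. $\ell\dashv_j r$ induces the $j$-relative monad with carrier $r\ell$, unit $\eta$ and extension operator $E(j,r\ell)\xrightarrow{\flat(1,\ell)}C(\ell,\ell)\xrightarrow{\frown_r(\ell,\ell)}E(r\ell,r\ell)$; $\Lambda^R_j$ sends $(c,\rho)$ to $\rho\ell\colon r\ell\Rightarrow r'c\ell=r'\ell'$. Opalgebras. A $T$-opalgebra is a tight-cell $a\colon A\to B$ with a 2-cell $\ltimes\colon E(j,t)\Rightarrow B(a,a)$ such that $\ltimes\circ E(j,\eta)\circ\frown_j=\frown_a$ and the 2-cells $E(j,t),E(j,t)\Rightarrow B(a,a)$ given by $(\ltimes,\ltimes)$ followed by $\smile_a(a,a)$, and by $(1,\dagger)$ followed by $\smile_t(j,t)$ followed by $\ltimes$,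 are equal. E.g. $(t,\dagger)$. For a chain $p_1,\dots,p_n$ from $B$ to $B'$, a $(p_1,\dots,p_n)$-graded $T$-opalgebra morphism from $(a\colon A\to B,\ltimes)$ to $(a'\colon A\to B',\ltimes')$ is a 2-cell $\alpha\colon p_1,\dots,p_n,B(1,a)\Rightarrow B'(1,a')$ such that the 2-cells $p_1,\dots,p_n,B(1,a),E(j,t)\Rightarrow B'(1,a')$ given by $(1,\dots,1,\rho)$ followed by $\alpha$, and by $(\alpha,1)$ followed by $\rho'$, are equal; here $\rho\colon B(1,a),E(j,t)\Rightarrow B(1,a)$ is $(1,\ltimes)$ followed by $\smile_a(1,a)$, and similarly $\rho'$. Opalgebra object. A $T$-opalgebra $(k_T\colon A\to\mathbf{Opalg}(T),\ltimes_T)$ is an opalgebra object for $T$ when: (1) for every $T$-opalgebra $(a\colon A\to B,\ltimes)$ there is a unique tight-cell $[]_{(a,\ltimes)}\colon\mathbf{Opalg}(T)\to B$ with $[]_{(a,\ltimes)}k_T=a$ and $\ltimes_T;[]_{(a,\ltimes)}=\ltimes$; (2) for every graded $T$-opalgebra morphism $\alpha\colon p_1,\dots,p_n,B(1,a)\Rightarrow B'(1,a')$ there is a unique 2-cell $[]_\alpha\colon p_1,\dots,p_n,B(1,[]_{(a,\ltimes)})\Rightarrow B'(1,[]_{(a',\ltimes')})$ with $\alpha=[]_\alpha(1,k_T)$. Write $v_T:=[]_{(t,\dagger)}\colon\mathbf{Opalg}(T)\to E$, so $v_Tk_T=t$. *)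

theory Defs
  imports Main
begin

section \<open>Virtual double categories\<close>

text \<open>
  A loose-cell \<open>p : B \<nrightarrow> A\<close> has source \<open>B\<close> and target \<open>A\<close>. The domain of a 2-cell is a list
  \<open>[p\<^sub>1, \<dots>, p\<^sub>n]\<close> with \<open>p\<^sub>i : A\<^sub>i \<nrightarrow> A\<^sub>i\<^sub>-\<^sub>1\<close>, so that its leftmost object \<open>A\<^sub>0\<close> is the target of
  \<open>p\<^sub>1\<close>. For the empty list the object \<open>A\<^sub>0 = A\<^sub>n\<close> is the common domain of the left and the right
  tight-cell.

  The composite \<open>ccomp X \<phi> f [\<phi>\<^sub>1, \<dots>, \<phi>\<^sub>n]\<close> takes as an extra argument the left tight-cell \<open>f\<close> of the
  juxtaposition \<open>(\<phi>\<^sub>1, \<dots>, \<phi>\<^sub>n)\<close>. It is redundant for \<open>n > 0\<close>. For \<open>n = 0\<close> it is essential: an empty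
  juxtaposition of 2-cells lies on a tight-cell \<open>f\<close>, and the composite is the nullary 2-cell \<open>\<phi>\<close>
  precomposed with \<open>f\<close> on both sides.
\<close>

record ('o, 't, 'l, 'c) vdc =
  obs :: "'o set"
  tights :: "'t set"
  tdom :: "'t \<Rightarrow> 'o"
  tcod :: "'t \<Rightarrow> 'o"
  tid :: "'o \<Rightarrow> 't"
  tcomp :: "'t \<Rightarrow> 't \<Rightarrow> 't"  (infixl "\<cdot>\<index>" 75)
  looses :: "'l set"
  lsrc :: "'l \<Rightarrow> 'o"
  ltgt :: "'l \<Rightarrow> 'o"
  cells :: "'c set"
  cdom :: "'c \<Rightarrow> 'l list"
  ccod :: "'c \<Rightarrow> 'l"
  cleft :: "'c \<Rightarrow> 't"
  cright :: "'c \<Rightarrow> 't"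
  cid :: "'l \<Rightarrow> 'c"
  ccomp :: "'c \<Rightarrow> 't \<Rightarrow> 'c list \<Rightarrow> 'c"

text \<open>Composition with a nonempty juxtaposition.\<close>

definition paste :: "('o, 't, 'l, 'c) vdc \<Rightarrow> 'c \<Rightarrow> 'c list \<Rightarrow> 'c"  (infixr "\<star>\<index>" 65) where
  "\<psi> \<star>\<^bsub>X\<^esub> \<phi>s = ccomp X \<psi> (cleft X (hd \<phi>s)) \<phi>s"

context
  fixes X :: "('o, 't, 'l, 'c) vdc" (structure)
begin

text \<open>\<open>chain A ps B\<close>: \<open>ps\<close> is a chain of loose-cells from \<open>B\<close> (on the right) to \<open>A\<close> (on the left).\<close>

primrec chain :: "'o \<Rightarrow> 'l list \<Rightarrow> 'o \<Rightarrow> bool" where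
  "chain A [] B \<longleftrightarrow> A \<in> obs X \<and> A = B"
| "chain A (p # ps) B \<longleftrightarrow> p \<in> looses X \<and> ltgt X p = A \<and> chain (lsrc X p) ps B"

text \<open>\<open>cell_path f \<phi>s g\<close>: the 2-cells \<open>\<phi>s\<close> can be juxtaposed, with outer left and right tight-cells
  \<open>f\<close> and \<open>g\<close>.\<close>

primrec cell_path :: "'t \<Rightarrow> 'c list \<Rightarrow> 't \<Rightarrow> bool" where
  "cell_path f [] g \<longleftrightarrow> f \<in> tights X \<and> f = g"
| "cell_path f (\<phi> # \<phi>s) g \<longleftrightarrow> \<phi> \<in> cells X \<and> cleft X \<phi> = f \<and> cell_path (cright X \<phi>) \<phi>s g"

definition composable :: "'c \<Rightarrow> 't \<Rightarrow> 'c list \<Rightarrow> 't \<Rightarrow> bool" where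
  "composable \<phi> f \<phi>s g \<longleftrightarrow>
     \<phi> \<in> cells X \<and> cell_path f \<phi>s g \<and> map (ccod X) \<phi>s = cdom X \<phi> \<and>
     tcod X f = tdom X (cleft X \<phi>)"

definition framed :: "'c \<Rightarrow> 'l list \<Rightarrow> 'l \<Rightarrow> 't \<Rightarrow> 't \<Rightarrow> bool" where
  "framed \<phi> ps q f g \<longleftrightarrow>
     \<phi> \<in> cells X \<and> cdom X \<phi> = ps \<and> ccod X \<phi> = q \<and> cleft X \<phi> = f \<and> cright X \<phi> = g"

text \<open>\<open>globular \<phi> ps q\<close> renders \<open>\<phi> : p\<^sub>1, \<dots>, p\<^sub>n \<Rightarrow> q\<close>, a 2-cell whose tight-cells are identities.\<close>

definition globular :: "'c \<Rightarrow> 'l list \<Rightarrow> 'l \<Rightarrow> bool" where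
  "globular \<phi> ps q \<longleftrightarrow> framed \<phi> ps q (tid X (ltgt X q)) (tid X (lsrc X q))"

end

locale virtual_double_category =
  fixes X :: "('o, 't, 'l, 'c) vdc" (structure)
  assumes tdom_obs: "f \<in> tights X \<Longrightarrow> tdom X f \<in> obs X"
    and tcod_obs: "f \<in> tights X \<Longrightarrow> tcod X f \<in> obs X"
    and tid_tight: "A \<in> obs X \<Longrightarrow> tid X A \<in> tights X \<and> tdom X (tid X A) = A \<and> tcod X (tid X A) = A"
    and tcomp_tight: "\<lbrakk>f \<in> tights X; g \<in> tights X; tcod X f = tdom X g\<rbrakk> \<Longrightarrow>
      g \<cdot> f \<in> tights X \<and> tdom X (g \<cdot> f) = tdom X f \<and> tcod X (g \<cdot> f) = tcod X g"
    and tid_left: "f \<in> tights X \<Longrightarrow> tid X (tcod X f) \<cdot> f = f"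
    and tid_right: "f \<in> tights X \<Longrightarrow> f \<cdot> tid X (tdom X f) = f"
    and tcomp_assoc: "\<lbrakk>f \<in> tights X; g \<in> tights X; h \<in> tights X; tcod X f = tdom X g;
      tcod X g = tdom X h\<rbrakk> \<Longrightarrow> (h \<cdot> g) \<cdot> f = h \<cdot> (g \<cdot> f)"
    and loose_obs: "p \<in> looses X \<Longrightarrow> lsrc X p \<in> obs X \<and> ltgt X p \<in> obs X"
    and cell_tights: "\<phi> \<in> cells X \<Longrightarrow> cleft X \<phi> \<in> tights X \<and> cright X \<phi> \<in> tights X"
    and cell_dom: "\<phi> \<in> cells X \<Longrightarrow>
      chain X (tdom X (cleft X \<phi>)) (cdom X \<phi>) (tdom X (cright X \<phi>))"
    and cell_cod: "\<phi> \<in> cells X \<Longrightarrow> ccod X \<phi> \<in> looses X \<and>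
      ltgt X (ccod X \<phi>) = tcod X (cleft X \<phi>) \<and> lsrc X (ccod X \<phi>) = tcod X (cright X \<phi>)"
    and cid_cell: "p \<in> looses X \<Longrightarrow> globular X (cid X p) [p] p"
    and ccomp_cell: "composable X \<phi> f \<phi>s g \<Longrightarrow>
      framed X (ccomp X \<phi> f \<phi>s) (concat (map (cdom X) \<phi>s)) (ccod X \<phi>)
        (cleft X \<phi> \<cdot> f) (cright X \<phi> \<cdot> g)"
    and cid_left: "\<phi> \<in> cells X \<Longrightarrow> ccomp X (cid X (ccod X \<phi>)) (cleft X \<phi>) [\<phi>] = \<phi>"
    and cid_right: "\<phi> \<in> cells X \<Longrightarrow>
      ccomp X \<phi> (tid X (tdom X (cleft X \<phi>))) (map (cid X) (cdom X \<phi>)) = \<phi>"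
    and ccomp_assoc: "\<lbrakk>composable X \<phi> f \<phi>s g; length \<psi>ss = length \<phi>s; length hs = Suc (length \<phi>s);
      hs ! 0 \<in> tights X; tcod X (hs ! 0) = tdom X f;
      \<And>i. i < length \<phi>s \<Longrightarrow> composable X (\<phi>s ! i) (hs ! i) (\<psi>ss ! i) (hs ! Suc i)\<rbrakk> \<Longrightarrow>
      ccomp X (ccomp X \<phi> f \<phi>s) (hs ! 0) (concat \<psi>ss) =
      ccomp X \<phi> (f \<cdot> (hs ! 0))
        (map (\<lambda>i. ccomp X (\<phi>s ! i) (hs ! i) (\<psi>ss ! i)) [0..<length \<phi>s])"


section \<open>Virtual equipments\<close>

context
  fixes X :: "('o, 't, 'l, 'c) vdc" (structure)
begin

text \<open>The two \<open>chain\<close> conditions say that \<open>\<theta>\<close> fits between \<open>ps\<close> and \<open>rs\<close>; for a nullary \<open>\<theta>\<close> this is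
  not visible from the list \<open>ps @ cdom X \<theta> @ rs\<close>.\<close>

definition opcartesian :: "'c \<Rightarrow> bool" where
  "opcartesian \<theta> \<longleftrightarrow> globular X \<theta> (cdom X \<theta>) (ccod X \<theta>) \<and>
     (\<forall>ps rs \<chi>. \<chi> \<in> cells X \<and> cdom X \<chi> = ps @ cdom X \<theta> @ rs \<and>
        chain X (tdom X (cleft X \<chi>)) ps (ltgt X (ccod X \<theta>)) \<and>
        chain X (lsrc X (ccod X \<theta>)) rs (tdom X (cright X \<chi>)) \<longrightarrow>
        (\<exists>!\<chi>'. framed X \<chi>' (ps @ [ccod X \<theta>] @ rs) (ccod X \<chi>) (cleft X \<chi>) (cright X \<chi>) \<and>
               \<chi>' \<star> (map (cid X) ps @ [\<theta>] @ map (cid X) rs) = \<chi>))"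

definition cartesian :: "'c \<Rightarrow> bool" where
  "cartesian \<kappa> \<longleftrightarrow> \<kappa> \<in> cells X \<and> (\<exists>p. cdom X \<kappa> = [p]) \<and>
     (\<forall>\<chi> f' g'. \<chi> \<in> cells X \<and> ccod X \<chi> = ccod X \<kappa> \<and> f' \<in> tights X \<and> g' \<in> tights X \<and>
        tcod X f' = tdom X (cleft X \<kappa>) \<and> tcod X g' = tdom X (cright X \<kappa>) \<and>
        cleft X \<chi> = cleft X \<kappa> \<cdot> f' \<and> cright X \<chi> = cright X \<kappa> \<cdot> g' \<longrightarrow>
        (\<exists>!\<chi>'. framed X \<chi>' (cdom X \<chi>) (hd (cdom X \<kappa>)) f' g' \<and> \<kappa> \<star> [\<chi>'] = \<chi>))"

definition exhibits_loose_identity :: "'o \<Rightarrow> 'c \<Rightarrow> bool" where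
  "exhibits_loose_identity A \<theta> \<longleftrightarrow> opcartesian \<theta> \<and> cdom X \<theta> = [] \<and> tdom X (cleft X \<theta>) = A"

definition exhibits_restriction :: "'l \<Rightarrow> 't \<Rightarrow> 't \<Rightarrow> 'c \<Rightarrow> bool" where
  "exhibits_restriction q f g \<kappa> \<longleftrightarrow>
     cartesian \<kappa> \<and> ccod X \<kappa> = q \<and> cleft X \<kappa> = f \<and> cright X \<kappa> = g"

end

locale virtual_equipment = virtual_double_category +
  assumes ex_loose_identity: "A \<in> obs X \<Longrightarrow> \<exists>\<theta>. exhibits_loose_identity X A \<theta>"
    and ex_restriction: "\<lbrakk>q \<in> looses X; f \<in> tights X; g \<in> tights X; tcod X f = ltgt X q;
      tcod X g = lsrc X q\<rbrakk> \<Longrightarrow> \<exists>\<kappa>. exhibits_restriction X q f g \<kappa>"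

context
  fixes X :: "('o, 't, 'l, 'c) vdc" (structure)
begin

definition uid_cell :: "'o \<Rightarrow> 'c" where
  "uid_cell A = (SOME \<theta>. exhibits_loose_identity X A \<theta>)"

definition uid :: "'o \<Rightarrow> 'l" where
  "uid A = ccod X (uid_cell A)"

definition restr_cell :: "'l \<Rightarrow> 't \<Rightarrow> 't \<Rightarrow> 'c" where
  "restr_cell q f g = (SOME \<kappa>. exhibits_restriction X q f g \<kappa>)"

definition restr :: "'l \<Rightarrow> 't \<Rightarrow> 't \<Rightarrow> 'l" where
  "restr q f g = hd (cdom X (restr_cell q f g))"

text \<open>For \<open>f : D \<rightarrow> E\<close> and \<open>g : A \<rightarrow> E\<close>, \<open>hom f g\<close> is the loose-cell \<open>E(f,g) : A \<nrightarrow> D\<close>, with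
  cartesian 2-cell \<open>hom_cell f g\<close> to the loose-identity of \<open>E\<close>.\<close>

definition hom_cell :: "'t \<Rightarrow> 't \<Rightarrow> 'c" where
  "hom_cell f g = restr_cell (uid (tcod X f)) f g"

definition hom :: "'t \<Rightarrow> 't \<Rightarrow> 'l" where
  "hom f g = restr (uid (tcod X f)) f g"


section \<open>Canonical 2-cells\<close>

text \<open>Chosen restrictions compose only up to the canonical isomorphisms
  \<open>E(x,y)(f,g) \<cong> E(xf,yg)\<close>. Rather than transporting along these, the canonical 2-cells and the
  restrictions of 2-cells are characterised below directly between the loose-cells \<open>E(x,y)\<close>,
  by the universal properties.\<close>

text \<open>The canonical (cartesian) 2-cell \<open>E(xf,yg) \<Rightarrow> E(x,y)\<close> with left \<open>f\<close> and right \<open>g\<close>.\<close>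

definition hom_res :: "'t \<Rightarrow> 't \<Rightarrow> 't \<Rightarrow> 't \<Rightarrow> 'c" where
  "hom_res x y f g = (THE \<phi>. framed X \<phi> [hom (x \<cdot> f) (y \<cdot> g)] (hom x y) f g \<and>
     hom_cell x y \<star> [\<phi>] = hom_cell (x \<cdot> f) (y \<cdot> g))"

text \<open>The multiplication \<open>E(1,1), E(1,1) \<Rightarrow> E(1,1)\<close> of the loose-identity.\<close>

definition uid_mult :: "'o \<Rightarrow> 'c" where
  "uid_mult A = (THE \<mu>. globular X \<mu> [uid A, uid A] (uid A) \<and>
     \<mu> \<star> [uid_cell A, cid X (uid A)] = cid X (uid A))"

text \<open>The 2-cell \<open>C(1,1) \<Rightarrow> C'(1,1)\<close> with left and right \<open>c : C \<rightarrow> C'\<close>.\<close>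

definition uid_map :: "'t \<Rightarrow> 'c" where
  "uid_map c = (THE \<phi>. framed X \<phi> [uid (tdom X c)] (uid (tcod X c)) c c \<and>
     \<phi> \<star> [uid_cell (tdom X c)] = ccomp X (uid_cell (tcod X c)) c [])"

text \<open>\<open>smile t x y\<close> is \<open>\<smile>\<^sub>t(x,y) : E(x,t), E(t,y) \<Rightarrow> E(x,y)\<close>.\<close>

definition smile :: "'t \<Rightarrow> 't \<Rightarrow> 't \<Rightarrow> 'c" where
  "smile t x y = (THE \<phi>. globular X \<phi> [hom x t, hom t y] (hom x y) \<and>
     hom_cell x y \<star> [\<phi>] = uid_mult (tcod X x) \<star> [hom_cell x t, hom_cell t y])"

text \<open>\<open>frown f\<close> is \<open>\<frown>\<^sub>f : () \<Rightarrow> B(f,f)\<close>, and \<open>frown_at c x y\<close> is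
  \<open>\<frown>\<^sub>c(x,y) : C(x,y) \<Rightarrow> C'(cx,cy)\<close>.\<close>

definition frown :: "'t \<Rightarrow> 'c" where
  "frown f = (THE \<phi>. globular X \<phi> [] (hom f f) \<and>
     hom_cell f f \<star> [\<phi>] = ccomp X (uid_cell (tcod X f)) f [])"

definition frown_at :: "'t \<Rightarrow> 't \<Rightarrow> 't \<Rightarrow> 'c" where
  "frown_at c x y = (THE \<phi>. globular X \<phi> [hom x y] (hom (c \<cdot> x) (c \<cdot> y)) \<and>
     hom_cell (c \<cdot> x) (c \<cdot> y) \<star> [\<phi>] = uid_map c \<star> [hom_cell x y])"

text \<open>For \<open>\<phi> : p\<^sub>1, \<dots>, p\<^sub>n, B(x,y) \<Rightarrow> B'(x',y')\<close>, \<open>restr_right \<phi> x y x' y' g\<close> is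
  \<open>\<phi>(1,g) : p\<^sub>1, \<dots>, p\<^sub>n, B(x,yg) \<Rightarrow> B'(x',y'g)\<close>.\<close>

definition restr_right :: "'c \<Rightarrow> 't \<Rightarrow> 't \<Rightarrow> 't \<Rightarrow> 't \<Rightarrow> 't \<Rightarrow> 'c" where
  "restr_right \<phi> x y x' y' g =
     (THE \<gamma>. globular X \<gamma> (butlast (cdom X \<phi>) @ [hom x (y \<cdot> g)]) (hom x' (y' \<cdot> g)) \<and>
        hom_res x' y' (tid X (tdom X x')) g \<star> [\<gamma>] =
        \<phi> \<star> (map (cid X) (butlast (cdom X \<phi>)) @ [hom_res x y (tid X (tdom X x)) g]))"


section \<open>2-cells between tight-cells\<close>

text \<open>A 2-cell \<open>f \<Rightarrow> g\<close> between tight-cells \<open>A \<rightarrow> B\<close> is represented by a 2-cell \<open>() \<Rightarrow> B(f,g)\<close>; the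
  identity is \<open>frown f\<close>. Distinct pairs of tight-cells may have the same chosen \<open>B(f,g)\<close>, so the
  tight-cells are not determined by the 2-cell.\<close>

definition tight2 :: "'c \<Rightarrow> 't \<Rightarrow> 't \<Rightarrow> bool" where
  "tight2 \<tau> f g \<longleftrightarrow> f \<in> tights X \<and> g \<in> tights X \<and> tdom X f = tdom X g \<and> tcod X f = tcod X g \<and>
     globular X \<tau> [] (hom f g)"

definition is_tight2_id :: "'c \<Rightarrow> 't \<Rightarrow> 't \<Rightarrow> bool" where
  "is_tight2_id \<tau> f g \<longleftrightarrow> f = g \<and> \<tau> = frown f"

text \<open>The composite of \<open>\<sigma> : f \<Rightarrow> g\<close> and \<open>\<tau> : g \<Rightarrow> h\<close>.\<close>

definition tight2_comp :: "'t \<Rightarrow> 't \<Rightarrow> 't \<Rightarrow> 'c \<Rightarrow> 'c \<Rightarrow> 'c" where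
  "tight2_comp f g h \<tau> \<sigma> = smile g f h \<star> [\<sigma>, \<tau>]"

text \<open>For \<open>\<tau> : f \<Rightarrow> g\<close>, the whiskering \<open>\<tau>h : fh \<Rightarrow> gh\<close>.\<close>

definition whisker :: "'t \<Rightarrow> 't \<Rightarrow> 'c \<Rightarrow> 't \<Rightarrow> 'c" where
  "whisker f g \<tau> h = (THE \<gamma>. globular X \<gamma> [] (hom (f \<cdot> h) (g \<cdot> h)) \<and>
     hom_res f g h h \<star> [\<gamma>] = ccomp X \<tau> h [])"

text \<open>For \<open>\<tau> : f \<Rightarrow> g\<close>, the 2-cells \<open>E(x,\<tau>) : E(x,f) \<Rightarrow> E(x,g)\<close> and \<open>E(\<tau>,x) : E(g,x) \<Rightarrow> E(f,x)\<close>.\<close>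

definition hom_post :: "'t \<Rightarrow> 't \<Rightarrow> 't \<Rightarrow> 'c \<Rightarrow> 'c" where
  "hom_post x f g \<tau> = smile f x g \<star> [cid X (hom x f), \<tau>]"

definition hom_pre :: "'t \<Rightarrow> 't \<Rightarrow> 'c \<Rightarrow> 't \<Rightarrow> 'c" where
  "hom_pre f g \<tau> x = smile g f x \<star> [\<tau>, cid X (hom g x)]"

end


section \<open>Relative monads\<close>

record ('t, 'c) rmonad =
  carr :: "'t"
  ext :: "'c"
  eta :: "'c"

context
  fixes X :: "('o, 't, 'l, 'c) vdc" (structure)
begin

definition rel_monad :: "'t \<Rightarrow> ('t, 'c) rmonad \<Rightarrow> bool" where
  "rel_monad j T \<longleftrightarrow> (let t = carr T; d = ext T; h = eta T in
     j \<in> tights X \<and> t \<in> tights X \<and> tdom X t = tdom X j \<and> tcod X t = tcod X j \<and>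
     globular X d [hom X j t] (hom X t t) \<and> tight2 X h j t \<and>
     hom_pre X j t h t \<star> [d] = cid X (hom X j t) \<and>
     d \<star> [hom_post X j j t h \<star> [frown X j]] = frown X t \<and>
     smile X t t t \<star> [d, d] = d \<star> [smile X t j t \<star> [cid X (hom X j t), d]])"

definition rmonad_morphism ::
    "'t \<Rightarrow> ('t, 'c) rmonad \<Rightarrow> ('t, 'c) rmonad \<Rightarrow> 'c \<Rightarrow> bool" where
  "rmonad_morphism j T T' \<tau> \<longleftrightarrow> (let t = carr T; t' = carr T' in
     tight2 X \<tau> t t' \<and>
     tight2_comp X j t t' \<tau> (eta T) = eta T' \<and>
     hom_post X t t t' \<tau> \<star> [ext T] = hom_pre X t t' \<tau> t' \<star> [ext T' \<star> [hom_post X j t t' \<tau>]])"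

definition is_rmonad_id :: "('t, 'c) rmonad \<Rightarrow> ('t, 'c) rmonad \<Rightarrow> 'c \<Rightarrow> bool" where
  "is_rmonad_id T T' \<tau> \<longleftrightarrow> T = T' \<and> is_tight2_id X \<tau> (carr T) (carr T')"

end


section \<open>Relative adjunctions\<close>

record ('t, 'c) radj =
  ladj :: "'t"
  radj :: "'t"
  sharp :: "'c"
  flat :: "'c"

context
  fixes X :: "('o, 't, 'l, 'c) vdc" (structure)
begin

definition rel_adj :: "'t \<Rightarrow> ('t, 'c) radj \<Rightarrow> bool" where
  "rel_adj j R \<longleftrightarrow> (let l = ladj R; r = radj R; C = tcod X l in
     j \<in> tights X \<and> l \<in> tights X \<and> r \<in> tights X \<and>
     tdom X l = tdom X j \<and> tdom X r = C \<and> tcod X r = tcod X j \<and>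
     globular X (sharp R) [hom X l (tid X C)] (hom X j r) \<and>
     globular X (flat R) [hom X j r] (hom X l (tid X C)) \<and>
     flat R \<star> [sharp R] = cid X (hom X l (tid X C)) \<and>
     sharp R \<star> [flat R] = cid X (hom X j r))"

definition radj_unit :: "'t \<Rightarrow> ('t, 'c) radj \<Rightarrow> 'c" where
  "radj_unit j R = (let l = ladj R; r = radj R; C = tcod X l in
     restr_right X (sharp R) l (tid X C) j r l \<star> [frown X l])"

definition induced_rmonad :: "'t \<Rightarrow> ('t, 'c) radj \<Rightarrow> ('t, 'c) rmonad" where
  "induced_rmonad j R = (let l = ladj R; r = radj R; C = tcod X l in
     \<lparr>carr = r \<cdot> l,
      ext = frown_at X r l l \<star> [restr_right X (flat R) j r l (tid X C) l],
      eta = radj_unit j R\<rparr>)"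

definition right_morphism :: "'t \<Rightarrow> ('t, 'c) radj \<Rightarrow> ('t, 'c) radj \<Rightarrow> 't \<times> 'c \<Rightarrow> bool" where
  "right_morphism j R R' = (\<lambda>(c, \<rho>).
     let l = ladj R; r = radj R; C = tcod X l; l' = ladj R'; r' = radj R'; C' = tcod X l' in
     c \<in> tights X \<and> tdom X c = C \<and> tcod X c = C' \<and> c \<cdot> l = l' \<and>
     tight2 X \<rho> r (r' \<cdot> c) \<and>
     hom_post X j r (r' \<cdot> c) \<rho> \<star> [sharp R] =
     restr_right X (sharp R') l' (tid X C') j r' c \<star> [frown_at X c l (tid X C)])"

definition strict_right_morphism :: "('t, 'c) radj \<Rightarrow> ('t, 'c) radj \<Rightarrow> 't \<times> 'c \<Rightarrow> bool" where
  "strict_right_morphism R R' = (\<lambda>(c, \<rho>). is_tight2_id X \<rho> (radj R) (radj R' \<cdot> c))"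

text \<open>The action of \<open>\<Lambda>\<^sup>R\<^sub>j\<close> on right-morphisms from \<open>R\<close> to \<open>R'\<close>.\<close>

definition Lambda_R :: "('t, 'c) radj \<Rightarrow> ('t, 'c) radj \<Rightarrow> 't \<times> 'c \<Rightarrow> 'c" where
  "Lambda_R R R' = (\<lambda>(c, \<rho>). whisker X (radj R) (radj R' \<cdot> c) \<rho> (ladj R))"


section \<open>Opalgebras\<close>

definition opalgebra :: "'t \<Rightarrow> ('t, 'c) rmonad \<Rightarrow> 't \<Rightarrow> 'c \<Rightarrow> bool" where
  "opalgebra j T a w \<longleftrightarrow> (let t = carr T in
     a \<in> tights X \<and> tdom X a = tdom X j \<and>
     globular X w [hom X j t] (hom X a a) \<and>
     w \<star> [hom_post X j j t (eta T) \<star> [frown X j]] = frown X a \<and>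
     smile X a a a \<star> [w, w] = w \<star> [smile X t j t \<star> [cid X (hom X j t), ext T]])"

text \<open>The induced action \<open>B(1,a), E(j,t) \<Rightarrow> B(1,a)\<close>.\<close>

definition opalg_act :: "'t \<Rightarrow> 'c \<Rightarrow> 'c" where
  "opalg_act a w = (let i = tid X (tcod X a) in smile X a i a \<star> [cid X (hom X i a), w])"

definition graded_opalg_morphism ::
    "'t \<Rightarrow> ('t, 'c) rmonad \<Rightarrow> 'l list \<Rightarrow> 't \<Rightarrow> 'c \<Rightarrow> 't \<Rightarrow> 'c \<Rightarrow> 'c \<Rightarrow> bool" where
  "graded_opalg_morphism j T ps a w a' w' \<alpha> \<longleftrightarrow> (let B = tcod X a; B' = tcod X a' in
     chain X B' ps B \<and>
     globular X \<alpha> (ps @ [hom X (tid X B) a]) (hom X (tid X B') a') \<and>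
     \<alpha> \<star> (map (cid X) ps @ [opalg_act a w]) = opalg_act a' w' \<star> [\<alpha>, cid X (hom X j (carr T))])"

text \<open>For an opalgebra \<open>(k, w\<^sub>k)\<close>: \<open>b\<close> is a tight-cell with \<open>b k = a\<close> and \<open>w\<^sub>k ; b = w\<close>.\<close>

definition opalg_factor :: "'t \<Rightarrow> 'c \<Rightarrow> 't \<Rightarrow> 'c \<Rightarrow> 't \<Rightarrow> bool" where
  "opalg_factor k wk a w b \<longleftrightarrow> b \<in> tights X \<and> tdom X b = tcod X k \<and> tcod X b = tcod X a \<and>
     b \<cdot> k = a \<and> frown_at X b k k \<star> [wk] = w"

definition opalg_mediator :: "'t \<Rightarrow> 'c \<Rightarrow> 't \<Rightarrow> 'c \<Rightarrow> 't" where
  "opalg_mediator k wk a w = (THE b. opalg_factor k wk a w b)"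

definition opalgebra_object :: "'t \<Rightarrow> ('t, 'c) rmonad \<Rightarrow> 't \<Rightarrow> 'c \<Rightarrow> bool" where
  "opalgebra_object j T k wk \<longleftrightarrow> opalgebra j T k wk \<and>
     (\<forall>a w. opalgebra j T a w \<longrightarrow> (\<exists>!b. opalg_factor k wk a w b)) \<and>
     (\<forall>ps a w a' w' \<alpha>. opalgebra j T a w \<and> opalgebra j T a' w' \<and>
        graded_opalg_morphism j T ps a w a' w' \<alpha> \<longrightarrow>
        (let i = tid X (tcod X a); i' = tid X (tcod X a');
             b = opalg_mediator k wk a w; b' = opalg_mediator k wk a' w' in
         \<exists>!\<beta>. globular X \<beta> (ps @ [hom X i b]) (hom X i' b') \<and>
              \<alpha> = restr_right X \<beta> i b i' b' k))"

end

end

theory Submission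
  imports Defs
begin

text \<open>
  Every 2-cell into a loose-cell \<open>E(x,y)\<close> is transposed, along the cartesian 2-cell
  \<open>E(x,y) \<Rightarrow> E(1,1)\<close>, to a 2-cell into the loose-identity. For the latter there is a unital,
  associative product \<open>mult\<close>, on which tight-cells act by homomorphisms \<open>app c\<close>; in this calculus
  \<open>\<smile>\<close> becomes the product, \<open>\<frown>\<close> becomes the unit or the action, and no coherence isomorphisms
  between restrictions remain. Opcartesianness of the unit of the loose-identity makes every
  2-cell \<open>\<beta> : B(x,b) \<Rightarrow> B'(f,b')\<close> natural in \<open>b\<close>, that is \<open>\<beta>(\<gamma> \<cdot> b\<sigma>) = \<beta>(\<gamma>) \<cdot> b'\<sigma>\<close>.

  By naturality an adjunction amounts to \<open>\<eta> : j \<Rightarrow> rl\<close> and \<open>\<flat>\<close> with \<open>\<eta> \<cdot> r\<flat> = 1\<close> and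
  \<open>\<flat>(\<eta>) = 1\<close>, and the condition on a right-morphism \<open>(c,\<rho>)\<close> amounts to \<open>\<eta> \<cdot> \<rho>l = \<eta>'\<close>. For an
  opalgebra object, 2-cells out of \<open>B(x,bk)\<close> that are equivariant extend uniquely to \<open>B(x,b)\<close>, and
  2-cells obtained by restriction along \<open>k\<close> are always equivariant. Hence \<open>\<flat>\<close> is the
  extension of the opalgebra structure of \<open>k\<close>, and \<open>\<eta> \<cdot> v\<flat> = 1\<close> follows from \<open>\<eta> \<cdot> \<dagger> = 1\<close>. A
  monad morphism \<open>\<tau> : T \<Rightarrow> T'\<close> makes \<open>l'\<close> a \<open>T\<close>-opalgebra, which gives \<open>c\<close>, and \<open>\<rho>\<close> is the
  extension of \<open>\<tau>\<close>.
\<close>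

section \<open>Compositions computed by rewriting\<close>

text \<open>The universal property of an opalgebra object extends only 2-cells whose domain ends in
  a loose-cell \<open>B(1,bk)\<close> and whose codomain is some \<open>B'(1,b'k)\<close>, whereas
  \<open>\<flat>\<close> goes from \<open>E(j,v)\<close> to \<open>C(k,1)\<close>. This mismatch
  shapes the middle of the proof: the left tight-cells are traded for two extra loose-cells in the
  grade. Since the trade has a left inverse, existence and uniqueness of extensions both transfer.

  Restrictions along \<open>k\<close> are equivariant because the action on \<open>B(x,bk)\<close>
  is right multiplication by \<open>b\<omega>\<close>, for \<open>\<omega>\<close> the transposed
  structure of \<open>k\<close>; equivariance is thus naturality in \<open>b\<close> at
  \<open>\<omega>\<close>.

  A tight-cell out of the opalgebra object is determined by its composite with \<open>k\<close> and
  its image of \<open>\<omega>\<close>. For a right-morphism \<open>(c,\<rho>)\<close> the first is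
  prescribed and the second is a formula in the transpose, which makes the transpose determine
  \<open>c\<close>. As equality of tight-cells cannot be read off from a 2-cell between them, the
  same principle supplies \<open>r'c = v\<close> in the strictness statement.\<close>

text \<open>\<open>pend\<close> and \<open>subs\<close> restate associativity with the splitting of the inner list computed from
  the lengths of the domains, so that for concrete lists it is a rewrite rule.\<close>

context virtual_double_category
begin

primrec pend :: "'t \<Rightarrow> 'c list \<Rightarrow> 't" where
  "pend f [] = f"
| "pend f (\<phi> # \<phi>s) = pend (cright X \<phi>) \<phi>s"

text \<open>The outer right tight-cell of a juxtaposition is determined by its list and its left
  tight-cell, which lets \<open>pend\<close> name the seam.\<close>

lemma cell_path_append:
  "cell_path X f (\<phi>s @ \<psi>s) g \<longleftrightarrow>
    cell_path X f \<phi>s (pend f \<phi>s) \<and> cell_path X (pend f \<phi>s) \<psi>s g"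
proof (induction \<phi>s arbitrary: f)
  case Nil
  show ?case by (cases \<psi>s) (auto simp: cell_tights)
qed auto

lemma cell_path_tights: "cell_path X f \<phi>s g \<Longrightarrow> f \<in> tights X \<and> g \<in> tights X"
  by (induction \<phi>s arbitrary: f) (auto simp: cell_tights)

lemma cell_path_tcod:
  "cell_path X f \<phi>s g \<Longrightarrow> chain X (tcod X f) (map (ccod X) \<phi>s) A \<Longrightarrow> tcod X g = A"
proof (induction \<phi>s arbitrary: f)
  case (Cons \<phi> \<phi>s)
  then show ?case using cell_cod[of \<phi>] by auto
qed auto

lemma ccomp_framed:
  assumes "\<phi> \<in> cells X" "cell_path X f \<phi>s (pend f \<phi>s)" "map (ccod X) \<phi>s = cdom X \<phi>"
    "tcod X f = tdom X (cleft X \<phi>)"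
  shows "framed X (ccomp X \<phi> f \<phi>s) (concat (map (cdom X) \<phi>s)) (ccod X \<phi>)
        (cleft X \<phi> \<cdot> f) (cright X \<phi> \<cdot> pend f \<phi>s)"
  using ccomp_cell[of \<phi> f \<phi>s "pend f \<phi>s"] assms by (simp add: composable_def)

text \<open>The components of a frame become separate rules, so that the frame of a concrete
  composite is computed. The constructions below receive the same treatment.\<close>

lemmas ccomp_simps [simp] = ccomp_framed[unfolded framed_def, THEN conjunct1]
  ccomp_framed[unfolded framed_def, THEN conjunct2, THEN conjunct1]
  ccomp_framed[unfolded framed_def, THEN conjunct2, THEN conjunct2, THEN conjunct1]
  ccomp_framed[unfolded framed_def, THEN conjunct2, THEN conjunct2, THEN conjunct2, THEN conjunct1]
  ccomp_framed[unfolded framed_def, THEN conjunct2, THEN conjunct2, THEN conjunct2, THEN conjunct2]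

primrec subs :: "'t \<Rightarrow> 'c list \<Rightarrow> 'c list \<Rightarrow> 'c list" where
  "subs h [] \<Psi> = []"
| "subs h (\<phi> # \<phi>s) \<Psi> =
    ccomp X \<phi> h (take (length (cdom X \<phi>)) \<Psi>) #
    subs (pend h (take (length (cdom X \<phi>)) \<Psi>)) \<phi>s (drop (length (cdom X \<phi>)) \<Psi>)"

text \<open>Associativity is assumed for a splitting of the inner list into one block per outer
  2-cell. The block lengths are forced by the domains, and the right tight-cell of each block is the
  left one of the next, so cutting off the first block and recursing gives the splitting that
  \<open>subs\<close> computes.\<close>

lemma ex_splitting:
  assumes "cell_path X f \<phi>s g" "cell_path X h \<Psi> k" "map (ccod X) \<Psi> = concat (map (cdom X) \<phi>s)"
    "tcod X h = tdom X f"
  shows "\<exists>\<psi>ss hs. length \<psi>ss = length \<phi>s \<and> length hs = Suc (length \<phi>s) \<and> hs ! 0 = h \<and>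
    concat \<psi>ss = \<Psi> \<and>
    (\<forall>i < length \<phi>s. composable X (\<phi>s ! i) (hs ! i) (\<psi>ss ! i) (hs ! Suc i)) \<and>
    map (\<lambda>i. ccomp X (\<phi>s ! i) (hs ! i) (\<psi>ss ! i)) [0..<length \<phi>s] = subs h \<phi>s \<Psi>"
  using assms
proof (induction \<phi>s arbitrary: f h \<Psi>)
  case Nil
  then show ?case by (intro exI[of _ "[]"] exI[of _ "[h]"]) auto
next
  case (Cons \<phi> \<phi>s)
  define n where "n = length (cdom X \<phi>)"
  define \<Psi>1 where "\<Psi>1 = take n \<Psi>"
  define \<Psi>2 where "\<Psi>2 = drop n \<Psi>"
  define h' where "h' = pend h \<Psi>1"
  have \<Psi>: "\<Psi> = \<Psi>1 @ \<Psi>2" by (simp add: \<Psi>1_def \<Psi>2_def)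
  have \<phi>: "\<phi> \<in> cells X" "cleft X \<phi> = f" "cell_path X (cright X \<phi>) \<phi>s g"
    using Cons.prems by auto
  have p: "cell_path X h \<Psi>1 h'" "cell_path X h' \<Psi>2 k"
    using Cons.prems(2) by (auto simp: \<Psi> cell_path_append h'_def)
  have d1: "map (ccod X) \<Psi>1 = cdom X \<phi>"
    using Cons.prems(3) by (simp add: \<Psi>1_def take_map[symmetric] n_def)
  have d2: "map (ccod X) \<Psi>2 = concat (map (cdom X) \<phi>s)"
    using Cons.prems(3) by (simp add: \<Psi>2_def drop_map[symmetric] n_def)
  \<comment> \<open>For a nullary \<open>\<phi>\<close> the block is empty and \<open>h'\<close> is
    \<open>h\<close>; then \<open>cell_dom\<close> says that both tight-cells of
    \<open>\<phi>\<close> have the same domain.\<close>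
  have "tcod X h' = tdom X (cright X \<phi>)"
    using cell_path_tcod[OF p(1)] cell_dom[OF \<phi>(1)] d1 Cons.prems(4) \<phi>(2) by simp
  from Cons.IH[OF \<phi>(3) p(2) d2 this] obtain \<psi>ss hs where ih:
    "length \<psi>ss = length \<phi>s" "length hs = Suc (length \<phi>s)" "hs ! 0 = h'" "concat \<psi>ss = \<Psi>2"
    "\<And>i. i < length \<phi>s \<Longrightarrow> composable X (\<phi>s ! i) (hs ! i) (\<psi>ss ! i) (hs ! Suc i)"
    "map (\<lambda>i. ccomp X (\<phi>s ! i) (hs ! i) (\<psi>ss ! i)) [0..<length \<phi>s] = subs h' \<phi>s \<Psi>2"
    by blast
  have c: "composable X \<phi> h \<Psi>1 h'"
    using \<phi> p d1 Cons.prems(4) by (simp add: composable_def)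
  show ?case
  proof (intro exI[of _ "\<Psi>1 # \<psi>ss"] exI[of _ "h # hs"] conjI allI impI)
    fix i assume "i < length (\<phi> # \<phi>s)"
    then show "composable X ((\<phi> # \<phi>s) ! i) ((h # hs) ! i) ((\<Psi>1 # \<psi>ss) ! i) ((h # hs) ! Suc i)"
      using c ih by (cases i) auto
  next
    have "map (\<lambda>i. ccomp X ((\<phi> # \<phi>s) ! i) ((h # hs) ! i) ((\<Psi>1 # \<psi>ss) ! i)) [0..<length (\<phi> # \<phi>s)]
      = ccomp X \<phi> h \<Psi>1 # map (\<lambda>i. ccomp X (\<phi>s ! i) (hs ! i) (\<psi>ss ! i)) [0..<length \<phi>s]"
      by (simp add: upt_conv_Cons map_Suc_upt[symmetric] del: upt_Suc)
    then show "map (\<lambda>i. ccomp X ((\<phi> # \<phi>s) ! i) ((h # hs) ! i) ((\<Psi>1 # \<psi>ss) ! i)) [0..<length (\<phi> # \<phi>s)]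
      = subs h (\<phi> # \<phi>s) \<Psi>"
      using ih(6) by (simp add: \<Psi>1_def \<Psi>2_def n_def h'_def)
  qed (use ih \<Psi> in auto)
qed

lemma ccomp_ccomp [simp]:
  assumes "\<phi> \<in> cells X" "cell_path X f \<phi>s (pend f \<phi>s)" "map (ccod X) \<phi>s = cdom X \<phi>"
    "tcod X f = tdom X (cleft X \<phi>)"
    "cell_path X h \<Psi> (pend h \<Psi>)" "map (ccod X) \<Psi> = concat (map (cdom X) \<phi>s)"
    "tcod X h = tdom X f"
  shows "ccomp X (ccomp X \<phi> f \<phi>s) h \<Psi> = ccomp X \<phi> (f \<cdot> h) (subs h \<phi>s \<Psi>)"
proof -
  from ex_splitting[OF assms(2,5,6,7)] obtain \<psi>ss hs where s:
    "length \<psi>ss = length \<phi>s" "length hs = Suc (length \<phi>s)" "hs ! 0 = h" "concat \<psi>ss = \<Psi>"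
    "\<And>i. i < length \<phi>s \<Longrightarrow> composable X (\<phi>s ! i) (hs ! i) (\<psi>ss ! i) (hs ! Suc i)"
    "map (\<lambda>i. ccomp X (\<phi>s ! i) (hs ! i) (\<psi>ss ! i)) [0..<length \<phi>s] = subs h \<phi>s \<Psi>"
    by blast
  have "composable X \<phi> f \<phi>s (pend f \<phi>s)"
    using assms by (simp add: composable_def)
  moreover have "h \<in> tights X"
    using assms(5) cell_path_tights by blast
  ultimately show ?thesis
    using ccomp_assoc[of \<phi> f \<phi>s "pend f \<phi>s" \<psi>ss hs] s assms(7) by simp
qed

section \<open>Category laws of tight-cells and unit laws of composition\<close>

lemmas tight_simps [simp] =
  tdom_obs tcod_obs
  tid_tight[THEN conjunct1] tid_tight[THEN conjunct2, THEN conjunct1]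
  tid_tight[THEN conjunct2, THEN conjunct2]
  tcomp_tight[THEN conjunct1] tcomp_tight[THEN conjunct2, THEN conjunct1]
  tcomp_tight[THEN conjunct2, THEN conjunct2] tcomp_assoc

lemma tid_left' [simp]: "f \<in> tights X \<Longrightarrow> tcod X f = A \<Longrightarrow> tid X A \<cdot> f = f"
  using tid_left by blast

lemma tid_right' [simp]: "f \<in> tights X \<Longrightarrow> tdom X f = A \<Longrightarrow> f \<cdot> tid X A = f"
  using tid_right by blast

lemmas loose_simps [simp] = loose_obs[THEN conjunct1] loose_obs[THEN conjunct2]

lemmas cell_tight_simps [simp] = cell_tights[THEN conjunct1] cell_tights[THEN conjunct2]

lemma ccod_loose [simp]: "\<phi> \<in> cells X \<Longrightarrow> ccod X \<phi> \<in> looses X"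
  using cell_cod by blast

lemma tcod_cleft: "\<phi> \<in> cells X \<Longrightarrow> tcod X (cleft X \<phi>) = ltgt X (ccod X \<phi>)"
  and tcod_cright: "\<phi> \<in> cells X \<Longrightarrow> tcod X (cright X \<phi>) = lsrc X (ccod X \<phi>)"
  using cell_cod by auto

lemma cid_framed: "p \<in> looses X \<Longrightarrow> framed X (cid X p) [p] p (tid X (ltgt X p)) (tid X (lsrc X p))"
  using cid_cell by (simp add: globular_def)

lemmas cid_simps [simp] = cid_framed[unfolded framed_def, THEN conjunct1]
  cid_framed[unfolded framed_def, THEN conjunct2, THEN conjunct1]
  cid_framed[unfolded framed_def, THEN conjunct2, THEN conjunct2, THEN conjunct1]
  cid_framed[unfolded framed_def, THEN conjunct2, THEN conjunct2, THEN conjunct2, THEN conjunct1]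
  cid_framed[unfolded framed_def, THEN conjunct2, THEN conjunct2, THEN conjunct2, THEN conjunct2]

lemma ccomp_cid_left [simp]:
  "\<phi> \<in> cells X \<Longrightarrow> ccod X \<phi> = q \<Longrightarrow> cleft X \<phi> = f \<Longrightarrow> ccomp X (cid X q) f [\<phi>] = \<phi>"
  using cid_left by blast

lemma ccomp_cid_right1 [simp]:
  "\<phi> \<in> cells X \<Longrightarrow> cdom X \<phi> = [p] \<Longrightarrow> tdom X (cleft X \<phi>) = A \<Longrightarrow>
    ccomp X \<phi> (tid X A) [cid X p] = \<phi>"
  using cid_right[of \<phi>] by simp

lemma ccomp_cid_right2 [simp]:
  "\<phi> \<in> cells X \<Longrightarrow> cdom X \<phi> = [p, q] \<Longrightarrow> tdom X (cleft X \<phi>) = A \<Longrightarrow>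
    ccomp X \<phi> (tid X A) [cid X p, cid X q] = \<phi>"
  using cid_right[of \<phi>] by simp

lemma ccomp_nullary_tid [simp]:
  "\<phi> \<in> cells X \<Longrightarrow> cdom X \<phi> = [] \<Longrightarrow> tdom X (cleft X \<phi>) = A \<Longrightarrow>
    ccomp X \<phi> (tid X A) [] = \<phi>"
  using cid_right[of \<phi>] by simp

end

context virtual_equipment
begin

section \<open>The universal property of the chosen loose-identities\<close>

lemma uid_cell_opcartesian:
  assumes "A \<in> obs X"
  shows "opcartesian X (uid_cell X A)" "cdom X (uid_cell X A) = []"
    "tdom X (cleft X (uid_cell X A)) = A"
  using someI_ex[OF ex_loose_identity[OF assms]]
  by (simp_all add: uid_cell_def exhibits_loose_identity_def)

text \<open>Only the domain of the left tight-cell of the unit is prescribed. As that tight-cell is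
  an identity, it fixes the target of the loose-cell, and emptiness of the domain list identifies
  the source with the target.\<close>

lemma uid_cell_framed:
  assumes A: "A \<in> obs X"
  shows "framed X (uid_cell X A) [] (uid X A) (tid X A) (tid X A)"
    and "uid X A \<in> looses X" "ltgt X (uid X A) = A" "lsrc X (uid X A) = A"
proof -
  have g: "globular X (uid_cell X A) [] (uid X A)"
    using uid_cell_opcartesian[OF A] by (simp add: opcartesian_def uid_def)
  then have c: "uid_cell X A \<in> cells X"
    by (simp add: globular_def framed_def)
  show l: "uid X A \<in> looses X" using c by (simp add: uid_def)
  then show t: "ltgt X (uid X A) = A"
    using uid_cell_opcartesian(3)[OF A] g by (simp add: globular_def framed_def)
  have "chain X A [] (tdom X (cright X (uid_cell X A)))"
    using cell_dom[OF c] uid_cell_opcartesian[OF A] by simp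
  then show s: "lsrc X (uid X A) = A"
    using g l by (simp add: globular_def framed_def)
  show "framed X (uid_cell X A) [] (uid X A) (tid X A) (tid X A)"
    using g t s by (simp add: globular_def)
qed

lemmas uid_cell_simps [simp] = uid_cell_framed(2-4)
  uid_cell_framed(1)[unfolded framed_def, THEN conjunct1]
  uid_cell_framed(1)[unfolded framed_def, THEN conjunct2, THEN conjunct1]
  uid_cell_framed(1)[unfolded framed_def, THEN conjunct2, THEN conjunct2, THEN conjunct1]
  uid_cell_framed(1)[unfolded framed_def, THEN conjunct2, THEN conjunct2, THEN conjunct2, THEN conjunct1]
  uid_cell_framed(1)[unfolded framed_def, THEN conjunct2, THEN conjunct2, THEN conjunct2, THEN conjunct2]

lemma ex1_uid_factor:
  assumes "A \<in> obs X" "\<chi> \<in> cells X" "cdom X \<chi> = ps @ rs"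
    "chain X (tdom X (cleft X \<chi>)) ps A" "chain X A rs (tdom X (cright X \<chi>))"
  shows "\<exists>!\<chi>'. framed X \<chi>' (ps @ [uid X A] @ rs) (ccod X \<chi>) (cleft X \<chi>) (cright X \<chi>) \<and>
    \<chi>' \<star> (map (cid X) ps @ [uid_cell X A] @ map (cid X) rs) = \<chi>"
proof -
  have "ccod X (uid_cell X A) = uid X A" "ltgt X (uid X A) = A" "lsrc X (uid X A) = A"
    "cdom X (uid_cell X A) = []"
    using assms(1) by auto
  then show ?thesis
    using uid_cell_opcartesian(1)[OF assms(1)] assms(2-) unfolding opcartesian_def by auto
qed

section \<open>The calculus of 2-cells into loose-identities\<close>

lemma chain_append_cons:
  "chain X M (ps @ q # rs) N \<Longrightarrow> chain X M ps (ltgt X q) \<and> chain X (lsrc X q) rs N"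
  by (induction ps arbitrary: M) auto

text \<open>The uniqueness half of opcartesianness, read as extensionality: a 2-cell with
  \<open>A(1,1)\<close> in its domain is determined by what it becomes once the unit is inserted
  there. The identities of the calculus are proved by such tests.\<close>

lemma uid_eqI:
  assumes A: "A \<in> obs X"
    and c: "\<chi>1 \<in> cells X" "\<chi>2 \<in> cells X"
    "cdom X \<chi>1 = ps @ [uid X A] @ rs" "cdom X \<chi>2 = ps @ [uid X A] @ rs"
    "ccod X \<chi>2 = ccod X \<chi>1" "cleft X \<chi>2 = cleft X \<chi>1" "cright X \<chi>2 = cright X \<chi>1"
    and eq: "\<chi>1 \<star> (map (cid X) ps @ [uid_cell X A] @ map (cid X) rs) =
      \<chi>2 \<star> (map (cid X) ps @ [uid_cell X A] @ map (cid X) rs)"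
    and fr: "framed X (\<chi>1 \<star> (map (cid X) ps @ [uid_cell X A] @ map (cid X) rs)) (ps @ rs) (ccod X \<chi>1) (cleft X \<chi>1) (cright X \<chi>1)"
  shows "\<chi>1 = \<chi>2"
proof -
  let ?l = "\<chi>1 \<star> (map (cid X) ps @ [uid_cell X A] @ map (cid X) rs)"
  have ch: "chain X (tdom X (cleft X \<chi>1)) ps A \<and> chain X A rs (tdom X (cright X \<chi>1))"
    using chain_append_cons[of "tdom X (cleft X \<chi>1)" ps "uid X A" rs] cell_dom[OF c(1)] c(3) A
    by simp
  have "\<exists>!\<chi>'. framed X \<chi>' (ps @ [uid X A] @ rs) (ccod X ?l) (cleft X ?l) (cright X ?l) \<and>
    \<chi>' \<star> (map (cid X) ps @ [uid_cell X A] @ map (cid X) rs) = ?l"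
    using ex1_uid_factor[OF A, of ?l ps rs] fr ch by (simp add: framed_def)
  moreover have "framed X \<chi>1 (ps @ [uid X A] @ rs) (ccod X ?l) (cleft X ?l) (cright X ?l)"
    "framed X \<chi>2 (ps @ [uid X A] @ rs) (ccod X ?l) (cleft X ?l) (cright X ?l)"
    using c fr by (auto simp: framed_def)
  ultimately show ?thesis using eq by auto
qed

lemma uid_eqI0:
  assumes "A \<in> obs X" "\<chi>1 \<in> cells X" "\<chi>2 \<in> cells X"
    "cdom X \<chi>1 = [uid X A]" "cdom X \<chi>2 = [uid X A]"
    "ccod X \<chi>2 = ccod X \<chi>1" "cleft X \<chi>2 = cleft X \<chi>1" "cright X \<chi>2 = cright X \<chi>1"
    "tdom X (cleft X \<chi>1) = A" "tdom X (cright X \<chi>1) = A"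
    "ccomp X \<chi>1 (tid X A) [uid_cell X A] = ccomp X \<chi>2 (tid X A) [uid_cell X A]"
  shows "\<chi>1 = \<chi>2"
  by (rule uid_eqI[of A _ _ "[]" "[]"]) (use assms in \<open>simp_all add: paste_def framed_def\<close>)

lemma uid_eqI_left:
  assumes "A \<in> obs X" "\<chi>1 \<in> cells X" "\<chi>2 \<in> cells X"
    "cdom X \<chi>1 = uid X A # rs" "cdom X \<chi>2 = uid X A # rs"
    "ccod X \<chi>2 = ccod X \<chi>1" "cleft X \<chi>2 = cleft X \<chi>1" "cright X \<chi>2 = cright X \<chi>1"
    "tdom X (cleft X \<chi>1) = A"
    "ccomp X \<chi>1 (tid X A) (uid_cell X A # map (cid X) rs) =
      ccomp X \<chi>2 (tid X A) (uid_cell X A # map (cid X) rs)"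
    "framed X (ccomp X \<chi>1 (tid X A) (uid_cell X A # map (cid X) rs)) rs
      (ccod X \<chi>1) (cleft X \<chi>1) (cright X \<chi>1)"
  shows "\<chi>1 = \<chi>2"
  by (rule uid_eqI[of A _ _ "[]" rs]) (use assms in \<open>simp_all add: paste_def framed_def\<close>)

lemma uid_eqI_right1:
  assumes "A \<in> obs X" "\<chi>1 \<in> cells X" "\<chi>2 \<in> cells X" "p \<in> looses X" "lsrc X p = A"
    "cdom X \<chi>1 = [p, uid X A]" "cdom X \<chi>2 = [p, uid X A]"
    "ccod X \<chi>2 = ccod X \<chi>1" "cleft X \<chi>2 = cleft X \<chi>1" "cright X \<chi>2 = cright X \<chi>1"
    "tdom X (cleft X \<chi>1) = ltgt X p" "tdom X (cright X \<chi>1) = A"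
    "ccomp X \<chi>1 (tid X (ltgt X p)) [cid X p, uid_cell X A] =
      ccomp X \<chi>2 (tid X (ltgt X p)) [cid X p, uid_cell X A]"
  shows "\<chi>1 = \<chi>2"
  by (rule uid_eqI[of A _ _ "[p]" "[]"]) (use assms in \<open>simp_all add: paste_def framed_def\<close>)

lemma uid_factor:
  assumes "A \<in> obs X" "\<chi> \<in> cells X" "cdom X \<chi> = rs"
    "tdom X (cleft X \<chi>) = A" "chain X A rs (tdom X (cright X \<chi>))"
  shows "\<exists>!\<chi>'. framed X \<chi>' (uid X A # rs) (ccod X \<chi>) (cleft X \<chi>) (cright X \<chi>) \<and>
    \<chi>' \<star> (uid_cell X A # map (cid X) rs) = \<chi>"
  using ex1_uid_factor[of A \<chi> "[]" rs] assms by simp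

section \<open>The product of 2-cells into a loose-identity\<close>

lemma uid_mult_framed:
  assumes "A \<in> obs X"
  shows "framed X (uid_mult X A) [uid X A, uid X A] (uid X A) (tid X A) (tid X A)"
    "ccomp X (uid_mult X A) (tid X A) [uid_cell X A, cid X (uid X A)] = cid X (uid X A)"
proof -
  have "\<exists>!\<mu>. globular X \<mu> [uid X A, uid X A] (uid X A) \<and>
     \<mu> \<star> [uid_cell X A, cid X (uid X A)] = cid X (uid X A)"
    using uid_factor[of A "cid X (uid X A)" "[uid X A]"] assms by (simp add: globular_def)
  from theI'[OF this] show
    "framed X (uid_mult X A) [uid X A, uid X A] (uid X A) (tid X A) (tid X A)"
    "ccomp X (uid_mult X A) (tid X A) [uid_cell X A, cid X (uid X A)] = cid X (uid X A)"
    using assms by (simp_all add: uid_mult_def paste_def globular_def)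
qed

lemmas uid_mult_simps [simp] = uid_mult_framed(2)
  uid_mult_framed(1)[unfolded framed_def, THEN conjunct1]
  uid_mult_framed(1)[unfolded framed_def, THEN conjunct2, THEN conjunct1]
  uid_mult_framed(1)[unfolded framed_def, THEN conjunct2, THEN conjunct2, THEN conjunct1]
  uid_mult_framed(1)[unfolded framed_def, THEN conjunct2, THEN conjunct2, THEN conjunct2, THEN conjunct1]
  uid_mult_framed(1)[unfolded framed_def, THEN conjunct2, THEN conjunct2, THEN conjunct2, THEN conjunct2]

text \<open>The defining equation of the multiplication, precomposed with \<open>\<alpha>\<close>,
  is evaluated once as it stands and once after reassociation.\<close>

lemma uid_mult_unit_left_cell:
  assumes "A \<in> obs X" "\<alpha> \<in> cells X" "ccod X \<alpha> = uid X A" "cleft X \<alpha> = f"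
  shows "ccomp X (uid_mult X A) f [ccomp X (uid_cell X A) f [], \<alpha>] = \<alpha>"
proof -
  have t: "tcod X f = A"
    using assms tcod_cleft[of \<alpha>] by simp
  have "ccomp X (ccomp X (uid_mult X A) (tid X A) [uid_cell X A, cid X (uid X A)]) f [\<alpha>] = \<alpha>"
    using assms t by (simp del: ccomp_ccomp)
  moreover have "f \<in> tights X" using assms by auto
  ultimately show ?thesis
    using assms t by (simp del: uid_mult_simps(1))
qed

text \<open>The multiplication is defined by its left unit law alone. The right unit law is tested
  on the unit, where both arguments become units and the left law applies.\<close>

lemma uid_mult_unit_right:
  assumes "A \<in> obs X"
  shows "ccomp X (uid_mult X A) (tid X A) [cid X (uid X A), uid_cell X A] = cid X (uid X A)"
proof (rule uid_eqI0[OF assms])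
  show "ccomp X (ccomp X (uid_mult X A) (tid X A) [cid X (uid X A), uid_cell X A]) (tid X A) [uid_cell X A]
    = ccomp X (cid X (uid X A)) (tid X A) [uid_cell X A]"
    using assms uid_mult_unit_left_cell[of A "uid_cell X A" "tid X A"] by simp
qed (use assms in simp_all)

lemma uid_mult_unit_right_cell:
  assumes "A \<in> obs X" "\<alpha> \<in> cells X" "ccod X \<alpha> = uid X A" "cleft X \<alpha> = f" "cright X \<alpha> = g"
  shows "ccomp X (uid_mult X A) f [\<alpha>, ccomp X (uid_cell X A) g []] = \<alpha>"
proof -
  have t: "tcod X f = A" "tcod X g = A"
    using assms tcod_cleft[of \<alpha>] tcod_cright[of \<alpha>] by auto
  have "ccomp X (ccomp X (uid_mult X A) (tid X A) [cid X (uid X A), uid_cell X A]) f [\<alpha>] = \<alpha>"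
    using assms t by (simp del: ccomp_ccomp add: uid_mult_unit_right)
  moreover have "f \<in> tights X" "g \<in> tights X" using assms by auto
  ultimately show ?thesis
    using assms t by simp
qed

definition mult :: "'a \<Rightarrow> 'd \<Rightarrow> 'd \<Rightarrow> 'd" where
  "mult A \<alpha> \<beta> = ccomp X (uid_mult X A) (cleft X \<alpha>) [\<alpha>, \<beta>]"

definition tunit :: "'b \<Rightarrow> 'd" where
  "tunit f = ccomp X (uid_cell X (tcod X f)) f []"

definition app :: "'b \<Rightarrow> 'd \<Rightarrow> 'd" where
  "app c \<alpha> = ccomp X (uid_map X c) (cleft X \<alpha>) [\<alpha>]"

lemma uid_tcod:
  assumes "A \<in> obs X" "\<alpha> \<in> cells X" "ccod X \<alpha> = uid X A"
  shows "tcod X (cleft X \<alpha>) = A" "tcod X (cright X \<alpha>) = A"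
  using assms tcod_cleft[of \<alpha>] tcod_cright[of \<alpha>] by auto

lemma mult_simps [simp]:
  assumes "A \<in> obs X" "\<alpha> \<in> cells X" "\<beta> \<in> cells X" "ccod X \<alpha> = uid X A" "ccod X \<beta> = uid X A"
    "cright X \<alpha> = cleft X \<beta>"
  shows "mult A \<alpha> \<beta> \<in> cells X" "cdom X (mult A \<alpha> \<beta>) = cdom X \<alpha> @ cdom X \<beta>"
    "ccod X (mult A \<alpha> \<beta>) = uid X A" "cleft X (mult A \<alpha> \<beta>) = cleft X \<alpha>"
    "cright X (mult A \<alpha> \<beta>) = cright X \<beta>"
  using assms uid_tcod[of A \<alpha>] uid_tcod[of A \<beta>] by (simp_all add: mult_def)

lemma tunit_simps [simp]:
  assumes "f \<in> tights X"
  shows "tunit f \<in> cells X" "cdom X (tunit f) = []"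
    "ccod X (tunit f) = uid X (tcod X f)" "cleft X (tunit f) = f" "cright X (tunit f) = f"
  using assms by (simp_all add: tunit_def)

lemma mult_tunit_left [simp]:
  assumes "A \<in> obs X" "\<alpha> \<in> cells X" "ccod X \<alpha> = uid X A" "cleft X \<alpha> = f"
  shows "mult A (tunit f) \<alpha> = \<alpha>"
proof -
  have "f \<in> tights X" using assms by auto
  then show ?thesis
    using assms uid_mult_unit_left_cell[OF assms] uid_tcod[of A \<alpha>] by (simp add: mult_def tunit_def)
qed

lemma mult_tunit_right [simp]:
  assumes "A \<in> obs X" "\<alpha> \<in> cells X" "ccod X \<alpha> = uid X A" "cright X \<alpha> = f"
  shows "mult A \<alpha> (tunit f) = \<alpha>"
  using assms uid_mult_unit_right_cell[OF assms(1-3) refl assms(4)] uid_tcod[of A \<alpha>]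
  by (simp add: mult_def tunit_def)

text \<open>Substitution distributes over the product, each factor receiving the part of the list
  that its own domain demands. With the analogous rules for \<open>tunit\<close>, \<open>app\<close>
  and \<open>lift\<close>, composites reduce to expressions of the calculus.\<close>

lemma ccomp_mult [simp]:
  assumes "A \<in> obs X" "\<alpha> \<in> cells X" "\<beta> \<in> cells X" "ccod X \<alpha> = uid X A" "ccod X \<beta> = uid X A"
    "cright X \<alpha> = cleft X \<beta>" "cell_path X h \<Psi> (pend h \<Psi>)"
    "map (ccod X) \<Psi> = cdom X \<alpha> @ cdom X \<beta>" "tcod X h = tdom X (cleft X \<alpha>)"
  shows "ccomp X (mult A \<alpha> \<beta>) h \<Psi> =
    mult A (ccomp X \<alpha> h (take (length (cdom X \<alpha>)) \<Psi>))
      (ccomp X \<beta> (pend h (take (length (cdom X \<alpha>)) \<Psi>)) (drop (length (cdom X \<alpha>)) \<Psi>))"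
proof -
  define \<Psi>1 where "\<Psi>1 = take (length (cdom X \<alpha>)) \<Psi>"
  define \<Psi>2 where "\<Psi>2 = drop (length (cdom X \<alpha>)) \<Psi>"
  have \<Psi>: "\<Psi> = \<Psi>1 @ \<Psi>2" by (simp add: \<Psi>1_def \<Psi>2_def)
  have "map (ccod X) \<Psi>1 = cdom X \<alpha>"
    using assms(8) by (simp add: \<Psi>1_def take_map[symmetric])
  moreover have "cell_path X h \<Psi>1 (pend h \<Psi>1)"
    using assms(7) cell_path_append[of h \<Psi>1 \<Psi>2] by (simp add: \<Psi>)
  ultimately have "cleft X (ccomp X \<alpha> h \<Psi>1) = cleft X \<alpha> \<cdot> h"
    using assms by simp
  moreover have "length \<Psi> = length (cdom X \<alpha>) + length (cdom X \<beta>)"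
    using arg_cong[OF assms(8), of length] by simp
  ultimately show ?thesis
    using assms uid_tcod[of A \<alpha>] uid_tcod[of A \<beta>]
    by (simp add: mult_def \<Psi>1_def)
qed

lemma ccomp_tunit [simp]:
  assumes "f \<in> tights X" "h \<in> tights X" "tcod X h = tdom X f"
  shows "ccomp X (tunit f) h [] = tunit (f \<cdot> h)"
  using assms by (simp add: tunit_def)

text \<open>Inserting the unit in the first of the three arguments turns both bracketings into the
  multiplication itself, by the left unit law.\<close>

lemma uid_mult_assoc:
  assumes A: "A \<in> obs X"
  shows "ccomp X (uid_mult X A) (tid X A) [uid_mult X A, cid X (uid X A)] =
    ccomp X (uid_mult X A) (tid X A) [cid X (uid X A), uid_mult X A]" (is "?l = ?r")
proof (rule uid_eqI_left[OF A, of _ _ "[uid X A, uid X A]"])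
  have "ccomp X ?l (tid X A) [uid_cell X A, cid X (uid X A), cid X (uid X A)] = uid_mult X A"
    using A by simp
  moreover have "ccomp X ?r (tid X A) [uid_cell X A, cid X (uid X A), cid X (uid X A)] = uid_mult X A"
    using A uid_mult_unit_left_cell[OF A, of "uid_mult X A" "tid X A"] by simp
  ultimately show "ccomp X ?l (tid X A) (uid_cell X A # map (cid X) [uid X A, uid X A]) =
     ccomp X ?r (tid X A) (uid_cell X A # map (cid X) [uid X A, uid X A])"
    "framed X (ccomp X ?l (tid X A) (uid_cell X A # map (cid X) [uid X A, uid X A])) [uid X A, uid X A]
     (ccod X ?l) (cleft X ?l) (cright X ?l)"
    using A by (simp_all add: framed_def)
qed (use A in simp_all)

lemma mult_assoc [simp]:
  assumes "A \<in> obs X" "\<alpha> \<in> cells X" "\<beta> \<in> cells X" "\<gamma> \<in> cells X"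
    "ccod X \<alpha> = uid X A" "ccod X \<beta> = uid X A" "ccod X \<gamma> = uid X A"
    "cright X \<alpha> = cleft X \<beta>" "cright X \<beta> = cleft X \<gamma>"
  shows "mult A (mult A \<alpha> \<beta>) \<gamma> = mult A \<alpha> (mult A \<beta> \<gamma>)"
proof -
  note t = uid_tcod[of A \<alpha>] uid_tcod[of A \<beta>] uid_tcod[of A \<gamma>]
  have "ccomp X (ccomp X (uid_mult X A) (tid X A) [uid_mult X A, cid X (uid X A)]) (cleft X \<alpha>) [\<alpha>, \<beta>, \<gamma>]
    = mult A (mult A \<alpha> \<beta>) \<gamma>"
    using assms t by (simp add: mult_def)
  moreover have "ccomp X (ccomp X (uid_mult X A) (tid X A) [cid X (uid X A), uid_mult X A]) (cleft X \<alpha>) [\<alpha>, \<beta>, \<gamma>]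
    = mult A \<alpha> (mult A \<beta> \<gamma>)"
    using assms t by (simp add: mult_def)
  ultimately show ?thesis
    using uid_mult_assoc[OF assms(1)] by simp
qed

section \<open>The action of tight-cells by homomorphisms\<close>

lemma uid_map_framed:
  assumes "c \<in> tights X" "tdom X c = A" "tcod X c = B"
  shows "framed X (uid_map X c) [uid X A] (uid X B) c c"
    "ccomp X (uid_map X c) (tid X A) [uid_cell X A] = tunit c"
proof -
  have "A \<in> obs X" using assms by auto
  then have "\<exists>!\<phi>. framed X \<phi> [uid X (tdom X c)] (uid X (tcod X c)) c c \<and>
     \<phi> \<star> [uid_cell X (tdom X c)] = ccomp X (uid_cell X (tcod X c)) c []"
    unfolding tunit_def[symmetric] using uid_factor[of A "tunit c" "[]"] assms by simp
  from theI'[OF this] show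
    "framed X (uid_map X c) [uid X A] (uid X B) c c"
    "ccomp X (uid_map X c) (tid X A) [uid_cell X A] = tunit c"
    using assms \<open>A \<in> obs X\<close> by (simp_all add: uid_map_def paste_def tunit_def)
qed

lemmas uid_map_simps [simp] = uid_map_framed(2)
  uid_map_framed(1)[unfolded framed_def, THEN conjunct1]
  uid_map_framed(1)[unfolded framed_def, THEN conjunct2, THEN conjunct1]
  uid_map_framed(1)[unfolded framed_def, THEN conjunct2, THEN conjunct2, THEN conjunct1]
  uid_map_framed(1)[unfolded framed_def, THEN conjunct2, THEN conjunct2, THEN conjunct2, THEN conjunct1]
  uid_map_framed(1)[unfolded framed_def, THEN conjunct2, THEN conjunct2, THEN conjunct2, THEN conjunct2]

lemma app_simps [simp]:
  assumes "c \<in> tights X" "\<alpha> \<in> cells X" "ccod X \<alpha> = uid X (tdom X c)"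
  shows "app c \<alpha> \<in> cells X" "cdom X (app c \<alpha>) = cdom X \<alpha>" "ccod X (app c \<alpha>) = uid X (tcod X c)"
    "cleft X (app c \<alpha>) = c \<cdot> cleft X \<alpha>" "cright X (app c \<alpha>) = c \<cdot> cright X \<alpha>"
  using assms uid_tcod[of "tdom X c" \<alpha>] by (simp_all add: app_def)

lemma ccomp_app [simp]:
  assumes "c \<in> tights X" "\<alpha> \<in> cells X" "ccod X \<alpha> = uid X (tdom X c)"
    "cell_path X h \<Psi> (pend h \<Psi>)" "map (ccod X) \<Psi> = cdom X \<alpha>" "tcod X h = tdom X (cleft X \<alpha>)"
  shows "ccomp X (app c \<alpha>) h \<Psi> = app c (ccomp X \<alpha> h \<Psi>)"
proof -
  have "length (cdom X \<alpha>) = length \<Psi>"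
    using arg_cong[OF assms(5), of length] by simp
  then show ?thesis
    using assms uid_tcod[of "tdom X c" \<alpha>] by (simp add: app_def)
qed

lemma app_tunit [simp]:
  assumes "c \<in> tights X" "f \<in> tights X" "tcod X f = tdom X c"
  shows "app c (tunit f) = tunit (c \<cdot> f)"
proof -
  have "ccomp X (ccomp X (uid_map X c) (tid X (tdom X c)) [uid_cell X (tdom X c)]) f [] = tunit (c \<cdot> f)"
    using assms by (simp del: ccomp_ccomp)
  then show ?thesis
    using assms by (simp add: app_def tunit_def del: uid_map_simps(1))
qed

text \<open>Tested on the unit in the first argument: on the left the unit disappears inside
  \<open>app\<close>, on the right it becomes the factor \<open>tunit c\<close>, and both sides
  reduce to \<open>uid_map X c\<close>.\<close>

lemma uid_map_mult:
  assumes "c \<in> tights X" "tdom X c = A" "tcod X c = B"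
  shows "app c (uid_mult X A) = mult B (uid_map X c) (uid_map X c)" (is "?l = ?r")
proof -
  have A: "A \<in> obs X" "B \<in> obs X" using assms by auto
  have "ccomp X ?l (tid X A) [uid_cell X A, cid X (uid X A)] = uid_map X c"
    using A assms by (simp add: app_def)
  moreover have "ccomp X ?r (tid X A) [uid_cell X A, cid X (uid X A)] = uid_map X c"
    using A assms by simp
  ultimately have e: "ccomp X ?l (tid X A) (uid_cell X A # map (cid X) [uid X A]) = uid_map X c"
    "ccomp X ?r (tid X A) (uid_cell X A # map (cid X) [uid X A]) = uid_map X c"
    by simp_all
  have f: "framed X ?l [uid X A, uid X A] (uid X B) c c" "framed X ?r [uid X A, uid X A] (uid X B) c c"
    "framed X (uid_map X c) [uid X A] (uid X B) c c"
    using A assms by (simp_all add: framed_def)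
  show ?thesis
  proof (rule uid_eqI_left[of A _ _ "[uid X A]"])
    show "framed X (ccomp X ?l (tid X A) (uid_cell X A # map (cid X) [uid X A])) [uid X A]
      (ccod X ?l) (cleft X ?l) (cright X ?l)"
      unfolding e using f by (simp only: framed_def simp_thms)
  qed (use A assms f e in \<open>auto simp only: framed_def\<close>)
qed

lemma app_mult [simp]:
  assumes "c \<in> tights X" "tdom X c = A" "tcod X c = B" "\<alpha> \<in> cells X" "\<beta> \<in> cells X"
    "ccod X \<alpha> = uid X A" "ccod X \<beta> = uid X A" "cright X \<alpha> = cleft X \<beta>"
  shows "app c (mult A \<alpha> \<beta>) = mult B (app c \<alpha>) (app c \<beta>)"
proof -
  have A: "A \<in> obs X" "B \<in> obs X" using assms by auto
  note t = uid_tcod[of A \<alpha>] uid_tcod[of A \<beta>]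
  have "ccomp X (app c (uid_mult X A)) (cleft X \<alpha>) [\<alpha>, \<beta>] = app c (mult A \<alpha> \<beta>)"
    using assms t A by (simp add: mult_def)
  moreover have "ccomp X (mult B (uid_map X c) (uid_map X c)) (cleft X \<alpha>) [\<alpha>, \<beta>] = mult B (app c \<alpha>) (app c \<beta>)"
    using assms t A by (simp add: app_def)
  ultimately show ?thesis using uid_map_mult[OF assms(1-3)] by simp
qed

lemma uid_map_tcomp:
  assumes "c \<in> tights X" "d \<in> tights X" "tcod X d = tdom X c"
  shows "uid_map X (c \<cdot> d) = app c (uid_map X d)"
  by (rule uid_eqI0[of "tdom X d"]) (use assms in simp_all)

lemma app_app [simp]:
  assumes "c \<in> tights X" "d \<in> tights X" "tcod X d = tdom X c" "\<alpha> \<in> cells X"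
    "ccod X \<alpha> = uid X (tdom X d)"
  shows "app c (app d \<alpha>) = app (c \<cdot> d) \<alpha>"
  using assms uid_tcod[of "tdom X d" \<alpha>] by (simp add: app_def[of "c \<cdot> d"] uid_map_tcomp)
    (simp add: app_def)

lemma uid_map_tid [simp]: "A \<in> obs X \<Longrightarrow> uid_map X (tid X A) = cid X (uid X A)"
  by (rule uid_eqI0[of A]) (simp_all add: tunit_def)

lemma app_tid [simp]:
  "A \<in> obs X \<Longrightarrow> \<alpha> \<in> cells X \<Longrightarrow> ccod X \<alpha> = uid X A \<Longrightarrow> app (tid X A) \<alpha> = \<alpha>"
  using uid_tcod[of A \<alpha>] by (simp add: app_def)

section \<open>Transposition along cartesian 2-cells\<close>

lemma hom_cell_restriction:
  assumes "x \<in> tights X" "y \<in> tights X" "tcod X x = tcod X y"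
  shows "exhibits_restriction X (uid X (tcod X x)) x y (hom_cell X x y)"
proof -
  have "\<exists>\<kappa>. exhibits_restriction X (uid X (tcod X x)) x y \<kappa>"
    by (rule ex_restriction) (use assms in simp_all)
  then show ?thesis
    unfolding hom_cell_def restr_cell_def by (rule someI_ex)
qed

lemma hom_cell_framed:
  assumes "x \<in> tights X" "y \<in> tights X" "tcod X x = tcod X y"
  shows "framed X (hom_cell X x y) [hom X x y] (uid X (tcod X x)) x y"
    and "hom X x y \<in> looses X" "ltgt X (hom X x y) = tdom X x" "lsrc X (hom X x y) = tdom X y"
proof -
  show f: "framed X (hom_cell X x y) [hom X x y] (uid X (tcod X x)) x y"
  proof -
    obtain p where "cdom X (hom_cell X x y) = [p]" "hom_cell X x y \<in> cells X"
      using hom_cell_restriction[OF assms] unfolding exhibits_restriction_def cartesian_def by metis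
    then show ?thesis
      using hom_cell_restriction[OF assms]
      by (simp add: exhibits_restriction_def framed_def hom_def restr_def hom_cell_def)
  qed
  have "chain X (tdom X x) [hom X x y] (tdom X y)"
    using cell_dom[of "hom_cell X x y"] f unfolding framed_def by metis
  then show "hom X x y \<in> looses X" "ltgt X (hom X x y) = tdom X x" "lsrc X (hom X x y) = tdom X y"
    unfolding chain.simps by metis+
qed

lemmas hom_simps [simp] = hom_cell_framed(2-4)
  hom_cell_framed(1)[unfolded framed_def, THEN conjunct1]
  hom_cell_framed(1)[unfolded framed_def, THEN conjunct2, THEN conjunct1]
  hom_cell_framed(1)[unfolded framed_def, THEN conjunct2, THEN conjunct2, THEN conjunct1]
  hom_cell_framed(1)[unfolded framed_def, THEN conjunct2, THEN conjunct2, THEN conjunct2, THEN conjunct1]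
  hom_cell_framed(1)[unfolded framed_def, THEN conjunct2, THEN conjunct2, THEN conjunct2, THEN conjunct2]

text \<open>\<open>lift x y f g \<gamma>\<close> is the factorisation through \<open>E(x,y)\<close> of a 2-cell \<open>\<gamma>\<close> into the loose-identity
  of \<open>E\<close> with left \<open>xf\<close> and right \<open>yg\<close>.\<close>

definition lift :: "'b \<Rightarrow> 'b \<Rightarrow> 'b \<Rightarrow> 'b \<Rightarrow> 'd \<Rightarrow> 'd" where
  "lift x y f g \<gamma> = (THE \<phi>. framed X \<phi> (cdom X \<gamma>) (hom X x y) f g \<and>
     ccomp X (hom_cell X x y) f [\<phi>] = \<gamma>)"

lemma ex1_lift:
  assumes "x \<in> tights X" "y \<in> tights X" "tcod X x = E" "tcod X y = E"
    "f \<in> tights X" "g \<in> tights X" "tcod X f = tdom X x" "tcod X g = tdom X y"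
    "\<gamma> \<in> cells X" "ccod X \<gamma> = uid X E" "cleft X \<gamma> = x \<cdot> f" "cright X \<gamma> = y \<cdot> g"
  shows "\<exists>!\<phi>. framed X \<phi> (cdom X \<gamma>) (hom X x y) f g \<and>
     ccomp X (hom_cell X x y) f [\<phi>] = \<gamma>"
proof -
  have r: "cartesian X (hom_cell X x y)"
    using hom_cell_restriction[of x y] assms by (simp add: exhibits_restriction_def)
  have "\<exists>!\<phi>. framed X \<phi> (cdom X \<gamma>) (hom X x y) f g \<and> hom_cell X x y \<star> [\<phi>] = \<gamma>"
    using r[unfolded cartesian_def, THEN conjunct2, THEN conjunct2, rule_format, of \<gamma> f g] assms
    by simp
  moreover have "(framed X \<phi> (cdom X \<gamma>) (hom X x y) f g \<and> hom_cell X x y \<star> [\<phi>] = \<gamma>) \<longleftrightarrow>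
    (framed X \<phi> (cdom X \<gamma>) (hom X x y) f g \<and> ccomp X (hom_cell X x y) f [\<phi>] = \<gamma>)" for \<phi>
    by (auto simp: paste_def framed_def)
  ultimately show ?thesis by simp
qed

lemma lift_framed:
  assumes "x \<in> tights X" "y \<in> tights X" "tcod X x = E" "tcod X y = E"
    "f \<in> tights X" "g \<in> tights X" "tcod X f = tdom X x" "tcod X g = tdom X y"
    "\<gamma> \<in> cells X" "ccod X \<gamma> = uid X E" "cleft X \<gamma> = x \<cdot> f" "cright X \<gamma> = y \<cdot> g"
  shows "framed X (lift x y f g \<gamma>) (cdom X \<gamma>) (hom X x y) f g \<and>
     ccomp X (hom_cell X x y) f [lift x y f g \<gamma>] = \<gamma>"
  unfolding lift_def by (rule theI'[OF ex1_lift[OF assms]])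

lemmas lift_simps [simp] = lift_framed[THEN conjunct2]
  lift_framed[THEN conjunct1, unfolded framed_def, THEN conjunct1]
  lift_framed[THEN conjunct1, unfolded framed_def, THEN conjunct2, THEN conjunct1]
  lift_framed[THEN conjunct1, unfolded framed_def, THEN conjunct2, THEN conjunct2, THEN conjunct1]
  lift_framed[THEN conjunct1, unfolded framed_def, THEN conjunct2, THEN conjunct2, THEN conjunct2, THEN conjunct1]
  lift_framed[THEN conjunct1, unfolded framed_def, THEN conjunct2, THEN conjunct2, THEN conjunct2, THEN conjunct2]

lemma lift_eqI:
  assumes "x \<in> tights X" "y \<in> tights X" "tcod X x = tcod X y"
    "\<phi> \<in> cells X" "ccod X \<phi> = hom X x y" "cleft X \<phi> = f" "cright X \<phi> = g"
    "ccomp X (hom_cell X x y) f [\<phi>] = \<gamma>"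
  shows "lift x y f g \<gamma> = \<phi>"
proof -
  have t: "tcod X f = tdom X x" "tcod X g = tdom X y" "f \<in> tights X" "g \<in> tights X"
    using assms tcod_cleft[of \<phi>] tcod_cright[of \<phi>] by auto
  have \<gamma>: "\<gamma> \<in> cells X" "ccod X \<gamma> = uid X (tcod X x)" "cleft X \<gamma> = x \<cdot> f" "cright X \<gamma> = y \<cdot> g"
    "cdom X \<gamma> = cdom X \<phi>"
    using assms t by auto
  have "framed X \<phi> (cdom X \<gamma>) (hom X x y) f g"
    using assms \<gamma> by (simp add: framed_def)
  moreover have "\<exists>!\<phi>. framed X \<phi> (cdom X \<gamma>) (hom X x y) f g \<and>
     ccomp X (hom_cell X x y) f [\<phi>] = \<gamma>"
    by (rule ex1_lift[where E="tcod X x"]) (use assms(1-3) t \<gamma> in simp_all)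
  ultimately show ?thesis
    unfolding lift_def using assms(8) by (intro the1_equality) simp_all
qed

lemma lift_hom_cell [simp]:
  assumes "x \<in> tights X" "y \<in> tights X" "tcod X x = tcod X y"
    "\<phi> \<in> cells X" "ccod X \<phi> = hom X x y" "cleft X \<phi> = f" "cright X \<phi> = g"
  shows "lift x y f g (ccomp X (hom_cell X x y) f [\<phi>]) = \<phi>"
  using lift_eqI[OF assms refl] .

lemma lift_hom_cell_tid [simp]:
  assumes "x \<in> tights X" "y \<in> tights X" "tcod X x = tcod X y" "tdom X x = A" "tdom X y = B"
  shows "lift x y (tid X A) (tid X B) (hom_cell X x y) = cid X (hom X x y)"
  by (rule lift_eqI) (use assms in simp_all)

lemma hom_eqI:
  assumes "x \<in> tights X" "y \<in> tights X" "tcod X x = tcod X y"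
    "\<phi> \<in> cells X" "ccod X \<phi> = hom X x y" "\<psi> \<in> cells X" "ccod X \<psi> = hom X x y"
    "cleft X \<phi> = cleft X \<psi>" "cright X \<phi> = cright X \<psi>"
    "ccomp X (hom_cell X x y) (cleft X \<phi>) [\<phi>] = ccomp X (hom_cell X x y) (cleft X \<psi>) [\<psi>]"
  shows "\<phi> = \<psi>"
  using lift_hom_cell[of x y \<phi> "cleft X \<phi>" "cright X \<phi>"]
    lift_hom_cell[of x y \<psi> "cleft X \<psi>" "cright X \<psi>"] assms by metis

text \<open>Cartesian 2-cells are cancellable. Through this equivalence each axiom stated for
  2-cells into some \<open>E(x,y)\<close> is translated into the calculus.\<close>

lemma hom_eq_iff:
  assumes "x \<in> tights X" "y \<in> tights X" "tcod X x = tcod X y"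
    "\<phi> \<in> cells X" "ccod X \<phi> = hom X x y" "\<psi> \<in> cells X" "ccod X \<psi> = hom X x y"
    "cleft X \<phi> = f" "cleft X \<psi> = f" "cright X \<phi> = cright X \<psi>"
  shows "\<phi> = \<psi> \<longleftrightarrow> ccomp X (hom_cell X x y) f [\<phi>] = ccomp X (hom_cell X x y) f [\<psi>]"
  using hom_eqI[of x y \<phi> \<psi>] assms by auto

text \<open>Both sides have the same composite with the cartesian 2-cell, so substitution commutes
  with transposition.\<close>

lemma ccomp_lift [simp]:
  assumes "x \<in> tights X" "y \<in> tights X" "tcod X x = E" "tcod X y = E"
    "f \<in> tights X" "g \<in> tights X" "tcod X f = tdom X x" "tcod X g = tdom X y"
    "\<gamma> \<in> cells X" "ccod X \<gamma> = uid X E" "cleft X \<gamma> = x \<cdot> f" "cright X \<gamma> = y \<cdot> g"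
    "cell_path X h \<Psi> (pend h \<Psi>)" "map (ccod X) \<Psi> = cdom X \<gamma>" "tcod X h = tdom X f"
  shows "ccomp X (lift x y f g \<gamma>) h \<Psi> = lift x y (f \<cdot> h) (g \<cdot> pend h \<Psi>) (ccomp X \<gamma> h \<Psi>)"
proof -
  have h: "h \<in> tights X" "pend h \<Psi> \<in> tights X"
    using cell_path_tights[OF assms(13)] by auto
  have len: "length (cdom X \<gamma>) = length \<Psi>"
    using arg_cong[OF assms(14), of length] by simp
  have d: "tcod X (pend h \<Psi>) = tdom X g"
    using cell_path_tcod[OF assms(13), of "tdom X g"] cell_dom[of \<gamma>] assms by simp
  have "ccomp X (ccomp X (hom_cell X x y) f [lift x y f g \<gamma>]) h \<Psi> = ccomp X \<gamma> h \<Psi>"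
    using assms by simp
  moreover have "ccomp X (ccomp X (hom_cell X x y) f [lift x y f g \<gamma>]) h \<Psi> =
    ccomp X (hom_cell X x y) (f \<cdot> h) [ccomp X (lift x y f g \<gamma>) h \<Psi>]"
    using assms h len by (simp del: lift_simps(1))
  ultimately have "ccomp X (hom_cell X x y) (f \<cdot> h) [ccomp X (lift x y f g \<gamma>) h \<Psi>] = ccomp X \<gamma> h \<Psi>"
    by simp
  then show ?thesis
    by (intro lift_eqI[symmetric]) (use assms h d in simp_all)
qed

lemma the_lift:
  assumes "x \<in> tights X" "y \<in> tights X" "tcod X x = E" "tcod X y = E"
    "f \<in> tights X" "g \<in> tights X" "tcod X f = tdom X x" "tcod X g = tdom X y"
    "\<gamma> \<in> cells X" "ccod X \<gamma> = uid X E" "cleft X \<gamma> = x \<cdot> f" "cright X \<gamma> = y \<cdot> g" "ps = cdom X \<gamma>"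
  shows "(THE \<phi>. framed X \<phi> ps (hom X x y) f g \<and> hom_cell X x y \<star> [\<phi>] = \<gamma>) = lift x y f g \<gamma>"
proof -
  have "(framed X \<phi> ps (hom X x y) f g \<and> hom_cell X x y \<star> [\<phi>] = \<gamma>) \<longleftrightarrow>
    (framed X \<phi> (cdom X \<gamma>) (hom X x y) f g \<and> ccomp X (hom_cell X x y) f [\<phi>] = \<gamma>)" for \<phi>
    using assms(13) by (auto simp: paste_def framed_def)
  then show ?thesis by (simp add: lift_def)
qed

lemma the_lift_globular:
  assumes "x \<in> tights X" "y \<in> tights X" "tcod X x = E" "tcod X y = E"
    "\<gamma> \<in> cells X" "ccod X \<gamma> = uid X E" "cleft X \<gamma> = x" "cright X \<gamma> = y" "ps = cdom X \<gamma>"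
  shows "(THE \<phi>. globular X \<phi> ps (hom X x y) \<and> hom_cell X x y \<star> [\<phi>] = \<gamma>) =
    lift x y (tid X (tdom X x)) (tid X (tdom X y)) \<gamma>"
proof -
  have "globular X \<phi> ps (hom X x y) \<longleftrightarrow>
    framed X \<phi> ps (hom X x y) (tid X (tdom X x)) (tid X (tdom X y))" for \<phi>
    using assms(1-4) by (simp add: globular_def)
  moreover have "(THE \<phi>. framed X \<phi> ps (hom X x y) (tid X (tdom X x)) (tid X (tdom X y)) \<and>
    hom_cell X x y \<star> [\<phi>] = \<gamma>) = lift x y (tid X (tdom X x)) (tid X (tdom X y)) \<gamma>"
    by (rule the_lift) (use assms in simp_all)
  ultimately show ?thesis by simp
qed

section \<open>The canonical 2-cells and restrictions of 2-cells as transposes\<close>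

lemma hom_res_eq:
  assumes "x \<in> tights X" "y \<in> tights X" "tcod X x = E" "tcod X y = E"
    "f \<in> tights X" "g \<in> tights X" "tcod X f = tdom X x" "tcod X g = tdom X y"
  shows "hom_res X x y f g = lift x y f g (hom_cell X (x \<cdot> f) (y \<cdot> g))"
  unfolding hom_res_def by (rule the_lift) (use assms in simp_all)

lemma smile_eq:
  assumes "x \<in> tights X" "y \<in> tights X" "t \<in> tights X" "tcod X x = E" "tcod X y = E" "tcod X t = E"
  shows "smile X t x y = lift x y (tid X (tdom X x)) (tid X (tdom X y))
    (mult E (hom_cell X x t) (hom_cell X t y))"
proof -
  have "uid_mult X (tcod X x) \<star> [hom_cell X x t, hom_cell X t y] =
    mult E (hom_cell X x t) (hom_cell X t y)"
    using assms by (simp add: paste_def mult_def)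
  moreover have "E \<in> obs X" using assms by auto
  ultimately show ?thesis
    unfolding smile_def
    using the_lift_globular[of x y E "mult E (hom_cell X x t) (hom_cell X t y)" "[hom X x t, hom X t y]"]
      assms by simp
qed

lemma frown_eq:
  assumes "f \<in> tights X"
  shows "frown X f = lift f f (tid X (tdom X f)) (tid X (tdom X f)) (tunit f)"
  unfolding frown_def tunit_def[symmetric]
  by (rule the_lift_globular) (use assms in simp_all)

lemma frown_at_eq:
  assumes "x \<in> tights X" "y \<in> tights X" "c \<in> tights X" "tcod X x = tdom X c" "tcod X y = tdom X c"
  shows "frown_at X c x y =
    lift (c \<cdot> x) (c \<cdot> y) (tid X (tdom X x)) (tid X (tdom X y)) (app c (hom_cell X x y))"
proof -
  have "uid_map X c \<star> [hom_cell X x y] = app c (hom_cell X x y)"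
    using assms by (simp add: paste_def app_def)
  then show ?thesis
    unfolding frown_at_def
    using the_lift_globular[of "c \<cdot> x" "c \<cdot> y" "tcod X c" "app c (hom_cell X x y)" "[hom X x y]"]
      assms by simp
qed

lemma whisker_eq:
  assumes "tight2 X \<tau> f g" "h \<in> tights X" "tcod X h = tdom X f"
  shows "whisker X f g \<tau> h = lift (f \<cdot> h) (g \<cdot> h) (tid X (tdom X h)) (tid X (tdom X h))
    (ccomp X (hom_cell X f g) h [ccomp X \<tau> h []])"
proof -
  have \<tau>: "f \<in> tights X" "g \<in> tights X" "tdom X f = tdom X g" "tcod X f = tcod X g"
    "\<tau> \<in> cells X" "cdom X \<tau> = []" "ccod X \<tau> = hom X f g" "cleft X \<tau> = tid X (tdom X g)"
    "cright X \<tau> = tid X (tdom X g)" "tcod X h = tdom X g"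
    using assms by (auto simp: tight2_def globular_def framed_def)
  \<comment> \<open>Whiskering is defined through \<open>hom_res\<close>, transposition through
    \<open>hom_cell\<close>. Composing with the cancellable \<open>hom_cell X f g\<close> converts
    one condition into the other.\<close>
  have "(globular X \<gamma> [] (hom X (f \<cdot> h) (g \<cdot> h)) \<and> hom_res X f g h h \<star> [\<gamma>] = ccomp X \<tau> h []) \<longleftrightarrow>
    (globular X \<gamma> [] (hom X (f \<cdot> h) (g \<cdot> h)) \<and> hom_cell X (f \<cdot> h) (g \<cdot> h) \<star> [\<gamma>] =
      ccomp X (hom_cell X f g) h [ccomp X \<tau> h []])" (is "?G \<and> ?L \<longleftrightarrow> ?G \<and> ?R") for \<gamma>
  proof (cases ?G)
    case True
    then have "?L \<longleftrightarrow> ccomp X (hom_cell X f g) h [hom_res X f g h h \<star> [\<gamma>]] =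
      ccomp X (hom_cell X f g) h [ccomp X \<tau> h []]"
      using \<tau> assms(2)
      by (intro hom_eq_iff[of f g]) (simp_all add: globular_def framed_def paste_def hom_res_eq)
    also have "\<dots> \<longleftrightarrow> ?R"
      using \<tau> assms(2) True by (simp add: globular_def framed_def paste_def hom_res_eq)
    finally show ?thesis using True by simp
  qed simp
  then show ?thesis
    unfolding whisker_def
    using the_lift_globular[of "f \<cdot> h" "g \<cdot> h" "tcod X f" "ccomp X (hom_cell X f g) h [ccomp X \<tau> h []]" "[]"]
      \<tau> assms(2) by simp
qed

text \<open>Uniqueness holds because \<open>hom_res\<close> followed by
  \<open>hom_cell X x' y'\<close> is \<open>hom_cell X x' (y' \<cdot> g)\<close>, which is
  cancellable.\<close>

lemma restr_right_eqI:
  assumes "x \<in> tights X" "y \<in> tights X" "tcod X x = tcod X y"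
    "x' \<in> tights X" "y' \<in> tights X" "tcod X x' = tcod X y'"
    "g \<in> tights X" "tcod X g = tdom X y" "tdom X y' = tdom X y"
    "globular X \<gamma> (butlast (cdom X \<phi>) @ [hom X x (y \<cdot> g)]) (hom X x' (y' \<cdot> g))"
    "hom_res X x' y' (tid X (tdom X x')) g \<star> [\<gamma>] =
      \<phi> \<star> (map (cid X) (butlast (cdom X \<phi>)) @ [hom_res X x y (tid X (tdom X x)) g])"
  shows "restr_right X \<phi> x y x' y' g = \<gamma>"
  unfolding restr_right_def
proof (rule the_equality)
  fix \<delta> assume \<delta>: "globular X \<delta> (butlast (cdom X \<phi>) @ [hom X x (y \<cdot> g)]) (hom X x' (y' \<cdot> g)) \<and>
    hom_res X x' y' (tid X (tdom X x')) g \<star> [\<delta>] =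
      \<phi> \<star> (map (cid X) (butlast (cdom X \<phi>)) @ [hom_res X x y (tid X (tdom X x)) g])"
  then have \<delta>1: "globular X \<delta> (butlast (cdom X \<phi>) @ [hom X x (y \<cdot> g)]) (hom X x' (y' \<cdot> g))"
    and e: "hom_res X x' y' (tid X (tdom X x')) g \<star> [\<delta>] = hom_res X x' y' (tid X (tdom X x')) g \<star> [\<gamma>]"
    using assms(11) by simp_all
  note ty = \<delta>1[unfolded globular_def framed_def] assms(10)[unfolded globular_def framed_def]
  have "ccomp X (hom_cell X x' y') (tid X (tdom X x')) [hom_res X x' y' (tid X (tdom X x')) g \<star> [\<phi>']] =
    ccomp X (hom_cell X x' (y' \<cdot> g)) (tid X (tdom X x')) [\<phi>']"
    if "globular X \<phi>' (butlast (cdom X \<phi>) @ [hom X x (y \<cdot> g)]) (hom X x' (y' \<cdot> g))" for \<phi>'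
    using that assms(1-9) by (simp add: globular_def framed_def paste_def hom_res_eq)
  from this[OF \<delta>1] this[OF assms(10)] e
  have "ccomp X (hom_cell X x' (y' \<cdot> g)) (tid X (tdom X x')) [\<delta>] =
    ccomp X (hom_cell X x' (y' \<cdot> g)) (tid X (tdom X x')) [\<gamma>]"
    by simp
  note e' = this
  show "\<delta> = \<gamma>"
    by (rule hom_eqI[of x' "y' \<cdot> g"]) (use assms(1-9) ty e' in simp_all)
qed (use assms(10,11) in blast)

text \<open>Two lengths of domain occur: a single loose-cell for \<open>\<sharp>\<close> and
  \<open>\<flat>\<close>, and three loose-cells for the bent 2-cells below.\<close>

lemma restr_right_unary:
  assumes "x \<in> tights X" "y \<in> tights X" "tcod X x = tcod X y"
    "x' \<in> tights X" "y' \<in> tights X" "tcod X x' = tcod X y'"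
    "g \<in> tights X" "tcod X g = tdom X y" "tdom X y' = tdom X y"
    "globular X \<phi> [hom X x y] (hom X x' y')" "tdom X x' = tdom X x"
  shows "restr_right X \<phi> x y x' y' g = lift x' (y' \<cdot> g) (tid X (tdom X x)) (tid X (tdom X g))
    (ccomp X (hom_cell X x' y') (tid X (tdom X x))
      [ccomp X \<phi> (tid X (tdom X x)) [hom_res X x y (tid X (tdom X x)) g]])"
    (is "_ = ?\<gamma>")
proof (rule restr_right_eqI)
  show "hom_res X x' y' (tid X (tdom X x')) g \<star> [?\<gamma>] =
      \<phi> \<star> (map (cid X) (butlast (cdom X \<phi>)) @ [hom_res X x y (tid X (tdom X x)) g])"
    by (rule hom_eqI[of x' y'])
      (use assms in \<open>simp_all add: globular_def framed_def paste_def hom_res_eq\<close>)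
qed (use assms in \<open>simp_all add: globular_def framed_def hom_res_eq\<close>)

lemma restr_right_ternary:
  assumes "x \<in> tights X" "y \<in> tights X" "tcod X x = tcod X y"
    "x' \<in> tights X" "y' \<in> tights X" "tcod X x' = tcod X y'"
    "g \<in> tights X" "tcod X g = tdom X y" "tdom X y' = tdom X y"
    "globular X \<phi> [p, q, hom X x y] (hom X x' y')"
    "p \<in> looses X" "q \<in> looses X" "ltgt X p = tdom X x'" "lsrc X p = ltgt X q" "lsrc X q = tdom X x"
  shows "restr_right X \<phi> x y x' y' g = lift x' (y' \<cdot> g) (tid X (tdom X x')) (tid X (tdom X g))
    (ccomp X (hom_cell X x' y') (tid X (tdom X x'))
      [ccomp X \<phi> (tid X (tdom X x')) [cid X p, cid X q, hom_res X x y (tid X (tdom X x)) g]])"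
    (is "_ = ?\<gamma>")
proof (rule restr_right_eqI)
  show "hom_res X x' y' (tid X (tdom X x')) g \<star> [?\<gamma>] =
      \<phi> \<star> (map (cid X) (butlast (cdom X \<phi>)) @ [hom_res X x y (tid X (tdom X x)) g])"
    by (rule hom_eqI[of x' y'])
      (use assms in \<open>simp_all add: globular_def framed_def paste_def hom_res_eq\<close>)
qed (use assms in \<open>simp_all add: globular_def framed_def hom_res_eq\<close>)

section \<open>Naturality\<close>

abbreviation hat :: "'b \<Rightarrow> 'b \<Rightarrow> 'd \<Rightarrow> 'd" where
  "hat x y \<phi> \<equiv> ccomp X (hom_cell X x y) (cleft X \<phi>) [\<phi>]"

abbreviation lift1 :: "'b \<Rightarrow> 'b \<Rightarrow> 'd \<Rightarrow> 'd" where
  "lift1 x y \<gamma> \<equiv> lift x y (tid X (tdom X x)) (tid X (tdom X y)) \<gamma>"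

text \<open>The interchange law for a 2-cell \<open>r \<Rightarrow> s\<close> and an arbitrary
  2-cell into \<open>C(1,1)\<close>. In the universal case \<open>\<sigma>\<close> is the identity
  of \<open>C(1,1)\<close>, and both sides become \<open>\<rho>\<close> once the unit is
  inserted.\<close>

lemma uid_naturality:
  assumes "r \<in> tights X" "s \<in> tights X" "tdom X r = C" "tdom X s = C" "tcod X r = E" "tcod X s = E"
    "\<rho> \<in> cells X" "cdom X \<rho> = []" "ccod X \<rho> = uid X E" "cleft X \<rho> = r" "cright X \<rho> = s"
    "\<sigma> \<in> cells X" "ccod X \<sigma> = uid X C" "cleft X \<sigma> = g" "cright X \<sigma> = h"
  shows "mult E (app r \<sigma>) (ccomp X \<rho> h []) = mult E (ccomp X \<rho> g []) (app s \<sigma>)"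
proof -
  have ob: "C \<in> obs X" "E \<in> obs X" using assms by auto
  have t: "tcod X g = C" "tcod X h = C" "g \<in> tights X" "h \<in> tights X"
    using uid_tcod[of C \<sigma>] assms ob by auto
  have "mult E (uid_map X r) \<rho> = mult E \<rho> (uid_map X s)"
    by (rule uid_eqI0[of C]) (use assms ob in simp_all)
  then have "ccomp X (mult E (uid_map X r) \<rho>) g [\<sigma>] = ccomp X (mult E \<rho> (uid_map X s)) g [\<sigma>]"
    by simp
  then show ?thesis
    using assms ob t by (simp add: app_def)
qed

text \<open>It suffices to treat the universal \<open>\<gamma>\<close> and \<open>\<sigma>\<close>,
  namely the cartesian 2-cell of \<open>B(x,b)\<close> and the identity of \<open>C(1,1)\<close>;
  the general case follows by substitution. Instantiated at identities of tight-cells, this plays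
  the part of the Yoneda lemma.\<close>

lemma hom_naturality:
  assumes "x \<in> tights X" "b \<in> tights X" "tcod X x = B" "tcod X b = B" "tdom X b = C"
    "b' \<in> tights X" "tdom X b' = C" "tcod X b' = B'"
    "\<beta> \<in> cells X" "cdom X \<beta> = [hom X x b]" "ccod X \<beta> = uid X B'" "cright X \<beta> = b'"
    "tdom X (cleft X \<beta>) = tdom X x"
    "\<gamma> \<in> cells X" "ccod X \<gamma> = uid X B" "cleft X \<gamma> = x \<cdot> h" "cright X \<gamma> = b \<cdot> g"
    "h \<in> tights X" "tcod X h = tdom X x"
    "\<sigma> \<in> cells X" "ccod X \<sigma> = uid X C" "cleft X \<sigma> = g" "cright X \<sigma> = g'"
  shows "ccomp X \<beta> h [lift x b h g' (mult B \<gamma> (app b \<sigma>))] =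
    mult B' (ccomp X \<beta> h [lift x b h g \<gamma>]) (app b' \<sigma>)"
proof -
  define D where "D = tdom X x"
  have ob: "B \<in> obs X" "B' \<in> obs X" "C \<in> obs X" "D \<in> obs X" using assms by (auto simp: D_def)
  have t: "tcod X g = C" "tcod X g' = C" "g \<in> tights X" "g' \<in> tights X"
    using uid_tcod[of C \<sigma>] assms ob by auto
  have bc: "tcod X (cleft X \<beta>) = B'"
    using uid_tcod[of B' \<beta>] assms ob by auto
  \<comment> \<open>The universal case: inserting the unit of \<open>C(1,1)\<close> in the second
    argument turns both sides into \<open>\<beta>\<close>.\<close>
  have "ccomp X \<beta> (tid X D) [lift x b (tid X D) (tid X C) (mult B (hom_cell X x b) (uid_map X b))] =
    mult B' \<beta> (uid_map X b')" (is "?l = ?r")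
  proof (rule uid_eqI_right1[of C _ _ "hom X x b"])
    have "ccomp X ?l (tid X D) [cid X (hom X x b), uid_cell X C] = \<beta>"
      using assms ob by (simp add: D_def[symmetric])
    moreover have "ccomp X ?r (tid X D) [cid X (hom X x b), uid_cell X C] = \<beta>"
      using assms ob by (simp add: D_def[symmetric])
    ultimately show "ccomp X ?l (tid X (ltgt X (hom X x b))) [cid X (hom X x b), uid_cell X C] =
      ccomp X ?r (tid X (ltgt X (hom X x b))) [cid X (hom X x b), uid_cell X C]"
      using assms by (simp add: D_def)
  qed (use assms ob bc in \<open>simp_all add: D_def[symmetric]\<close>)
  then have "ccomp X ?l h [lift x b h g \<gamma>, \<sigma>] = ccomp X ?r h [lift x b h g \<gamma>, \<sigma>]"
    by simp
  then show ?thesis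
    using assms ob t bc by (simp add: app_def[of _ \<sigma>] D_def[symmetric])
qed

lemma tight2D:
  assumes "tight2 X \<tau> f g"
  shows "f \<in> tights X" "g \<in> tights X" "tdom X f = tdom X g" "tcod X f = tcod X g"
    "\<tau> \<in> cells X" "cdom X \<tau> = []" "ccod X \<tau> = hom X f g" "cleft X \<tau> = tid X (tdom X f)"
    "cright X \<tau> = tid X (tdom X f)"
  using assms by (auto simp: tight2_def globular_def framed_def)

lemma hom_post_eq:
  assumes "tight2 X \<tau> f g" "x \<in> tights X" "tcod X x = E" "tcod X g = E"
  shows "hom_post X x f g \<tau> = lift1 x g (mult E (hom_cell X x f) (hat f g \<tau>))"
proof -
  note \<tau> = tight2D[OF assms(1)]
  have "E \<in> obs X" using assms by auto
  then show ?thesis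
    using \<tau> assms by (simp add: hom_post_def smile_eq paste_def)
qed

lemma hom_pre_eq:
  assumes "tight2 X \<tau> f g" "x \<in> tights X" "tcod X x = E" "tcod X g = E"
  shows "hom_pre X f g \<tau> x = lift1 f x (mult E (hat f g \<tau>) (hom_cell X g x))"
proof -
  note \<tau> = tight2D[OF assms(1)]
  have "E \<in> obs X" using assms by auto
  then show ?thesis
    using \<tau> assms by (simp add: hom_pre_def smile_eq paste_def)
qed

lemma globularD:
  assumes "globular X \<phi> ps (hom X x y)" "x \<in> tights X" "y \<in> tights X" "tcod X x = tcod X y"
  shows "\<phi> \<in> cells X" "cdom X \<phi> = ps" "ccod X \<phi> = hom X x y"
    "cleft X \<phi> = tid X (tdom X x)" "cright X \<phi> = tid X (tdom X y)"
  using assms by (auto simp: globular_def framed_def)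

lemma globular_lift1:
  assumes "x \<in> tights X" "y \<in> tights X" "tcod X x = tcod X y"
    "\<gamma> \<in> cells X" "cdom X \<gamma> = ps" "ccod X \<gamma> = uid X (tcod X y)" "cleft X \<gamma> = x" "cright X \<gamma> = y"
  shows "globular X (lift1 x y \<gamma>) ps (hom X x y)"
  using assms by (simp add: globular_def framed_def)

lemma tight2_lift1:
  assumes "x \<in> tights X" "y \<in> tights X" "tdom X x = tdom X y" "tcod X x = E" "tcod X y = E"
    "\<gamma> \<in> cells X" "cdom X \<gamma> = []" "ccod X \<gamma> = uid X E" "cleft X \<gamma> = x" "cright X \<gamma> = y"
  shows "tight2 X (lift1 x y \<gamma>) x y"
  using assms globular_lift1[of x y \<gamma> "[]"] by (simp add: tight2_def)

section \<open>Relative monads and opalgebras\<close>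

text \<open>In the calculus the laws read \<open>\<eta> \<cdot> \<dagger> = 1\<close>,
  \<open>\<dagger>(\<eta>) = 1\<close> and
  \<open>\<dagger> \<cdot> \<dagger> = \<dagger>(1 \<cdot> \<dagger>)\<close>, where parentheses
  denote substitution and 1 the transpose of an identity. Each is obtained by cancelling a cartesian
  2-cell.\<close>

lemma rel_monad_iff:
  assumes "carr T = t" "globular X (ext T) [hom X j t] (hom X t t)" "tight2 X (eta T) j t" "tcod X t = E"
  shows "rel_monad X j T \<longleftrightarrow>
    mult E (hat j t (eta T)) (hat t t (ext T)) = hom_cell X j t \<and>
    ccomp X (hat t t (ext T)) (tid X (tdom X t)) [eta T] = tunit t \<and>
    mult E (hat t t (ext T)) (hat t t (ext T)) =
      ccomp X (hat t t (ext T)) (tid X (tdom X t)) [lift1 j t (mult E (hom_cell X j t) (hat t t (ext T)))]"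
    (is "_ \<longleftrightarrow> ?e1 \<and> ?e2 \<and> ?e3")
proof -
  note h = tight2D[OF assms(3)]
  note d = globularD[OF assms(2) h(2) h(2) refl]
  have E: "E \<in> obs X" "tcod X j = E" using h assms by auto
  have "hom_pre X j t (eta T) t \<star> [ext T] = cid X (hom X j t) \<longleftrightarrow> ?e1"
    by (subst hom_eq_iff[of j t _ _ "tid X (tdom X t)"])
      (use h d E assms in \<open>simp_all add: hom_pre_eq[where E=E] paste_def\<close>)
  moreover have "ext T \<star> [hom_post X j j t (eta T) \<star> [frown X j]] = frown X t \<longleftrightarrow> ?e2"
    by (subst hom_eq_iff[of t t _ _ "tid X (tdom X t)"])
      (use h d E assms in \<open>simp_all add: hom_post_eq[where E=E] paste_def frown_eq\<close>)
  moreover have "smile X t t t \<star> [ext T, ext T] = ext T \<star> [smile X t j t \<star> [cid X (hom X j t), ext T]] \<longleftrightarrow> ?e3"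
    by (subst hom_eq_iff[of t t _ _ "tid X (tdom X t)"])
      (use h d E assms in \<open>simp_all add: smile_eq[where E=E] paste_def\<close>)
  ultimately show ?thesis
    unfolding rel_monad_def Let_def using h assms by auto
qed

lemma rel_monadD:
  assumes "rel_monad X j T" "carr T = t"
  shows "globular X (ext T) [hom X j t] (hom X t t)" "tight2 X (eta T) j t"
  using assms by (simp_all add: rel_monad_def Let_def)

lemma opalgebra_iff:
  assumes "carr T = t" "globular X (ext T) [hom X j t] (hom X t t)" "tight2 X (eta T) j t" "tcod X t = E"
    "a \<in> tights X" "tdom X a = tdom X j" "globular X w [hom X j t] (hom X a a)" "tcod X a = B"
  shows "opalgebra X j T a w \<longleftrightarrow>
    ccomp X (hat a a w) (tid X (tdom X t)) [eta T] = tunit a \<and>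
    mult B (hat a a w) (hat a a w) =
      ccomp X (hat a a w) (tid X (tdom X t)) [lift1 j t (mult E (hom_cell X j t) (hat t t (ext T)))]"
    (is "_ \<longleftrightarrow> ?e2 \<and> ?e3")
proof -
  note h = tight2D[OF assms(3)]
  note d = globularD[OF assms(2) h(2) h(2) refl]
  note w = globularD[OF assms(7) assms(5) assms(5) refl]
  have E: "E \<in> obs X" "tcod X j = E" "B \<in> obs X" using h assms by auto
  have "w \<star> [hom_post X j j t (eta T) \<star> [frown X j]] = frown X a \<longleftrightarrow> ?e2"
    by (subst hom_eq_iff[of a a _ _ "tid X (tdom X t)"])
      (use h d E w assms in \<open>simp_all add: hom_post_eq[where E=E] paste_def frown_eq\<close>)
  moreover have "smile X a a a \<star> [w, w] = w \<star> [smile X t j t \<star> [cid X (hom X j t), ext T]] \<longleftrightarrow> ?e3"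
    by (subst hom_eq_iff[of a a _ _ "tid X (tdom X t)"])
      (use h d E w assms in \<open>simp_all add: smile_eq[where E=E] smile_eq[where E=B] paste_def\<close>)
  ultimately show ?thesis
    unfolding opalgebra_def Let_def using h assms by auto
qed

lemma opalgebraD:
  assumes "opalgebra X j T a w" "carr T = t"
  shows "a \<in> tights X" "tdom X a = tdom X j" "globular X w [hom X j t] (hom X a a)"
  using assms by (simp_all add: opalgebra_def Let_def)

lemma frown_at_paste:
  assumes "globular X w ps (hom X k k)" "k \<in> tights X" "b \<in> tights X" "tdom X b = tcod X k"
  shows "frown_at X b k k \<star> [w] = lift1 (b \<cdot> k) (b \<cdot> k) (app b (hat k k w))"
  using globularD[OF assms(1,2,2)] assms by (simp add: frown_at_eq paste_def)

text \<open>The laws of an opalgebra are equations between units, products and substitutions, all of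
  which \<open>app b\<close> preserves. Structures therefore push forward along tight-cells.\<close>

lemma opalgebra_tcomp:
  assumes "rel_monad X j T" "opalgebra X j T k w" "b \<in> tights X" "tdom X b = tcod X k"
  shows "opalgebra X j T (b \<cdot> k) (frown_at X b k k \<star> [w])"
proof -
  define t where "t = carr T"
  note T = rel_monadD[OF assms(1) t_def[symmetric]]
  note h = tight2D[OF T(2)]
  note d = globularD[OF T(1) h(2) h(2) refl]
  note k = opalgebraD[OF assms(2) t_def[symmetric]]
  note w = globularD[OF k(3,1,1) refl]
  have ob: "tcod X k \<in> obs X" "tcod X b \<in> obs X" "tcod X t \<in> obs X" using k assms h by auto
  have *: "ccomp X (hat k k w) (tid X (tdom X t)) [eta T] = tunit k"
    "mult (tcod X k) (hat k k w) (hat k k w) =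
      ccomp X (hat k k w) (tid X (tdom X t)) [lift1 j t (mult (tcod X t) (hom_cell X j t) (hat t t (ext T)))]"
    using opalgebra_iff[OF t_def[symmetric] T refl k refl] assms(2) by simp_all
  have c: "cleft X (hat k k w) = k" "cright X (hat k k w) = k" "hat k k w \<in> cells X"
    "ccod X (hat k k w) = uid X (tcod X k)" "cdom X (hat k k w) = [hom X j t]"
    using k w h by simp_all
  have g: "globular X (frown_at X b k k \<star> [w]) [hom X j t] (hom X (b \<cdot> k) (b \<cdot> k))"
    unfolding frown_at_paste[OF k(3,1) assms(3,4)]
    by (rule globular_lift1) (use k w assms h(1) in simp_all)
  have hat: "hat (b \<cdot> k) (b \<cdot> k) (frown_at X b k k \<star> [w]) = app b (hat k k w)"
    unfolding frown_at_paste[OF k(3,1) assms(3,4)] using k w assms h(1) by simp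
  have "ccomp X (app b (hat k k w)) (tid X (tdom X t)) [eta T] = app b (ccomp X (hat k k w) (tid X (tdom X t)) [eta T])"
    by (rule ccomp_app) (use assms(3,4) c h k in simp_all)
  also have "\<dots> = tunit (b \<cdot> k)"
    using assms(3,4) k by (simp only: * app_tunit)
  finally have 1: "ccomp X (app b (hat k k w)) (tid X (tdom X t)) [eta T] = tunit (b \<cdot> k)" .
  have "mult (tcod X b) (app b (hat k k w)) (app b (hat k k w)) = app b (mult (tcod X k) (hat k k w) (hat k k w))"
    by (rule app_mult[symmetric]) (use assms(3,4) c h k in simp_all)
  also have "\<dots> = ccomp X (app b (hat k k w)) (tid X (tdom X t)) [lift1 j t (mult (tcod X t) (hom_cell X j t) (hat t t (ext T)))]"
    unfolding * by (rule ccomp_app[symmetric]) (use assms(3,4) c h k d ob in simp_all)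
  finally have 2: "mult (tcod X b) (app b (hat k k w)) (app b (hat k k w)) =
    ccomp X (app b (hat k k w)) (tid X (tdom X t)) [lift1 j t (mult (tcod X t) (hom_cell X j t) (hat t t (ext T)))]" .
  show ?thesis
    by (subst opalgebra_iff[OF t_def[symmetric] T refl _ _ g refl])
      (use 1 2 hat k assms in simp_all)
qed

section \<open>Extension along an opalgebra object\<close>

text \<open>Since each tight-cell out of the opalgebra object mediates the structure that it
  induces, the 2-dimensional universal property, stated for mediators, becomes available for
  arbitrary tight-cells.\<close>

lemma opalg_mediator_tcomp:
  assumes "rel_monad X j T" "opalgebra_object X j T k wk" "b \<in> tights X" "tdom X b = tcod X k"
  shows "opalg_mediator X k wk (b \<cdot> k) (frown_at X b k k \<star> [wk]) = b"
proof -
  have o: "opalgebra X j T k wk" using assms(2) by (simp add: opalgebra_object_def)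
  then have k: "k \<in> tights X" by (simp add: opalgebra_def Let_def)
  have "\<exists>!b'. opalg_factor X k wk (b \<cdot> k) (frown_at X b k k \<star> [wk]) b'"
    using assms(2) opalgebra_tcomp[OF assms(1) o assms(3,4)] unfolding opalgebra_object_def by blast
  moreover have "opalg_factor X k wk (b \<cdot> k) (frown_at X b k k \<star> [wk]) b"
    using assms k by (simp add: opalg_factor_def)
  ultimately show ?thesis
    unfolding opalg_mediator_def by (intro the1_equality)
qed

text \<open>\<open>bend\<close> turns \<open>\<gamma> : B(x,b) \<Rightarrow> B'(f,b')\<close> into \<open>B'(1,f), B(x,1), B(1,b) \<Rightarrow> B'(1,b')\<close>, the shape of a
  graded opalgebra morphism. Its left inverse \<open>unbend\<close> plugs the units of \<open>f\<close> and \<open>x\<close> into the first two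
  arguments; it is used in place of the isomorphism \<open>B(x,b) \<cong> B(x,1) \<odot> B(1,b)\<close>.\<close>

definition bend :: "'b \<Rightarrow> 'b \<Rightarrow> 'b \<Rightarrow> 'b \<Rightarrow> 'd \<Rightarrow> 'd" where
  "bend x f b b' \<gamma> = lift1 (tid X (tcod X b')) b'
    (mult (tcod X b') (hom_cell X (tid X (tcod X b')) f)
      (ccomp X \<gamma> (tid X (tdom X x)) [smile X (tid X (tcod X b)) x b]))"

definition unbend :: "'b \<Rightarrow> 'b \<Rightarrow> 'b \<Rightarrow> 'b \<Rightarrow> 'd \<Rightarrow> 'd" where
  "unbend x f b b' \<beta> = ccomp X (hat (tid X (tcod X b')) b' \<beta>) f
    [lift (tid X (tcod X b')) f f (tid X (tdom X f)) (tunit f),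
     lift x (tid X (tcod X b)) (tid X (tdom X x)) x (tunit x),
     hom_res X (tid X (tcod X b)) b x (tid X (tdom X b))]"

context
  fixes x f b b' D B C B'
  assumes ty: "x \<in> tights X" "tdom X x = D" "tcod X x = B" "f \<in> tights X" "tdom X f = D" "tcod X f = B'"
    "b \<in> tights X" "tdom X b = C" "tcod X b = B" "b' \<in> tights X" "tdom X b' = C" "tcod X b' = B'"
begin

private lemma ob: "B \<in> obs X" "B' \<in> obs X" "C \<in> obs X" "D \<in> obs X"
  using ty by auto

lemma bend_globular:
  assumes "framed X \<gamma> [hom X x b] (uid X B') f b'"
  shows "globular X (bend x f b b' \<gamma>) [hom X (tid X B') f, hom X x (tid X B), hom X (tid X B) b]
    (hom X (tid X B') b')"
  using ty ob assms by (simp add: bend_def globular_def framed_def smile_eq[where E=B])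

lemma hat_bend:
  assumes "framed X \<gamma> [hom X x b] (uid X B') f b'"
  shows "ccomp X (hom_cell X (tid X B') b') (tid X B') [bend x f b b' \<gamma>] =
    mult B' (hom_cell X (tid X B') f) (ccomp X \<gamma> (tid X D)
      [lift x b (tid X D) (tid X C) (mult B (hom_cell X x (tid X B)) (hom_cell X (tid X B) b))])"
  using ty ob assms by (simp add: bend_def framed_def smile_eq[where E=B])

text \<open>With the units of \<open>f\<close> and \<open>x\<close> inserted, both products in
  \<open>hat_bend\<close> have a unit as first factor and collapse.\<close>

lemma unbend_bend:
  assumes "framed X \<gamma> [hom X x b] (uid X B') f b'"
  shows "unbend x f b b' (bend x f b b' \<gamma>) = \<gamma>"
proof -
  note g = bend_globular[OF assms, unfolded globular_def framed_def]
  show ?thesis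
    using ty ob assms g hat_bend[OF assms] by (simp add: unbend_def framed_def hom_res_eq)
qed

lemma unbend_framed:
  assumes "globular X \<beta> [hom X (tid X B') f, hom X x (tid X B), hom X (tid X B) b]
    (hom X (tid X B') b')"
  shows "framed X (unbend x f b b' \<beta>) [hom X x b] (uid X B') f b'"
  using ty ob assms by (simp add: unbend_def globular_def framed_def hom_res_eq)

text \<open>An opalgebra acts on \<open>B(1,b)\<close> by right multiplication with its transposed
  structure. In the bent 2-cell the loose-cells of the grade contribute factors on the left only, so
  equivariance of \<open>\<gamma>\<close> carries over by associativity.\<close>

lemma graded_opalg_morphism_bend:
  assumes "framed X \<gamma> [hom X x b] (uid X B') f b'"
    and w: "globular X w [hom X j (carr T)] (hom X b b)" "globular X w' [hom X j (carr T)] (hom X b' b')"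
    and j: "j \<in> tights X" "carr T \<in> tights X" "tcod X j = tcod X (carr T)"
      "tdom X j = C" "tdom X (carr T) = C"
    and eq: "ccomp X \<gamma> (tid X D) [lift x b (tid X D) (tid X C) (mult B (hom_cell X x b) (hat b b w))] =
      mult B' \<gamma> (hat b' b' w')"
  shows "graded_opalg_morphism X j T [hom X (tid X B') f, hom X x (tid X B)] b w b' w' (bend x f b b' \<gamma>)"
proof -
  define \<alpha> where "\<alpha> = bend x f b b' \<gamma>"
  define t where "t = carr T"
  note g = bend_globular[OF assms(1), folded \<alpha>_def]
  note g' = g[unfolded globular_def framed_def]
  note w1 = globularD[OF w(1), folded t_def]
  note w2 = globularD[OF w(2), folded t_def]
  note h = hat_bend[OF assms(1), folded \<alpha>_def]
  note ty' = ty ob j[folded t_def] g' w1 w2 assms(1)[unfolded framed_def]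
  have act: "opalg_act X b w = lift (tid X B) b (tid X B) (tid X C) (mult B (hom_cell X (tid X B) b) (hat b b w))"
    using ty' by (simp add: opalg_act_def Let_def smile_eq paste_def)
  have act': "opalg_act X b' w' =
    lift (tid X B') b' (tid X B') (tid X C) (mult B' (hom_cell X (tid X B') b') (hat b' b' w'))"
    using ty' by (simp add: opalg_act_def Let_def smile_eq paste_def)
  define s where "s = lift x b (tid X D) (tid X C) (mult B (hom_cell X x (tid X B)) (hom_cell X (tid X B) b))"
  \<comment> \<open>The hypothesis concerns \<open>B(x,b)\<close>; it is precomposed with the
    composition \<open>s\<close> of \<open>B(x,1), B(1,b)\<close>, keeping the last
    argument.\<close>
  have "ccomp X (ccomp X \<gamma> (tid X D) [lift x b (tid X D) (tid X C) (mult B (hom_cell X x b) (hat b b w))])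
      (tid X D) [s, cid X (hom X j t)] =
    ccomp X (mult B' \<gamma> (hat b' b' w')) (tid X D) [s, cid X (hom X j t)]"
    using eq by simp
  then have e: "ccomp X \<gamma> (tid X D) [lift x b (tid X D) (tid X C)
      (mult B (hom_cell X x (tid X B)) (mult B (hom_cell X (tid X B) b) (hat b b w)))] =
    mult B' (ccomp X \<gamma> (tid X D) [s]) (hat b' b' w')"
    using ty' by (simp add: s_def)
  let ?ps = "[hom X (tid X B') f, hom X x (tid X B)]"
  let ?l = "\<alpha> \<star> (map (cid X) ?ps @ [opalg_act X b w])"
  let ?r = "opalg_act X b' w' \<star> [\<alpha>, cid X (hom X j t)]"
  have "ccomp X (hom_cell X (tid X B') b') (tid X B') [?l] =
    ccomp X (ccomp X (hom_cell X (tid X B') b') (tid X B') [\<alpha>]) (tid X B')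
      [cid X (hom X (tid X B') f), cid X (hom X x (tid X B)), opalg_act X b w]"
    using ty' by (simp add: paste_def act)
  also have "\<dots> = mult B' (hom_cell X (tid X B') f) (ccomp X \<gamma> (tid X D) [lift x b (tid X D) (tid X C)
      (mult B (hom_cell X x (tid X B)) (mult B (hom_cell X (tid X B) b) (hat b b w)))])"
    unfolding h using ty' by (simp add: act)
  also have "\<dots> = mult B' (ccomp X (hom_cell X (tid X B') b') (tid X B') [\<alpha>]) (hat b' b' w')"
    unfolding h e using ty' by (simp add: s_def)
  also have "\<dots> = ccomp X (hom_cell X (tid X B') b') (tid X B') [?r]"
    using ty' by (simp add: paste_def act')
  finally have hats: "ccomp X (hom_cell X (tid X B') b') (tid X B') [?l] =
    ccomp X (hom_cell X (tid X B') b') (tid X B') [?r]" .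
  have "?l = ?r"
    by (rule hom_eqI[of "tid X B'" b']) (use hats ty' in \<open>simp_all add: paste_def act act'\<close>)
  then show ?thesis
    unfolding graded_opalg_morphism_def Let_def \<alpha>_def[symmetric] t_def[symmetric]
    using g ty ob by simp
qed

context
  fixes k A
  assumes k: "k \<in> tights X" "tdom X k = A" "tcod X k = C"
begin

text \<open>Bending commutes with restriction along \<open>k\<close>. The condition
  \<open>\<alpha> = \<beta>(1,k)\<close> of the universal property can thus be compared with a
  condition on 2-cells out of \<open>B(x,b)\<close>.\<close>

lemma restr_right_bend:
  assumes "framed X \<gamma> [hom X x b] (uid X B') f b'"
  shows "restr_right X (bend x f b b' \<gamma>) (tid X B) b (tid X B') b' k =
    bend x f (b \<cdot> k) (b' \<cdot> k) (ccomp X \<gamma> (tid X D) [hom_res X x b (tid X D) k])"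
proof -
  have A: "A \<in> obs X" using k by auto
  note g = bend_globular[OF assms]
  note g' = g[unfolded globular_def framed_def] assms[unfolded framed_def]
  have r: "restr_right X (bend x f b b' \<gamma>) (tid X B) b (tid X B') b' k =
    lift (tid X B') (b' \<cdot> k) (tid X B') (tid X A)
     (ccomp X (hom_cell X (tid X B') b') (tid X B')
       [ccomp X (bend x f b b' \<gamma>) (tid X B')
         [cid X (hom X (tid X B') f), cid X (hom X x (tid X B)), hom_res X (tid X B) b (tid X B) k]])"
    using restr_right_ternary[OF _ _ _ _ _ _ _ _ _ g] ty ob k A by simp
  have "ccomp X (hom_cell X (tid X B') b') (tid X B')
       [ccomp X (bend x f b b' \<gamma>) (tid X B')
         [cid X (hom X (tid X B') f), cid X (hom X x (tid X B)), hom_res X (tid X B) b (tid X B) k]] =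
    ccomp X (ccomp X (hom_cell X (tid X B') b') (tid X B') [bend x f b b' \<gamma>]) (tid X B')
         [cid X (hom X (tid X B') f), cid X (hom X x (tid X B)), hom_res X (tid X B) b (tid X B) k]"
    using ty ob k A g' by (simp add: hom_res_eq)
  also have "\<dots> = mult B' (hom_cell X (tid X B') f) (ccomp X \<gamma> (tid X D)
      [lift x b (tid X D) k (mult B (hom_cell X x (tid X B)) (hom_cell X (tid X B) (b \<cdot> k)))])"
    unfolding hat_bend[OF assms] using ty ob k A g' by (simp add: hom_res_eq)
  finally show ?thesis
    unfolding r using ty ob k A g' by (simp add: bend_def smile_eq[where E=B] hom_res_eq)
qed

lemma unbend_restr_right:
  assumes "globular X \<beta> [hom X (tid X B') f, hom X x (tid X B), hom X (tid X B) b] (hom X (tid X B') b')"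
  shows "ccomp X (unbend x f b b' \<beta>) (tid X D) [hom_res X x b (tid X D) k] =
    unbend x f (b \<cdot> k) (b' \<cdot> k) (restr_right X \<beta> (tid X B) b (tid X B') b' k)"
proof -
  have A: "A \<in> obs X" using k by auto
  note g' = assms[unfolded globular_def framed_def]
  have r: "restr_right X \<beta> (tid X B) b (tid X B') b' k =
    lift (tid X B') (b' \<cdot> k) (tid X B') (tid X A)
     (ccomp X (hom_cell X (tid X B') b') (tid X B')
       [ccomp X \<beta> (tid X B')
         [cid X (hom X (tid X B') f), cid X (hom X x (tid X B)), hom_res X (tid X B) b (tid X B) k]])"
    using restr_right_ternary[OF _ _ _ _ _ _ _ _ _ assms] ty ob k A by simp
  show ?thesis
    unfolding r using ty ob k A g' by (simp add: unbend_def hom_res_eq)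
qed

end

end

text \<open>The universal property for the grade \<open>B'(1,f), B(x,1)\<close>, applied to the bent
  2-cell. The equation \<open>eq\<close> is equivariance of \<open>\<gamma>\<close> for the
  pushforward structures on \<open>b \<cdot> k\<close> and \<open>b' \<cdot> k\<close>, whose
  mediators are \<open>b\<close> and \<open>b'\<close>.\<close>

lemma opalg_extension_aux:
  assumes T: "rel_monad X j T" and K: "opalgebra_object X j T k wk" "tcod X k = C"
    and ty: "x \<in> tights X" "tdom X x = D" "tcod X x = B" "f \<in> tights X" "tdom X f = D" "tcod X f = B'"
    "b \<in> tights X" "tdom X b = C" "tcod X b = B" "b' \<in> tights X" "tdom X b' = C" "tcod X b' = B'"
    and g: "framed X \<gamma> [hom X x (b \<cdot> k)] (uid X B') f (b' \<cdot> k)"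
    and eq: "ccomp X \<gamma> (tid X D)
        [lift x (b \<cdot> k) (tid X D) (tid X (tdom X k)) (mult B (hom_cell X x (b \<cdot> k)) (app b (hat k k wk)))] =
      mult B' \<gamma> (app b' (hat k k wk))"
  shows "\<exists>!\<beta>. globular X \<beta> [hom X (tid X B') f, hom X x (tid X B), hom X (tid X B) b] (hom X (tid X B') b') \<and>
     bend x f (b \<cdot> k) (b' \<cdot> k) \<gamma> = restr_right X \<beta> (tid X B) b (tid X B') b' k"
proof -
  define t where "t = carr T"
  note T' = rel_monadD[OF T t_def[symmetric]]
  note h = tight2D[OF T'(2)]
  have o: "opalgebra X j T k wk" using K(1) by (simp add: opalgebra_object_def)
  note k = opalgebraD[OF o t_def[symmetric]]
  note w = globularD[OF k(3,1,1) refl]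
  let ?w = "frown_at X b k k \<star> [wk]" and ?w' = "frown_at X b' k k \<star> [wk]"
  have oa: "opalgebra X j T (b \<cdot> k) ?w" "opalgebra X j T (b' \<cdot> k) ?w'"
    using opalgebra_tcomp[OF T o] ty K(2) by simp_all
  have m: "opalg_mediator X k wk (b \<cdot> k) ?w = b" "opalg_mediator X k wk (b' \<cdot> k) ?w' = b'"
    using opalg_mediator_tcomp[OF T K(1)] ty K(2) by simp_all
  have hats: "hat (b \<cdot> k) (b \<cdot> k) ?w = app b (hat k k wk)"
    "hat (b' \<cdot> k) (b' \<cdot> k) ?w' = app b' (hat k k wk)"
    using ty K(2) k w h(1) by (simp_all add: frown_at_paste[OF k(3,1)])
  have "graded_opalg_morphism X j T [hom X (tid X B') f, hom X x (tid X B)]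
    (b \<cdot> k) ?w (b' \<cdot> k) ?w' (bend x f (b \<cdot> k) (b' \<cdot> k) \<gamma>)"
  proof (rule graded_opalg_morphism_bend[where D=D and B=B and C="tdom X k" and B'=B'])
    show "ccomp X \<gamma> (tid X D) [lift x (b \<cdot> k) (tid X D) (tid X (tdom X k))
        (mult B (hom_cell X x (b \<cdot> k)) (hat (b \<cdot> k) (b \<cdot> k) ?w))] =
      mult B' \<gamma> (hat (b' \<cdot> k) (b' \<cdot> k) ?w')"
      unfolding hats by (rule eq)
    show "globular X ?w [hom X j (carr T)] (hom X (b \<cdot> k) (b \<cdot> k))"
      "globular X ?w' [hom X j (carr T)] (hom X (b' \<cdot> k) (b' \<cdot> k))"
      using opalgebraD(3)[OF oa(1) refl] opalgebraD(3)[OF oa(2) refl] by simp_all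
  qed (use ty K(2) k h g t_def in simp_all)
  with K(1) oa have "let i = tid X (tcod X (b \<cdot> k)); i' = tid X (tcod X (b' \<cdot> k));
             c = opalg_mediator X k wk (b \<cdot> k) ?w; c' = opalg_mediator X k wk (b' \<cdot> k) ?w' in
         \<exists>!\<beta>. globular X \<beta> ([hom X (tid X B') f, hom X x (tid X B)] @ [hom X i c]) (hom X i' c') \<and>
              bend x f (b \<cdot> k) (b' \<cdot> k) \<gamma> = restr_right X \<beta> i c i' c' k"
    unfolding opalgebra_object_def by blast
  then show ?thesis
    unfolding m Let_def using ty K(2) k(1) by simp
qed

text \<open>The extension supplied by the universal property has the bent shape but is not known to
  be of the form \<open>bend\<close>. Its \<open>unbend\<close> still extends
  \<open>\<gamma>\<close>, because unbending commutes with restriction and undoes bending.\<close>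

lemma opalg_extension:
  assumes "rel_monad X j T" "opalgebra_object X j T k wk" "tcod X k = C"
    and ty: "x \<in> tights X" "tdom X x = D" "tcod X x = B" "f \<in> tights X" "tdom X f = D" "tcod X f = B'"
    "b \<in> tights X" "tdom X b = C" "tcod X b = B" "b' \<in> tights X" "tdom X b' = C" "tcod X b' = B'"
    and g: "framed X \<gamma> [hom X x (b \<cdot> k)] (uid X B') f (b' \<cdot> k)"
    and eq: "ccomp X \<gamma> (tid X D)
        [lift x (b \<cdot> k) (tid X D) (tid X (tdom X k)) (mult B (hom_cell X x (b \<cdot> k)) (app b (hat k k wk)))] =
      mult B' \<gamma> (app b' (hat k k wk))"
  obtains \<beta> where "framed X \<beta> [hom X x b] (uid X B') f b'"
    "ccomp X \<beta> (tid X D) [hom_res X x b (tid X D) k] = \<gamma>"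
proof -
  have k: "k \<in> tights X"
    using assms(2) by (simp add: opalgebra_object_def opalgebra_def Let_def)
  obtain \<beta> where \<beta>: "globular X \<beta> [hom X (tid X B') f, hom X x (tid X B), hom X (tid X B) b] (hom X (tid X B') b')"
    "bend x f (b \<cdot> k) (b' \<cdot> k) \<gamma> = restr_right X \<beta> (tid X B) b (tid X B') b' k"
    using opalg_extension_aux[OF assms] by blast
  have "ccomp X (unbend x f b b' \<beta>) (tid X D) [hom_res X x b (tid X D) k] =
    unbend x f (b \<cdot> k) (b' \<cdot> k) (bend x f (b \<cdot> k) (b' \<cdot> k) \<gamma>)"
    unfolding \<beta>(2) by (rule unbend_restr_right[OF ty k refl assms(3) \<beta>(1)])
  also have "\<dots> = \<gamma>"
    by (rule unbend_bend[OF ty(1-6) _ _ _ _ _ _ g, where C="tdom X k"]) (use ty k assms(3) in simp_all)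
  finally show thesis
    using that unbend_framed[OF ty \<beta>(1)] by blast
qed

text \<open>Equivariance of the common restriction is naturality in \<open>b\<close> at the
  transposed structure of \<open>k\<close>. Both bent 2-cells then solve the same extension problem,
  and bending is injective because it has a left inverse.\<close>

lemma opalg_extension_unique:
  assumes T: "rel_monad X j T" and K: "opalgebra_object X j T k wk" "tcod X k = C"
    and ty: "x \<in> tights X" "tdom X x = D" "tcod X x = B" "f \<in> tights X" "tdom X f = D" "tcod X f = B'"
    "b \<in> tights X" "tdom X b = C" "tcod X b = B" "b' \<in> tights X" "tdom X b' = C" "tcod X b' = B'"
    and f: "framed X \<beta>1 [hom X x b] (uid X B') f b'" "framed X \<beta>2 [hom X x b] (uid X B') f b'"
    and eq: "ccomp X \<beta>1 (tid X D) [hom_res X x b (tid X D) k] =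
      ccomp X \<beta>2 (tid X D) [hom_res X x b (tid X D) k]"
  shows "\<beta>1 = \<beta>2"
proof -
  define t where "t = carr T"
  note T' = rel_monadD[OF T t_def[symmetric]]
  note h = tight2D[OF T'(2)]
  have o: "opalgebra X j T k wk" using K(1) by (simp add: opalgebra_object_def)
  note k = opalgebraD[OF o t_def[symmetric]]
  note w = globularD[OF k(3,1,1) refl]
  note f1 = f(1)[unfolded framed_def]
  define \<gamma> where "\<gamma> = ccomp X \<beta>1 (tid X D) [hom_res X x b (tid X D) k]"
  have ob: "B \<in> obs X" "B' \<in> obs X" "C \<in> obs X" "D \<in> obs X" using ty by auto
  have g: "framed X \<gamma> [hom X x (b \<cdot> k)] (uid X B') f (b' \<cdot> k)"
    using ty K(2) k(1) f1 ob by (simp add: \<gamma>_def framed_def hom_res_eq)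
  have "ccomp X \<beta>1 (tid X D) [lift x b (tid X D) k (mult B (hom_cell X x (b \<cdot> k)) (app b (hat k k wk)))] =
    mult B' (ccomp X \<beta>1 (tid X D) [lift x b (tid X D) k (hom_cell X x (b \<cdot> k))]) (app b' (hat k k wk))"
    by (rule hom_naturality[where C=C]) (use ty K(2) k(1,2) h(1) w f1 ob in simp_all)
  moreover have "ccomp X \<gamma> (tid X D)
        [lift x (b \<cdot> k) (tid X D) (tid X (tdom X k)) (mult B (hom_cell X x (b \<cdot> k)) (app b (hat k k wk)))] =
     ccomp X \<beta>1 (tid X D) [lift x b (tid X D) k (mult B (hom_cell X x (b \<cdot> k)) (app b (hat k k wk)))]"
    using ty K(2) k(1,2) h(1) w f1 ob by (simp add: \<gamma>_def hom_res_eq)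
  moreover have "\<gamma> = ccomp X \<beta>1 (tid X D) [lift x b (tid X D) k (hom_cell X x (b \<cdot> k))]"
    using ty K(2) k(1) ob by (simp add: \<gamma>_def hom_res_eq)
  ultimately have e: "ccomp X \<gamma> (tid X D)
        [lift x (b \<cdot> k) (tid X D) (tid X (tdom X k)) (mult B (hom_cell X x (b \<cdot> k)) (app b (hat k k wk)))] =
      mult B' \<gamma> (app b' (hat k k wk))"
    by (simp only:)
  define P where "P \<beta> \<longleftrightarrow>
     globular X \<beta> [hom X (tid X B') f, hom X x (tid X B), hom X (tid X B) b] (hom X (tid X B') b') \<and>
     bend x f (b \<cdot> k) (b' \<cdot> k) \<gamma> = restr_right X \<beta> (tid X B) b (tid X B') b' k" for \<beta>
  have b: "P (bend x f b b' \<beta>)"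
    if "framed X \<beta> [hom X x b] (uid X B') f b'" "ccomp X \<beta> (tid X D) [hom_res X x b (tid X D) k] = \<gamma>" for \<beta>
    unfolding P_def restr_right_bend[OF ty k(1) refl K(2) that(1)] that(2)
    using bend_globular[OF ty that(1)] by (intro conjI refl)
  have "\<exists>!\<beta>. P \<beta>"
    unfolding P_def by (rule opalg_extension_aux[OF T K ty g e])
  moreover have "P (bend x f b b' \<beta>1)" "P (bend x f b b' \<beta>2)"
    using b[OF f(1)] b[OF f(2)] eq by (simp_all only: \<gamma>_def)
  ultimately have "bend x f b b' \<beta>1 = bend x f b b' \<beta>2"
    by blast
  then show ?thesis
    using unbend_bend[OF ty f(1)] unbend_bend[OF ty f(2)] by metis
qed

section \<open>Relative adjunctions through their units\<close>

text \<open>A relative adjunction is determined by its unit \<open>\<eta> : j \<Rightarrow> rl\<close> and \<open>\<flat>\<close>: since \<open>\<flat>\<close> is natural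
  in the second argument, the two triangle equations below already make it invertible.\<close>

definition unit_adj :: "'b \<Rightarrow> 'b \<Rightarrow> 'b \<Rightarrow> 'd \<Rightarrow> 'd \<Rightarrow> bool" where
  "unit_adj j l r h F \<longleftrightarrow> j \<in> tights X \<and> l \<in> tights X \<and> r \<in> tights X \<and>
    tdom X l = tdom X j \<and> tdom X r = tcod X l \<and> tcod X r = tcod X j \<and>
    framed X h [] (uid X (tcod X j)) j (r \<cdot> l) \<and>
    framed X F [hom X j r] (uid X (tcod X l)) l (tid X (tcod X l)) \<and>
    mult (tcod X j) h (app r F) = hom_cell X j r \<and>
    ccomp X F (tid X (tdom X j)) [lift j r (tid X (tdom X j)) l h] = tunit l"

lemma rel_adjD:
  assumes "rel_adj X j R" "ladj R = l" "radj R = r"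
  shows "j \<in> tights X" "l \<in> tights X" "r \<in> tights X" "tdom X l = tdom X j" "tdom X r = tcod X l"
    "tcod X r = tcod X j" "globular X (sharp R) [hom X l (tid X (tcod X l))] (hom X j r)"
    "globular X (flat R) [hom X j r] (hom X l (tid X (tcod X l)))"
    "ccomp X (flat R) (tid X (tdom X j)) [sharp R] = cid X (hom X l (tid X (tcod X l)))"
    "ccomp X (sharp R) (tid X (tdom X j)) [flat R] = cid X (hom X j r)"
proof -
  have c: "ccomp X (flat R) (cleft X (sharp R)) [sharp R] = cid X (hom X l (tid X (tcod X l)))"
    "ccomp X (sharp R) (cleft X (flat R)) [flat R] = cid X (hom X j r)"
    using assms by (simp_all add: rel_adj_def Let_def paste_def)
  show ty: "j \<in> tights X" "l \<in> tights X" "r \<in> tights X" "tdom X l = tdom X j" "tdom X r = tcod X l"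
    "tcod X r = tcod X j" "globular X (sharp R) [hom X l (tid X (tcod X l))] (hom X j r)"
    "globular X (flat R) [hom X j r] (hom X l (tid X (tcod X l)))"
    using assms by (simp_all add: rel_adj_def Let_def)
  have "cleft X (sharp R) = tid X (tdom X j)" "cleft X (flat R) = tid X (tdom X j)"
    using ty by (simp_all add: globular_def framed_def)
  with c show "ccomp X (flat R) (tid X (tdom X j)) [sharp R] = cid X (hom X l (tid X (tcod X l)))"
    "ccomp X (sharp R) (tid X (tdom X j)) [flat R] = cid X (hom X j r)"
    by simp_all
qed

text \<open>A Yoneda argument: \<open>\<sharp>\<close> is natural in its second argument, hence is
  multiplication by its value at the identity of \<open>l\<close>, which is the unit. The inverse
  laws for \<open>\<sharp>\<close> and \<open>\<flat>\<close> then become the two triangle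
  equations.\<close>

lemma rel_adj_unit_adj:
  assumes "rel_adj X j R" "ladj R = l" "radj R = r"
  shows "unit_adj j l r (hat j (r \<cdot> l) (radj_unit X j R)) (hat l (tid X (tcod X l)) (flat R))" (is ?U)
    and "hat j r (sharp R) = mult (tcod X j) (hat j (r \<cdot> l) (radj_unit X j R))
      (app r (hom_cell X l (tid X (tcod X l))))" (is ?S)
    and "tight2 X (radj_unit X j R) j (r \<cdot> l)" (is ?T)
proof -
  note a = rel_adjD[OF assms]
  define A C E where "A = tdom X j" and "C = tcod X l" and "E = tcod X j"
  have ty: "j \<in> tights X" "l \<in> tights X" "r \<in> tights X" "tdom X j = A" "tdom X l = A" "tcod X l = C"
    "tdom X r = C" "tcod X r = E" "tcod X j = E" "A \<in> obs X" "C \<in> obs X" "E \<in> obs X"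
    using a by (auto simp: A_def C_def E_def)
  note s = globularD[OF a(7), unfolded ty] and f = globularD[OF a(8), unfolded ty]
  have s: "sharp R \<in> cells X" "cdom X (sharp R) = [hom X l (tid X C)]" "ccod X (sharp R) = hom X j r"
    "cleft X (sharp R) = tid X A" "cright X (sharp R) = tid X C"
    using s ty by simp_all
  have f: "flat R \<in> cells X" "ccod X (flat R) = hom X l (tid X C)" "cdom X (flat R) = [hom X j r]"
    "cleft X (flat R) = tid X A" "cright X (flat R) = tid X C"
    using f ty by simp_all
  \<comment> \<open>The transposed \<open>\<sharp>\<close> evaluated at the identity of
    \<open>l\<close>.\<close>
  define h where "h = ccomp X (hat j r (sharp R)) (tid X A) [lift l (tid X C) (tid X A) l (tunit l)]"
  have hc: "h \<in> cells X" "cdom X h = []" "ccod X h = uid X E" "cleft X h = j" "cright X h = r \<cdot> l"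
    using ty s by (simp_all add: h_def)
  have u: "radj_unit X j R = lift j (r \<cdot> l) (tid X A) (tid X A) h"
  proof -
    have "globular X (sharp R) [hom X l (tid X C)] (hom X j r)"
      using a(7) ty by simp
    from restr_right_unary[OF _ _ _ _ _ _ _ _ _ this] ty
    have "restr_right X (sharp R) l (tid X C) j r l = lift j (r \<cdot> l) (tid X A) (tid X A)
      (ccomp X (hom_cell X j r) (tid X A) [ccomp X (sharp R) (tid X A) [hom_res X l (tid X C) (tid X A) l]])"
      by simp
    then show ?thesis
      using ty s assms(2,3) by (simp add: radj_unit_def Let_def paste_def frown_eq h_def hom_res_eq)
  qed
  show ?T
    unfolding u using tight2_lift1[of j "r \<cdot> l" E h] ty hc by simp
  have hat: "hat j (r \<cdot> l) (radj_unit X j R) = h"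
    unfolding u using ty hc by simp
  \<comment> \<open>Naturality at \<open>\<gamma> = tunit l\<close> and \<open>\<sigma>\<close> the
    cartesian 2-cell of \<open>C(l,1)\<close>. Their product is this cartesian 2-cell, so the left
    side is the transpose of \<open>\<sharp>\<close>.\<close>
  have "ccomp X (hat j r (sharp R)) (tid X A) [lift l (tid X C) (tid X A) (tid X C)
      (mult C (tunit l) (app (tid X C) (hom_cell X l (tid X C))))] =
    mult E (ccomp X (hat j r (sharp R)) (tid X A) [lift l (tid X C) (tid X A) l (tunit l)])
      (app r (hom_cell X l (tid X C)))"
    by (rule hom_naturality[where C=C]) (use ty s in simp_all)
  then have S: "ccomp X (hom_cell X j r) (tid X A) [sharp R] = mult E h (app r (hom_cell X l (tid X C)))"
    using ty s by (simp add: h_def)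
  then show ?S
    unfolding hat using ty s by simp
  have "ccomp X (ccomp X (hom_cell X j r) (tid X A) [sharp R]) (tid X A) [flat R] =
    ccomp X (mult E h (app r (hom_cell X l (tid X C)))) (tid X A) [flat R]"
    using S by simp
  then have I: "mult E h (app r (ccomp X (hom_cell X l (tid X C)) (tid X A) [flat R])) = hom_cell X j r"
    using ty s f hc a(10) by simp
  \<comment> \<open>The lift of \<open>h\<close> is \<open>\<sharp>\<close> at the identity of
    \<open>l\<close>, so \<open>\<flat>\<close> sends it back to that identity.\<close>
  have "lift j r (tid X A) l h = ccomp X (sharp R) (tid X A) [lift l (tid X C) (tid X A) l (tunit l)]"
    using ty s by (simp add: h_def)
  then have "ccomp X (flat R) (tid X A) [lift j r (tid X A) l h] =
    ccomp X (ccomp X (flat R) (tid X A) [sharp R]) (tid X A) [lift l (tid X C) (tid X A) l (tunit l)]"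
    using ty s f by simp
  also have "\<dots> = lift l (tid X C) (tid X A) l (tunit l)"
    using ty a(9) by simp
  finally have "ccomp X (flat R) (tid X A) [lift j r (tid X A) l h] = lift l (tid X C) (tid X A) l (tunit l)" .
  then show ?U
    unfolding hat unit_adj_def using ty s f hc I by (simp add: framed_def)
qed

text \<open>With \<open>\<phi>\<close> the 2-cell \<open>\<flat>\<close>, the left side is the
  extension operator of the induced monad.\<close>

lemma restr_right_flat:
  assumes "j \<in> tights X" "l \<in> tights X" "r \<in> tights X" "tdom X l = tdom X j" "tdom X r = tcod X l"
    "tcod X r = tcod X j" "globular X \<phi> [hom X j r] (hom X l (tid X (tcod X l)))"
  shows "frown_at X r l l \<star> [restr_right X \<phi> j r l (tid X (tcod X l)) l] =
    lift1 (r \<cdot> l) (r \<cdot> l) (app r (ccomp X (hat l (tid X (tcod X l)) \<phi>) (tid X (tdom X j))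
      [hom_res X j r (tid X (tdom X j)) l]))"
proof -
  define C where "C = tcod X l"
  have C: "tcod X l = C" "C \<in> obs X" "tdom X r = C" using assms by (simp_all add: C_def)
  note f = globularD[OF assms(7)]
  have f: "\<phi> \<in> cells X" "ccod X \<phi> = hom X l (tid X C)" "cdom X \<phi> = [hom X j r]"
    "cleft X \<phi> = tid X (tdom X j)" "cright X \<phi> = tid X C"
    using f assms C by simp_all
  have g: "globular X \<phi> [hom X j r] (hom X l (tid X C))"
    using assms(7) C by simp
  have "restr_right X \<phi> j r l (tid X C) l = lift l l (tid X (tdom X j)) (tid X (tdom X j))
    (ccomp X (hom_cell X l (tid X C)) (tid X (tdom X j))
      [ccomp X \<phi> (tid X (tdom X j)) [hom_res X j r (tid X (tdom X j)) l]])"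
    using restr_right_unary[OF _ _ _ _ _ _ _ _ _ g] assms(1-6) C by simp
  then show ?thesis
    using assms(1-6) C f by (simp add: frown_at_eq paste_def hom_res_eq)
qed

text \<open>Multiplication by \<open>h\<close> serves as \<open>\<sharp>\<close>. For
  \<open>\<kappa>\<close> the cartesian 2-cell of \<open>C(l,1)\<close>, naturality of
  \<open>F\<close> gives \<open>F(h \<cdot> r\<kappa>) = F(h) \<cdot> \<kappa> = \<kappa>\<close>;
  the other inverse law is the equation \<open>h \<cdot> rF = 1\<close>.\<close>

lemma unit_adj_rel_adj:
  assumes u: "unit_adj j l r h F"
  defines "R \<equiv> \<lparr>ladj = l, radj = r,
    sharp = lift1 j r (mult (tcod X j) h (app r (hom_cell X l (tid X (tcod X l))))),
    flat = lift1 l (tid X (tcod X l)) F\<rparr>"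
  shows "rel_adj X j R" "radj_unit X j R = lift1 j (r \<cdot> l) h"
proof -
  define A C E where "A = tdom X j" and "C = tcod X l" and "E = tcod X j"
  have ty: "j \<in> tights X" "l \<in> tights X" "r \<in> tights X" "tdom X j = A" "tdom X l = A" "tcod X l = C"
    "tdom X r = C" "tcod X r = E" "tcod X j = E" "A \<in> obs X" "C \<in> obs X" "E \<in> obs X"
    using u by (auto simp: A_def C_def E_def unit_adj_def)
  have h: "h \<in> cells X" "cdom X h = []" "ccod X h = uid X E" "cleft X h = j" "cright X h = r \<cdot> l"
    and F: "F \<in> cells X" "cdom X F = [hom X j r]" "ccod X F = uid X C" "cleft X F = l" "cright X F = tid X C"
    and I: "mult E h (app r F) = hom_cell X j r"
    and II: "ccomp X F (tid X A) [lift j r (tid X A) l h] = tunit l"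
    using u ty by (auto simp: unit_adj_def framed_def)
  define s where "s = lift j r (tid X A) (tid X C) (mult E h (app r (hom_cell X l (tid X C))))"
  define f where "f = lift l (tid X C) (tid X A) (tid X C) F"
  have R: "R = \<lparr>ladj = l, radj = r, sharp = s, flat = f\<rparr>"
    using ty by (simp add: R_def s_def f_def)
  have sc: "s \<in> cells X" "cdom X s = [hom X l (tid X C)]" "ccod X s = hom X j r"
    "cleft X s = tid X A" "cright X s = tid X C"
    using ty h by (simp_all add: s_def)
  have fc: "f \<in> cells X" "cdom X f = [hom X j r]" "ccod X f = hom X l (tid X C)"
    "cleft X f = tid X A" "cright X f = tid X C"
    using ty F by (simp_all add: f_def)
  have "ccomp X F (tid X A) [lift j r (tid X A) (tid X C) (mult E h (app r (hom_cell X l (tid X C))))] =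
    mult C (ccomp X F (tid X A) [lift j r (tid X A) l h]) (app (tid X C) (hom_cell X l (tid X C)))"
    by (rule hom_naturality[where C=C]) (use ty h F in simp_all)
  then have "ccomp X F (tid X A) [s] = hom_cell X l (tid X C)"
    using ty by (simp add: II s_def)
  then have fs: "ccomp X f (tid X A) [s] = cid X (hom X l (tid X C))"
    using ty F sc by (simp add: f_def)
  have "ccomp X (mult E h (app r (hom_cell X l (tid X C)))) (tid X A) [f] = hom_cell X j r"
    using ty h F I by (simp add: f_def)
  then have sf: "ccomp X s (tid X A) [f] = cid X (hom X j r)"
    using ty h fc by (simp add: s_def)
  show "rel_adj X j R"
    using ty sc fc fs sf by (simp add: rel_adj_def R Let_def globular_def framed_def paste_def)
  have "globular X s [hom X l (tid X C)] (hom X j r)"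
    using ty sc by (simp add: globular_def framed_def)
  from restr_right_unary[OF _ _ _ _ _ _ _ _ _ this] ty
  have "restr_right X s l (tid X C) j r l = lift j (r \<cdot> l) (tid X A) (tid X A)
    (ccomp X (hom_cell X j r) (tid X A) [ccomp X s (tid X A) [hom_res X l (tid X C) (tid X A) l]])"
    by simp
  then show "radj_unit X j R = lift1 j (r \<cdot> l) h"
    using ty h by (simp add: radj_unit_def R Let_def paste_def frown_eq s_def hom_res_eq)
qed

text \<open>The transpose of the 2-cell \<open>E(j,rl) \<Rightarrow> C(l,l)\<close> that makes \<open>l\<close> an opalgebra for the induced monad.\<close>

definition ladj_act :: "'b \<Rightarrow> 'b \<Rightarrow> 'b \<Rightarrow> 'd \<Rightarrow> 'd" where
  "ladj_act j l r F = ccomp X F (tid X (tdom X j)) [hom_res X j r (tid X (tdom X j)) l]"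

text \<open>The form in which \<open>\<flat>\<close> of a given adjunction is used for monads and
  right-morphisms. The second and third facts are the triangle equations restricted along
  \<open>l\<close>; the last is naturality of \<open>\<flat>\<close>, where \<open>b'\<close> is the
  identity of \<open>C\<close>.\<close>

lemma ladj_act:
  assumes u: "unit_adj j l r h F" and ty: "tdom X j = A" "tcod X l = C" "tcod X j = E"
  shows "framed X (ladj_act j l r F) [hom X j (r \<cdot> l)] (uid X C) l l"
    and "mult E h (app r (ladj_act j l r F)) = hom_cell X j (r \<cdot> l)"
    and "ccomp X (ladj_act j l r F) (tid X A) [lift j (r \<cdot> l) (tid X A) (tid X A) h] = tunit l"
    and "\<lbrakk>\<gamma> \<in> cells X; ccod X \<gamma> = uid X E; cleft X \<gamma> = j; cright X \<gamma> = r \<cdot> l;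
        \<sigma> \<in> cells X; ccod X \<sigma> = uid X C; cleft X \<sigma> = l; cright X \<sigma> = l\<rbrakk> \<Longrightarrow>
      ccomp X (ladj_act j l r F) (tid X A) [lift j (r \<cdot> l) (tid X A) (tid X A) (mult E \<gamma> (app r \<sigma>))] =
      mult C (ccomp X (ladj_act j l r F) (tid X A) [lift j (r \<cdot> l) (tid X A) (tid X A) \<gamma>]) \<sigma>"
proof -
  have ty: "j \<in> tights X" "l \<in> tights X" "r \<in> tights X" "tdom X j = A" "tdom X l = A" "tcod X l = C"
    "tdom X r = C" "tcod X r = E" "tcod X j = E" "A \<in> obs X" "C \<in> obs X" "E \<in> obs X"
    using u ty by (auto simp: unit_adj_def)
  have h: "h \<in> cells X" "cdom X h = []" "ccod X h = uid X E" "cleft X h = j" "cright X h = r \<cdot> l"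
    and F: "F \<in> cells X" "cdom X F = [hom X j r]" "ccod X F = uid X C" "cleft X F = l" "cright X F = tid X C"
    and I: "mult E h (app r F) = hom_cell X j r"
    and II: "ccomp X F (tid X A) [lift j r (tid X A) l h] = tunit l"
    using u ty by (auto simp: unit_adj_def framed_def)
  let ?W = "ladj_act j l r F"
  show W: "framed X ?W [hom X j (r \<cdot> l)] (uid X C) l l"
    using ty F by (simp add: ladj_act_def framed_def hom_res_eq)
  have "ccomp X (mult E h (app r F)) (tid X A) [hom_res X j r (tid X A) l] = hom_cell X j (r \<cdot> l)"
    unfolding I using ty by (simp add: hom_res_eq)
  then show "mult E h (app r ?W) = hom_cell X j (r \<cdot> l)"
    using ty F h by (simp add: ladj_act_def hom_res_eq)
  show "ccomp X ?W (tid X A) [lift j (r \<cdot> l) (tid X A) (tid X A) h] = tunit l"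
    using ty F h II by (simp add: ladj_act_def hom_res_eq)
  assume g: "\<gamma> \<in> cells X" "ccod X \<gamma> = uid X E" "cleft X \<gamma> = j" "cright X \<gamma> = r \<cdot> l"
    "\<sigma> \<in> cells X" "ccod X \<sigma> = uid X C" "cleft X \<sigma> = l" "cright X \<sigma> = l"
  have res: "ccomp X ?W (tid X A) [lift j (r \<cdot> l) (tid X A) (tid X A) \<delta>] =
    ccomp X F (tid X A) [lift j r (tid X A) l \<delta>]"
    if "\<delta> \<in> cells X" "ccod X \<delta> = uid X E" "cleft X \<delta> = j" "cright X \<delta> = r \<cdot> l" for \<delta>
    using ty F that by (simp add: ladj_act_def hom_res_eq)
  have "ccomp X F (tid X A) [lift j r (tid X A) l (mult E \<gamma> (app r \<sigma>))] =
    mult C (ccomp X F (tid X A) [lift j r (tid X A) l \<gamma>]) (app (tid X C) \<sigma>)"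
    by (rule hom_naturality[where C=C]) (use ty F g in simp_all)
  then show "ccomp X ?W (tid X A) [lift j (r \<cdot> l) (tid X A) (tid X A) (mult E \<gamma> (app r \<sigma>))] =
      mult C (ccomp X ?W (tid X A) [lift j (r \<cdot> l) (tid X A) (tid X A) \<gamma>]) \<sigma>"
    using res[of \<gamma>] res[of "mult E \<gamma> (app r \<sigma>)"] ty g by simp
qed

lemma induced_rmonad_eq:
  assumes "rel_adj X j R" "ladj R = l" "radj R = r"
  shows "induced_rmonad X j R = \<lparr>carr = r \<cdot> l,
    ext = lift1 (r \<cdot> l) (r \<cdot> l) (app r (ladj_act j l r (hat l (tid X (tcod X l)) (flat R)))),
    eta = radj_unit X j R\<rparr>"
  using restr_right_flat[OF rel_adjD(1-6,8)[OF assms]] assms(2,3)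
  by (simp add: induced_rmonad_def Let_def ladj_act_def)

lemma rel_monad_induced_rmonad:
  assumes "rel_adj X j R"
  shows "rel_monad X j (induced_rmonad X j R)"
proof -
  define l r A C E F where "l = ladj R" and "r = radj R" and "A = tdom X j" and "C = tcod X l"
    and "E = tcod X j" and "F = hat l (tid X (tcod X l)) (flat R)"
  note a = rel_adjD[OF assms l_def[symmetric] r_def[symmetric]]
  note u = rel_adj_unit_adj[OF assms l_def[symmetric] r_def[symmetric]]
  have ty: "j \<in> tights X" "l \<in> tights X" "r \<in> tights X" "tdom X j = A" "tdom X l = A" "tcod X l = C"
    "tdom X r = C" "tcod X r = E" "tcod X j = E" "A \<in> obs X" "C \<in> obs X" "E \<in> obs X"
    using a by (auto simp: A_def C_def E_def)
  define h where "h = hat j (r \<cdot> l) (radj_unit X j R)"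
  define W where "W = ladj_act j l r F"
  note w = ladj_act[OF u(1)[folded h_def F_def] ty(4,6,9), folded W_def]
  have W: "W \<in> cells X" "cdom X W = [hom X j (r \<cdot> l)]" "ccod X W = uid X C" "cleft X W = l" "cright X W = l"
    using w(1) by (simp_all add: framed_def)
  have T: "induced_rmonad X j R = \<lparr>carr = r \<cdot> l,
    ext = lift (r \<cdot> l) (r \<cdot> l) (tid X A) (tid X A) (app r W), eta = radj_unit X j R\<rparr>" (is "_ = ?T")
    using induced_rmonad_eq[OF assms l_def[symmetric] r_def[symmetric]] ty
    by (simp add: W_def F_def)
  note n = tight2D[OF u(3)]
  have n: "radj_unit X j R = lift j (r \<cdot> l) (tid X A) (tid X A) h" "h \<in> cells X" "cdom X h = []"
    "ccod X h = uid X E" "cleft X h = j" "cright X h = r \<cdot> l"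
    using n ty by (simp_all add: h_def)
  have g: "globular X (ext ?T) [hom X j (r \<cdot> l)] (hom X (r \<cdot> l) (r \<cdot> l))"
    using ty W by (simp add: globular_def framed_def)
  have t: "tight2 X (eta ?T) j (r \<cdot> l)"
    using u(3) by simp
  \<comment> \<open>By naturality \<open>W(1 \<cdot> rW) = W(1) \<cdot> W = W \<cdot> W\<close>;
    applying \<open>r\<close> gives the associativity law of the monad.\<close>
  have "app r (ccomp X W (tid X A) [lift j (r \<cdot> l) (tid X A) (tid X A)
      (mult E (hom_cell X j (r \<cdot> l)) (app r W))]) = app r (mult C W W)"
    by (subst w(4)) (use ty W in simp_all)
  moreover have "app r (ccomp X W (tid X A) [lift j (r \<cdot> l) (tid X A) (tid X A) h]) = app r (tunit l)"
    using w(3) by simp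
  ultimately show ?thesis
    unfolding T
    by (subst rel_monad_iff[OF _ g t, where E=E])
      (use ty W n w(2) in simp_all)
qed

section \<open>Right-morphisms\<close>

lemma rmonad_morphism_iff:
  assumes T: "globular X (ext T) [hom X j t] (hom X t t)" "tight2 X (eta T) j t" "carr T = t"
    and T': "globular X (ext T') [hom X j t'] (hom X t' t')" "tight2 X (eta T') j t'" "carr T' = t'"
    and \<tau>: "tight2 X \<tau> t t'" and E: "tcod X t = E"
  shows "rmonad_morphism X j T T' \<tau> \<longleftrightarrow>
    mult E (hat j t (eta T)) (hat t t' \<tau>) = hat j t' (eta T') \<and>
    mult E (hat t t (ext T)) (hat t t' \<tau>) = mult E (hat t t' \<tau>)
      (ccomp X (hat t' t' (ext T')) (tid X (tdom X t)) [lift1 j t' (mult E (hom_cell X j t) (hat t t' \<tau>))])"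
    (is "_ \<longleftrightarrow> ?e1 \<and> ?e2")
proof -
  note h = tight2D[OF T(2)] tight2D[OF T'(2)] tight2D[OF \<tau>]
  note d = globularD[OF T(1) h(2,2) refl] globularD[OF T'(1) h(11,11) refl]
  have ob: "E \<in> obs X" "tcod X j = E" "tcod X t' = E" using h E by auto
  have "tight2_comp X j t t' \<tau> (eta T) = eta T' \<longleftrightarrow> ?e1"
    by (subst hom_eq_iff[of j t' _ _ "tid X (tdom X t)"])
      (use h ob E in \<open>simp_all add: tight2_comp_def smile_eq[where E=E] paste_def\<close>)
  moreover have "hom_post X t t t' \<tau> \<star> [ext T] =
      hom_pre X t t' \<tau> t' \<star> [ext T' \<star> [hom_post X j t t' \<tau>]] \<longleftrightarrow> ?e2"
    by (subst hom_eq_iff[of t t' _ _ "tid X (tdom X t)"])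
      (use h d ob E \<tau> in \<open>simp_all add: hom_post_eq[where E=E] hom_pre_eq[where E=E] paste_def\<close>)
  ultimately show ?thesis
    unfolding rmonad_morphism_def Let_def T(3) T'(3) using \<tau> by simp
qed

section \<open>Right-morphisms between two fixed relative adjunctions\<close>

context
  fixes j R R' l r l' r' A C C' E
  assumes R: "rel_adj X j R" "ladj R = l" "radj R = r" and R': "rel_adj X j R'" "ladj R' = l'" "radj R' = r'"
    and ob: "tdom X j = A" "tcod X l = C" "tcod X l' = C'" "tcod X j = E"
begin

private lemma adj_ty: "j \<in> tights X" "l \<in> tights X" "r \<in> tights X" "tdom X j = A" "tdom X l = A" "tcod X l = C"
    "tdom X r = C" "tcod X r = E" "tcod X j = E" "A \<in> obs X" "C \<in> obs X" "E \<in> obs X"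
    "l' \<in> tights X" "r' \<in> tights X" "tdom X l' = A" "tcod X l' = C'"
    "tdom X r' = C'" "tcod X r' = E" "C' \<in> obs X"
  using rel_adjD(1-6)[OF R] rel_adjD(1-6)[OF R'] ob by auto

private lemma unit_cell: "hat j (r \<cdot> l) (radj_unit X j R) \<in> cells X" "cdom X (hat j (r \<cdot> l) (radj_unit X j R)) = []"
    "ccod X (hat j (r \<cdot> l) (radj_unit X j R)) = uid X E" "cleft X (hat j (r \<cdot> l) (radj_unit X j R)) = j"
    "cright X (hat j (r \<cdot> l) (radj_unit X j R)) = r \<cdot> l"
  using rel_adj_unit_adj(1)[OF R] adj_ty unfolding unit_adj_def framed_def by auto

private lemma unit_cell': "hat j (r' \<cdot> l') (radj_unit X j R') \<in> cells X" "cdom X (hat j (r' \<cdot> l') (radj_unit X j R')) = []"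
    "ccod X (hat j (r' \<cdot> l') (radj_unit X j R')) = uid X E" "cleft X (hat j (r' \<cdot> l') (radj_unit X j R')) = j"
    "cright X (hat j (r' \<cdot> l') (radj_unit X j R')) = r' \<cdot> l'"
  using rel_adj_unit_adj(1)[OF R'] adj_ty unfolding unit_adj_def framed_def by auto

text \<open>With both \<open>\<sharp>\<close> written as multiplication by units, the condition
  compares \<open>\<eta> \<cdot> r\<kappa> \<cdot> \<rho>\<close> with
  \<open>\<eta>' \<cdot> r'c\<kappa>\<close>, where \<open>\<kappa>\<close> is the cartesian 2-cell
  of \<open>C(l,1)\<close>. Interchange moves \<open>\<rho>\<close> to the left of
  \<open>\<kappa>\<close>, which is then cancelled as a right factor.\<close>

lemma right_morphism_iff:
  "right_morphism X j R R' (c, \<rho>) \<longleftrightarrow>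
    c \<in> tights X \<and> tdom X c = C \<and> tcod X c = C' \<and> c \<cdot> l = l' \<and> tight2 X \<rho> r (r' \<cdot> c) \<and>
    mult E (hat j (r \<cdot> l) (radj_unit X j R)) (ccomp X (hat r (r' \<cdot> c) \<rho>) l []) =
      hat j (r' \<cdot> l') (radj_unit X j R')" (is "_ \<longleftrightarrow> ?c \<and> ?dc \<and> ?cc \<and> ?cl \<and> ?t \<and> ?e")
proof (cases "?c \<and> ?dc \<and> ?cc \<and> ?cl \<and> ?t")
  case True
  then have c: "c \<in> tights X" "tdom X c = C" "tcod X c = C'" "c \<cdot> l = l'" and t: "tight2 X \<rho> r (r' \<cdot> c)"
    by auto
  note \<rho> = tight2D[OF t]
  have \<rho>: "\<rho> \<in> cells X" "cdom X \<rho> = []" "ccod X \<rho> = hom X r (r' \<cdot> c)" "cleft X \<rho> = tid X C" "cright X \<rho> = tid X C"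
    using \<rho> adj_ty by simp_all
  define h h' where "h = hat j (r \<cdot> l) (radj_unit X j R)" and "h' = hat j (r' \<cdot> l') (radj_unit X j R')"
  note hc = unit_cell[folded h_def] unit_cell'[folded h'_def]
  define p where "p = hat r (r' \<cdot> c) \<rho>"
  have p: "p \<in> cells X" "cdom X p = []" "ccod X p = uid X E" "cleft X p = r" "cright X p = r' \<cdot> c"
    using adj_ty c \<rho> by (simp_all add: p_def)
  define \<kappa> where "\<kappa> = hom_cell X l (tid X C)"
  have \<kappa>: "\<kappa> \<in> cells X" "cdom X \<kappa> = [hom X l (tid X C)]" "ccod X \<kappa> = uid X C" "cleft X \<kappa> = l" "cright X \<kappa> = tid X C"
    using adj_ty by (simp_all add: \<kappa>_def)
  have S: "hat j r (sharp R) = mult E h (app r \<kappa>)"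
    using rel_adj_unit_adj(2)[OF R] ob by (simp add: h_def \<kappa>_def)
  have S': "hat j r' (sharp R') = mult E h' (app r' (hom_cell X l' (tid X C')))"
    using rel_adj_unit_adj(2)[OF R'] ob by (simp add: h'_def)
  have g: "globular X (sharp R) [hom X l (tid X C)] (hom X j r)"
    "globular X (sharp R') [hom X l' (tid X C')] (hom X j r')"
    using rel_adjD(7)[OF R] rel_adjD(7)[OF R'] ob by simp_all
  note s = globularD[OF g(1)] globularD[OF g(2)]
  have s: "sharp R \<in> cells X" "cdom X (sharp R) = [hom X l (tid X C)]" "ccod X (sharp R) = hom X j r"
    "cleft X (sharp R) = tid X A" "cright X (sharp R) = tid X C"
    and s': "sharp R' \<in> cells X" "cdom X (sharp R') = [hom X l' (tid X C')]" "ccod X (sharp R') = hom X j r'"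
    "cleft X (sharp R') = tid X A" "cright X (sharp R') = tid X C'"
    using s adj_ty by simp_all
  have f: "frown_at X c l (tid X C) = lift l' c (tid X A) (tid X C) (app c \<kappa>)"
    using frown_at_eq[of l "tid X C" c] c adj_ty by (simp add: \<kappa>_def)
  have rr: "restr_right X (sharp R') l' (tid X C') j r' c = lift j (r' \<cdot> c) (tid X A) (tid X C)
    (ccomp X (hom_cell X j r') (tid X A) [ccomp X (sharp R') (tid X A) [hom_res X l' (tid X C') (tid X A) c]])"
    using restr_right_unary[OF _ _ _ _ _ _ _ _ _ g(2)] c adj_ty by simp
  have "ccomp X (hom_cell X j r') (tid X A) [ccomp X (sharp R') (tid X A) [hom_res X l' (tid X C') (tid X A) c]] =
    ccomp X (hat j r' (sharp R')) (tid X A) [hom_res X l' (tid X C') (tid X A) c]"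
    using c adj_ty s' by (simp add: hom_res_eq)
  also have "\<dots> = mult E h' (app r' (hom_cell X l' c))"
    unfolding S' using c adj_ty hc by (simp add: hom_res_eq)
  finally have rr: "restr_right X (sharp R') l' (tid X C') j r' c = lift j (r' \<cdot> c) (tid X A) (tid X C)
    (mult E h' (app r' (hom_cell X l' c)))"
    using rr by simp
  let ?l = "hom_post X j r (r' \<cdot> c) \<rho> \<star> [sharp R]"
  let ?r = "restr_right X (sharp R') l' (tid X C') j r' c \<star> [frown_at X c l (tid X C)]"
  have post: "hom_post X j r (r' \<cdot> c) \<rho> = lift j (r' \<cdot> c) (tid X A) (tid X C) (mult E (hom_cell X j r) p)"
    using hom_post_eq[OF t, of j E] c adj_ty by (simp add: p_def)
  have l1: "?l = lift j (r' \<cdot> c) (tid X A) (tid X C) (mult E (hat j r (sharp R)) p)"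
    using c adj_ty s p by (simp add: post paste_def)
  have l2: "?l = lift j (r' \<cdot> c) (tid X A) (tid X C) (mult E h (mult E (app r \<kappa>) p))"
    unfolding l1 S using c adj_ty \<kappa> hc p by simp
  have "mult E (app r \<kappa>) (ccomp X p (tid X C) []) = mult E (ccomp X p l []) (app (r' \<cdot> c) \<kappa>)"
    by (rule uid_naturality[where C=C]) (use c adj_ty p \<kappa> in simp_all)
  then have n: "mult E (app r \<kappa>) p = mult E (ccomp X p l []) (app (r' \<cdot> c) \<kappa>)"
    using p adj_ty c by simp
  have l3: "?l = lift j (r' \<cdot> c) (tid X A) (tid X C) (mult E (mult E h (ccomp X p l [])) (app (r' \<cdot> c) \<kappa>))"
    unfolding l2 n using c adj_ty \<kappa> hc p by simp
  have r: "?r = lift j (r' \<cdot> c) (tid X A) (tid X C) (mult E h' (app (r' \<cdot> c) \<kappa>))"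
    using c adj_ty \<kappa> hc by (simp add: rr f paste_def)
  let ?X = "mult E h (ccomp X p l [])"
  have X: "?X \<in> cells X" "cdom X ?X = []" "ccod X ?X = uid X E" "cleft X ?X = j" "cright X ?X = r' \<cdot> l'"
    using c adj_ty hc p by simp_all
  \<comment> \<open>Evaluation at the identity of \<open>l\<close> turns \<open>\<kappa>\<close>
    into a unit and so returns \<open>x\<close>.\<close>
  have inj: "x = ccomp X (ccomp X (hom_cell X j (r' \<cdot> c)) (tid X A) [lift j (r' \<cdot> c) (tid X A) (tid X C) (mult E x (app (r' \<cdot> c) \<kappa>))])
      (tid X A) [lift l (tid X C) (tid X A) l (tunit l)]"
    if "x \<in> cells X" "cdom X x = []" "ccod X x = uid X E" "cleft X x = j" "cright X x = r' \<cdot> l'" for x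
    using that c adj_ty by (simp add: \<kappa>_def)
  have "?l = ?r \<longleftrightarrow> ?X = h'"
  proof
    assume "?l = ?r"
    then show "?X = h'"
      using inj[OF X] inj[OF hc(6-10)] unfolding l3 r by metis
  next
    assume e: "?X = h'"
    show "?l = ?r"
      unfolding l3 r e by (rule refl)
  qed
  then show ?thesis
    unfolding right_morphism_def Let_def split R(2,3) R'(2,3) ob p_def h_def h'_def using c t by simp
next
  case False
  then show ?thesis
    unfolding right_morphism_def Let_def split R(2,3) R'(2,3) ob by auto
qed

context
  fixes c \<rho>
  assumes m: "right_morphism X j R R' (c, \<rho>)"
begin

lemma Lambda_R_eq:
  "Lambda_R X R R' (c, \<rho>) = lift (r \<cdot> l) (r' \<cdot> l') (tid X A) (tid X A) (ccomp X (hat r (r' \<cdot> c) \<rho>) l [])"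
  "tight2 X (Lambda_R X R R' (c, \<rho>)) (r \<cdot> l) (r' \<cdot> l')"
  "hat (r \<cdot> l) (r' \<cdot> l') (Lambda_R X R R' (c, \<rho>)) = ccomp X (hat r (r' \<cdot> c) \<rho>) l []"
proof -
  have c: "c \<in> tights X" "tdom X c = C" "tcod X c = C'" "c \<cdot> l = l'" and t: "tight2 X \<rho> r (r' \<cdot> c)"
    using m by (auto simp: right_morphism_iff)
  note \<rho> = tight2D[OF t]
  have \<rho>: "\<rho> \<in> cells X" "cdom X \<rho> = []" "ccod X \<rho> = hom X r (r' \<cdot> c)" "cleft X \<rho> = tid X C" "cright X \<rho> = tid X C"
    using \<rho> adj_ty by simp_all
  show L: "Lambda_R X R R' (c, \<rho>) = lift (r \<cdot> l) (r' \<cdot> l') (tid X A) (tid X A) (ccomp X (hat r (r' \<cdot> c) \<rho>) l [])"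
    using whisker_eq[OF t, of l] c adj_ty \<rho> by (simp add: Lambda_R_def R(2,3) R'(2,3))
  show "tight2 X (Lambda_R X R R' (c, \<rho>)) (r \<cdot> l) (r' \<cdot> l')"
    unfolding L using c adj_ty \<rho> tight2_lift1[of "r \<cdot> l" "r' \<cdot> l'" E "ccomp X (hat r (r' \<cdot> c) \<rho>) l []"]
    by simp
  show "hat (r \<cdot> l) (r' \<cdot> l') (Lambda_R X R R' (c, \<rho>)) = ccomp X (hat r (r' \<cdot> c) \<rho>) l []"
    unfolding L using c adj_ty \<rho> by simp
qed

text \<open>The triangle equation, interchange and the condition on \<open>\<rho>\<close> give
  \<open>1 \<cdot> \<rho>l = \<eta> \<cdot> rW \<cdot> \<rho>l = \<eta> \<cdot> \<rho>l \<cdot> r'cW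
  = \<eta>' \<cdot> r'cW\<close>, and applying \<open>W'\<close> leaves \<open>cW\<close>. Hence the
  image under \<open>c\<close> of the action on \<open>l\<close> depends only on
  \<open>\<rho>l\<close>. The same interchange makes \<open>\<rho>l\<close> compatible with the
  extension operators.\<close>

lemma app_ladj_act:
  "app c (ladj_act j l r (hat l (tid X C) (flat R))) =
    ccomp X (ladj_act j l' r' (hat l' (tid X C') (flat R'))) (tid X A)
      [lift j (r' \<cdot> l') (tid X A) (tid X A) (mult E (hom_cell X j (r \<cdot> l)) (ccomp X (hat r (r' \<cdot> c) \<rho>) l []))]"
  (is "app c ?W = ccomp X ?W' _ _")
  and Lambda_R_rmonad_morphism:
  "rmonad_morphism X j (induced_rmonad X j R) (induced_rmonad X j R') (Lambda_R X R R' (c, \<rho>))"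
proof -
  have c: "c \<in> tights X" "tdom X c = C" "tcod X c = C'" "c \<cdot> l = l'" and t: "tight2 X \<rho> r (r' \<cdot> c)"
    using m by (auto simp: right_morphism_iff)
  note \<rho> = tight2D[OF t]
  have \<rho>: "\<rho> \<in> cells X" "cdom X \<rho> = []" "ccod X \<rho> = hom X r (r' \<cdot> c)" "cleft X \<rho> = tid X C" "cright X \<rho> = tid X C"
    using \<rho> adj_ty by simp_all
  define h h' where "h = hat j (r \<cdot> l) (radj_unit X j R)" and "h' = hat j (r' \<cdot> l') (radj_unit X j R')"
  note hc = unit_cell[folded h_def] unit_cell'[folded h'_def]
  define p where "p = hat r (r' \<cdot> c) \<rho>"
  have p: "p \<in> cells X" "cdom X p = []" "ccod X p = uid X E" "cleft X p = r" "cright X p = r' \<cdot> c"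
    using adj_ty c \<rho> by (simp_all add: p_def)
  have e: "mult E h (ccomp X p l []) = h'"
    using m unfolding right_morphism_iff p_def h_def h'_def by simp
  define W W' where "W = ?W" and "W' = ?W'"
  have u: "unit_adj j l r h (hat l (tid X C) (flat R))" "unit_adj j l' r' h' (hat l' (tid X C') (flat R'))"
    using rel_adj_unit_adj(1)[OF R] rel_adj_unit_adj(1)[OF R'] ob by (simp_all add: h_def h'_def)
  note w = ladj_act[OF u(1) ob(1,2,4), folded W_def] and w' = ladj_act[OF u(2) ob(1,3,4), folded W'_def]
  have W: "W \<in> cells X" "cdom X W = [hom X j (r \<cdot> l)]" "ccod X W = uid X C" "cleft X W = l" "cright X W = l"
    and W': "W' \<in> cells X" "cdom X W' = [hom X j (r' \<cdot> l')]" "ccod X W' = uid X C'" "cleft X W' = l'" "cright X W' = l'"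
    using w(1) w'(1) by (simp_all add: framed_def)
  have n: "mult E (app r W) (ccomp X p l []) = mult E (ccomp X p l []) (app (r' \<cdot> c) W)"
    by (rule uid_naturality[where C=C]) (use c adj_ty p W in simp_all)
  have "mult E (hom_cell X j (r \<cdot> l)) (ccomp X p l []) = mult E h (mult E (app r W) (ccomp X p l []))"
    unfolding w(2)[symmetric] using c adj_ty p W hc by simp
  also have "\<dots> = mult E (mult E h (ccomp X p l [])) (app (r' \<cdot> c) W)"
    unfolding n using c adj_ty p W hc by simp
  also have "\<dots> = mult E h' (app r' (app c W))"
    unfolding e using c adj_ty W by simp
  finally have k: "mult E (hom_cell X j (r \<cdot> l)) (ccomp X p l []) = mult E h' (app r' (app c W))" .
  have "ccomp X W' (tid X A) [lift j (r' \<cdot> l') (tid X A) (tid X A) (mult E h' (app r' (app c W)))] =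
    mult C' (ccomp X W' (tid X A) [lift j (r' \<cdot> l') (tid X A) (tid X A) h']) (app c W)"
    by (rule w'(4)) (use c adj_ty W hc in simp_all)
  also have "\<dots> = app c W"
    unfolding w'(3) using c adj_ty W by simp
  finally have a: "app c W = ccomp X W' (tid X A) [lift j (r' \<cdot> l') (tid X A) (tid X A)
      (mult E (hom_cell X j (r \<cdot> l)) (ccomp X p l []))]"
    unfolding k by (rule sym)
  then show "app c ?W = ccomp X ?W' (tid X A)
      [lift j (r' \<cdot> l') (tid X A) (tid X A) (mult E (hom_cell X j (r \<cdot> l)) (ccomp X (hat r (r' \<cdot> c) \<rho>) l []))]"
    unfolding W_def W'_def p_def .
  let ?T = "induced_rmonad X j R" and ?T' = "induced_rmonad X j R'"
  have T: "?T = \<lparr>carr = r \<cdot> l, ext = lift (r \<cdot> l) (r \<cdot> l) (tid X A) (tid X A) (app r W), eta = radj_unit X j R\<rparr>"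
    using induced_rmonad_eq[OF R] adj_ty by (simp add: W_def)
  have T': "?T' = \<lparr>carr = r' \<cdot> l', ext = lift (r' \<cdot> l') (r' \<cdot> l') (tid X A) (tid X A) (app r' W'), eta = radj_unit X j R'\<rparr>"
    using induced_rmonad_eq[OF R'] adj_ty by (simp add: W'_def)
  have cr: "carr ?T = r \<cdot> l" "carr ?T' = r' \<cdot> l'" "eta ?T = radj_unit X j R" "eta ?T' = radj_unit X j R'"
    by (simp_all add: T T')
  note g = rel_monadD[OF rel_monad_induced_rmonad[OF R(1)] cr(1)]
  note g' = rel_monadD[OF rel_monad_induced_rmonad[OF R'(1)] cr(2)]
  have hats: "hat (r \<cdot> l) (r \<cdot> l) (ext ?T) = app r W" "hat (r' \<cdot> l') (r' \<cdot> l') (ext ?T') = app r' W'"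
    using adj_ty W W' by (simp_all add: T T')
  have "mult E (app r W) (ccomp X p l []) = mult E (ccomp X p l []) (app r' (app c W))"
    unfolding n using c adj_ty W by simp
  also have "\<dots> = mult E (ccomp X p l []) (ccomp X (app r' W') (tid X A)
    [lift j (r' \<cdot> l') (tid X A) (tid X A) (mult E (hom_cell X j (r \<cdot> l)) (ccomp X p l []))])"
    unfolding a using c adj_ty W' p by simp
  finally have x: "mult E (app r W) (ccomp X p l []) = mult E (ccomp X p l []) (ccomp X (app r' W') (tid X A)
    [lift j (r' \<cdot> l') (tid X A) (tid X A) (mult E (hom_cell X j (r \<cdot> l)) (ccomp X p l []))])" .
  have tE: "tcod X (r \<cdot> l) = E" using adj_ty by simp
  show "rmonad_morphism X j ?T ?T' (Lambda_R X R R' (c, \<rho>))"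
    unfolding rmonad_morphism_iff[OF g cr(1) g' cr(2) Lambda_R_eq(2) tE] hats Lambda_R_eq(3) cr(3,4)
    using e x adj_ty by (simp add: h_def h'_def p_def)
qed

end

end

section \<open>The adjunction of an opalgebra object\<close>

text \<open>A 2-cell between tight-cells has an empty domain, with no loose-cell along which to
  extend. It is encoded as the induced \<open>E(1,r) \<Rightarrow> E(1,s)\<close>, to which
  uniqueness of extensions applies, and read back at the identity of \<open>r\<close>.\<close>

lemma tight2_extension_unique:
  assumes T: "rel_monad X j T" and K: "opalgebra_object X j T k wk" "tcod X k = C"
    and ty: "r \<in> tights X" "s \<in> tights X" "tdom X r = C" "tdom X s = C" "tcod X r = E" "tcod X s = E"
    and p: "framed X p [] (uid X E) r s" "framed X q [] (uid X E) r s"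
    and eq: "ccomp X p k [] = ccomp X q k []"
  shows "p = q"
proof -
  have k: "k \<in> tights X"
    using K(1) by (simp add: opalgebra_object_def opalgebra_def Let_def)
  have ob: "E \<in> obs X" "C \<in> obs X" using ty by auto
  define \<beta> where "\<beta> p = mult E (hom_cell X (tid X E) r) p" for p
  have unlift: "ccomp X (\<beta> p) r [lift (tid X E) r r (tid X C) (tunit r)] = p"
    if "framed X p [] (uid X E) r s" for p
    using that ty ob by (simp add: \<beta>_def framed_def)
  have \<beta>: "framed X (\<beta> p) [hom X (tid X E) r] (uid X E) (tid X E) s"
    "ccomp X (\<beta> p) (tid X E) [hom_res X (tid X E) r (tid X E) k] =
      mult E (hom_cell X (tid X E) (r \<cdot> k)) (ccomp X p k [])"
    if "framed X p [] (uid X E) r s" for p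
    using that ty ob k K(2) by (simp_all add: \<beta>_def framed_def hom_res_eq)
  have "\<beta> p = \<beta> q"
  proof (rule opalg_extension_unique[OF T K _ _ _ _ _ _ _ _ _ _ _ _ \<beta>(1)[OF p(1)] \<beta>(1)[OF p(2)],
        where D=E and B=E])
    show "ccomp X (\<beta> p) (tid X E) [hom_res X (tid X E) r (tid X E) k] =
      ccomp X (\<beta> q) (tid X E) [hom_res X (tid X E) r (tid X E) k]"
      unfolding \<beta>(2)[OF p(1)] \<beta>(2)[OF p(2)] eq ..
  qed (use ty ob in simp_all)
  then show ?thesis
    using unlift[OF p(1)] unlift[OF p(2)] by metis
qed

section \<open>Construction of the adjunction between \<open>k\<close> and \<open>v\<close>\<close>

context
  fixes j T k wk t v A C E \<eta> \<delta> \<omega>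
  assumes T: "rel_monad X j T" "carr T = t" and K: "opalgebra_object X j T k wk"
    and v: "v = opalg_mediator X k wk t (ext T)"
    and ob: "tdom X j = A" "tcod X k = C" "tcod X j = E"
    and hats: "\<eta> = hat j t (eta T)" "\<delta> = hat t t (ext T)" "\<omega> = hat k k wk"
begin

private lemma opalg: "opalgebra X j T k wk"
  using K by (simp add: opalgebra_object_def)

private lemma ty: "j \<in> tights X" "t \<in> tights X" "k \<in> tights X" "tdom X j = A" "tdom X t = A" "tdom X k = A"
  "tcod X j = E" "tcod X t = E" "tcod X k = C" "A \<in> obs X" "C \<in> obs X" "E \<in> obs X"
  using T opalg ob unfolding rel_monad_def opalgebra_def Let_def by auto

private lemma monad_cells: "globular X (ext T) [hom X j t] (hom X t t)" "tight2 X (eta T) j t"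
  "globular X wk [hom X j t] (hom X k k)"
  using rel_monadD[OF T] opalgebraD(3)[OF opalg T(2)] by auto

private lemma cells:
  "\<eta> \<in> cells X" "cdom X \<eta> = []" "ccod X \<eta> = uid X E" "cleft X \<eta> = j" "cright X \<eta> = t"
  "\<delta> \<in> cells X" "cdom X \<delta> = [hom X j t]" "ccod X \<delta> = uid X E" "cleft X \<delta> = t" "cright X \<delta> = t"
  "\<omega> \<in> cells X" "cdom X \<omega> = [hom X j t]" "ccod X \<omega> = uid X C" "cleft X \<omega> = k" "cright X \<omega> = k"
  using tight2D[OF monad_cells(2)] globularD[OF monad_cells(1)] globularD[OF monad_cells(3)] ty
  by (simp_all add: hats)

private lemma eta_lift: "eta T = lift j t (tid X A) (tid X A) \<eta>"
  and ext_lift: "ext T = lift t t (tid X A) (tid X A) \<delta>"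
  using tight2D[OF monad_cells(2)] globularD[OF monad_cells(1)] ty by (simp_all add: hats)

private lemma monad_laws: "mult E \<eta> \<delta> = hom_cell X j t"
  "ccomp X \<delta> (tid X A) [eta T] = tunit t"
  "mult E \<delta> \<delta> = ccomp X \<delta> (tid X A) [lift j t (tid X A) (tid X A) (mult E (hom_cell X j t) \<delta>)]"
  using rel_monad_iff[OF T(2) monad_cells(1,2) ty(8)] T(1) ty by (simp_all add: hats)

private lemma opalg_laws:
  assumes "opalgebra X j T a w" "tcod X a = B"
  shows "ccomp X (hat a a w) (tid X A) [eta T] = tunit a"
    "mult B (hat a a w) (hat a a w) =
      ccomp X (hat a a w) (tid X A) [lift j t (tid X A) (tid X A) (mult E (hom_cell X j t) \<delta>)]"
  using opalgebra_iff[OF T(2) monad_cells(1,2) ty(8) opalgebraD[OF assms(1) T(2)] assms(2)] assms(1) ty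
  by (simp_all add: hats)

private lemma opalgebraI:
  assumes "a \<in> tights X" "tdom X a = A" "tcod X a = B" "framed X w [hom X j t] (uid X B) a a"
    "ccomp X w (tid X A) [eta T] = tunit a"
    "mult B w w = ccomp X w (tid X A) [lift j t (tid X A) (tid X A) (mult E (hom_cell X j t) \<delta>)]"
  shows "opalgebra X j T a (lift a a (tid X A) (tid X A) w)"
proof -
  have g: "globular X (lift a a (tid X A) (tid X A) w) [hom X j t] (hom X a a)"
    using globular_lift1[of a a w] assms by (simp add: framed_def)
  have d: "tdom X a = tdom X j" using assms(2) ob by simp
  show ?thesis
    unfolding opalgebra_iff[OF T(2) monad_cells(1,2) ty(8) assms(1) d g assms(3)]
    using assms ty by (simp add: hats[symmetric] framed_def)
qed

text \<open>The second and third monad laws say that \<open>(t, \<dagger>)\<close> is an opalgebra,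
  so its mediator satisfies the factorisation equations; the last of these is transposed by
  cancelling a cartesian 2-cell.\<close>

private lemma v_factor: "v \<in> tights X" "tdom X v = C" "tcod X v = E" "v \<cdot> k = t" "app v \<omega> = \<delta>"
proof -
  have "opalgebra X j T t (ext T)"
    unfolding ext_lift by (rule opalgebraI[where B=E]) (use ty cells monad_laws in \<open>simp_all add: framed_def\<close>)
  then have "\<exists>!b. opalg_factor X k wk t (ext T) b"
    using K unfolding opalgebra_object_def by blast
  then have f: "opalg_factor X k wk t (ext T) v"
    unfolding v opalg_mediator_def by (rule theI')
  then show v: "v \<in> tights X" "tdom X v = C" "tcod X v = E" "v \<cdot> k = t"
    using ty by (auto simp: opalg_factor_def)
  have "ext T = frown_at X v k k \<star> [wk]"
    using f by (simp add: opalg_factor_def)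
  also have "\<dots> = lift t t (tid X A) (tid X A) (app v \<omega>)"
    using frown_at_paste[OF monad_cells(3) ty(3) v(1)] v ty by (simp add: hats)
  finally have "lift t t (tid X A) (tid X A) (app v \<omega>) = lift t t (tid X A) (tid X A) \<delta>"
    using ext_lift by simp
  then have "ccomp X (hom_cell X t t) (tid X A) [lift t t (tid X A) (tid X A) (app v \<omega>)] =
    ccomp X (hom_cell X t t) (tid X A) [lift t t (tid X A) (tid X A) \<delta>]"
    by simp
  then show "app v \<omega> = \<delta>"
    using ty cells v by simp
qed

lemma opalg_object_unit_adj:
  obtains F where "unit_adj j k v \<eta> F" "ladj_act j k v F = \<omega>"
proof -
  note vf = v_factor
  obtain F where F: "framed X F [hom X j v] (uid X C) k (tid X C)"
    "ccomp X F (tid X A) [hom_res X j v (tid X A) k] = \<omega>"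
  \<comment> \<open>As \<open>\<flat>\<close> has codomain \<open>C(k,1)\<close>, the tight-cell
    \<open>b'\<close> is the identity of \<open>C\<close>.\<close>
  proof (rule opalg_extension[OF T(1) K ob(2), where x=j and D=A and B=E and f=k and B'=C and b=v
        and b'="tid X C" and \<gamma>=\<omega>])
    \<comment> \<open>Because \<open>v\<omega> = \<delta>\<close>, equivariance of
      \<open>\<omega>\<close> is the multiplicative law of the opalgebra \<open>k\<close>.\<close>
    show "ccomp X \<omega> (tid X A) [lift j (v \<cdot> k) (tid X A) (tid X (tdom X k))
        (mult E (hom_cell X j (v \<cdot> k)) (app v (hat k k wk)))] =
      mult C \<omega> (app (tid X C) (hat k k wk))"
      unfolding hats(3)[symmetric] vf(4,5) using opalg_laws(2)[OF opalg ty(9)] ty cells by (simp add: hats(3)[symmetric])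
  qed (use ty vf cells in \<open>simp_all add: framed_def\<close>)
  note F' = F(1)[unfolded framed_def]
  have "mult E \<eta> (app v F) = hom_cell X j v"
  proof (rule opalg_extension_unique[OF T(1) K ob(2), where x=j and f=j and b=v and b'=v])
    have "ccomp X (mult E \<eta> (app v F)) (tid X A) [hom_res X j v (tid X A) k] = mult E \<eta> (app v \<omega>)"
      unfolding F(2)[symmetric] using ty vf F' cells by (simp add: hom_res_eq)
    also have "\<dots> = hom_cell X j t"
      unfolding vf(5) by (rule monad_laws(1))
    finally show "ccomp X (mult E \<eta> (app v F)) (tid X A) [hom_res X j v (tid X A) k] =
      ccomp X (hom_cell X j v) (tid X A) [hom_res X j v (tid X A) k]"
      using ty vf by (simp add: hom_res_eq)
    show "framed X (mult E \<eta> (app v F)) [hom X j v] (uid X E) j v"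
      using ty vf F' cells by (simp add: framed_def)
  qed (use ty vf in \<open>simp_all add: framed_def\<close>)
  \<comment> \<open>The right tight-cell of \<open>\<eta>\<close> factors through \<open>k\<close>,
    so evaluating \<open>F\<close> there involves only its restriction \<open>\<omega>\<close>; what
    remains is the unit law for \<open>k\<close>.\<close>
  moreover have "ccomp X F (tid X A) [lift j v (tid X A) k \<eta>] = ccomp X \<omega> (tid X A) [eta T]"
    unfolding F(2)[symmetric] eta_lift using ty vf F' cells by (simp add: hom_res_eq)
  then have "ccomp X F (tid X A) [lift j v (tid X A) k \<eta>] = tunit k"
    using opalg_laws(1)[OF opalg ty(9)] by (simp add: hats(3))
  ultimately have "unit_adj j k v \<eta> F"
    using ty vf F(1) cells by (simp add: unit_adj_def framed_def)
  moreover have "ladj_act j k v F = \<omega>"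
    using F(2) ty by (simp add: ladj_act_def)
  ultimately show thesis by (rule that)
qed

text \<open>The last conjunct says that the adjunction induces on \<open>k\<close> its original
  opalgebra structure. This links right-morphisms out of \<open>R\<close> to the universal property,
  and with \<open>v\<omega> = \<delta>\<close> it makes the induced monad equal to
  \<open>T\<close>.\<close>

lemma ex_opalg_object_rel_adj:
  "\<exists>R. rel_adj X j R \<and> ladj R = k \<and> radj R = v \<and> radj_unit X j R = eta T \<and>
    induced_rmonad X j R = T \<and> ladj_act j k v (hat k (tid X C) (flat R)) = \<omega>"
proof -
  obtain F where F: "unit_adj j k v \<eta> F" "ladj_act j k v F = \<omega>"
    by (rule opalg_object_unit_adj)
  note vf = v_factor
  define R where "R = \<lparr>ladj = k, radj = v,
    sharp = lift1 j v (mult (tcod X j) \<eta> (app v (hom_cell X k (tid X (tcod X k))))),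
    flat = lift1 k (tid X (tcod X k)) F\<rparr>"
  have R: "rel_adj X j R" "ladj R = k" "radj R = v"
    using unit_adj_rel_adj(1)[OF F(1)] by (simp_all add: R_def)
  have u: "radj_unit X j R = eta T"
    using unit_adj_rel_adj(2)[OF F(1)] vf ty by (simp add: R_def eta_lift)
  have "framed X F [hom X j v] (uid X C) k (tid X C)"
    using F(1) ty by (simp add: unit_adj_def)
  then have h: "hat k (tid X C) (flat R) = F"
    using ty by (simp add: R_def framed_def)
  then have "hat k (tid X (tcod X k)) (flat R) = F"
    using ty by simp
  then have "induced_rmonad X j R = \<lparr>carr = t, ext = ext T, eta = eta T\<rparr>"
    using induced_rmonad_eq[OF R] vf ty by (simp add: F(2) u ext_lift)
  then have "induced_rmonad X j R = T"
    using T(2) by simp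
  then show ?thesis
    using R u h F(2) by blast
qed

section \<open>Right-morphisms out of the adjunction of the opalgebra object\<close>

context
  fixes R R' l' r' C' t' T'
  assumes R: "rel_adj X j R" "ladj R = k" "radj R = v" "radj_unit X j R = eta T" "induced_rmonad X j R = T"
      "ladj_act j k v (hat k (tid X C) (flat R)) = \<omega>"
    and R': "rel_adj X j R'" "ladj R' = l'" "radj R' = r'"
    and ob': "tcod X l' = C'" "r' \<cdot> l' = t'" "induced_rmonad X j R' = T'"
begin

private lemma ty': "l' \<in> tights X" "r' \<in> tights X" "tdom X l' = A" "tcod X l' = C'" "tdom X r' = C'" "tcod X r' = E"
  "C' \<in> obs X" "t' \<in> tights X" "tdom X t' = A" "tcod X t' = E"
  using rel_adjD(1-6)[OF R'] ob ob' ty by auto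

private lemma right_morphism_app:
  assumes m: "right_morphism X j R R' (c, \<rho>)"
  shows "app c \<omega> = ccomp X (ladj_act j l' r' (hat l' (tid X C') (flat R'))) (tid X A)
      [lift j t' (tid X A) (tid X A) (mult E (hom_cell X j t) (hat t t' (Lambda_R X R R' (c, \<rho>))))]"
  using app_ladj_act[OF R(1-3) R' ob(1,2) ob'(1) ob(3) m] Lambda_R_eq(3)[OF R(1-3) R' ob(1,2) ob'(1) ob(3) m]
  by (simp only: R(6) ob'(2) v_factor(4))

text \<open>The means of proving tight-cells equal, both for injectivity and in the strict
  case.\<close>

private lemma mediator_c:
  assumes "c \<in> tights X" "tdom X c = C"
  shows "c = opalg_mediator X k wk (c \<cdot> k) (lift (c \<cdot> k) (c \<cdot> k) (tid X A) (tid X A) (app c \<omega>))"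
  using opalg_mediator_tcomp[OF T(1) K assms(1)] frown_at_paste[OF monad_cells(3) ty(3) assms(1)] assms ty
  by (simp add: hats(3))

private lemma right_morphismD:
  assumes "right_morphism X j R R' (c, \<rho>)"
  shows "c \<in> tights X" "tdom X c = C" "tcod X c = C'" "c \<cdot> k = l'" "tight2 X \<rho> v (r' \<cdot> c)"
    "mult E \<eta> (ccomp X (hat v (r' \<cdot> c) \<rho>) k []) = hat j t' (radj_unit X j R')"
    "(r' \<cdot> c) \<cdot> k = t'"
    "\<rho> = lift v (r' \<cdot> c) (tid X C) (tid X C) (hat v (r' \<cdot> c) \<rho>)"
    "framed X (hat v (r' \<cdot> c) \<rho>) [] (uid X E) v (r' \<cdot> c)"
proof -
  note vf = v_factor
  show m: "c \<in> tights X" "tdom X c = C" "tcod X c = C'" "c \<cdot> k = l'" "tight2 X \<rho> v (r' \<cdot> c)"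
    "mult E \<eta> (ccomp X (hat v (r' \<cdot> c) \<rho>) k []) = hat j t' (radj_unit X j R')"
    using assms right_morphism_iff[OF R(1-3) R' ob(1,2) ob'(1) ob(3), of c \<rho>] R(4) ob' vf
    by (simp_all add: hats)
  show "(r' \<cdot> c) \<cdot> k = t'"
    using m ty ty' ob' by simp
  note tight2D[OF m(5)]
  then show "\<rho> = lift v (r' \<cdot> c) (tid X C) (tid X C) (hat v (r' \<cdot> c) \<rho>)"
    "framed X (hat v (r' \<cdot> c) \<rho>) [] (uid X E) v (r' \<cdot> c)"
    using m(1-4) ty ty' vf by (simp_all add: framed_def)
qed

private lemma hat_Lambda_R:
  assumes m: "right_morphism X j R R' (c, \<rho>)"
  shows "hat t t' (Lambda_R X R R' (c, \<rho>)) = ccomp X (hat v (r' \<cdot> c) \<rho>) k []"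
    "Lambda_R X R R' (c, \<rho>) = lift t t' (tid X A) (tid X A) (ccomp X (hat v (r' \<cdot> c) \<rho>) k [])"
  using Lambda_R_eq(1,3)[OF R(1-3) R' ob(1,2) ob'(1) ob(3) m]
  by (simp_all only: ob'(2) v_factor(4))

text \<open>The composite \<open>c \<cdot> k\<close> is prescribed and \<open>app c \<omega>\<close>
  is expressed through the transpose, so the transpose determines \<open>c\<close>. It then
  determines \<open>\<rho>\<close>, as 2-cells between tight-cells are detected by whiskering with
  \<open>k\<close>.\<close>

lemma Lambda_R_inj: "inj_on (Lambda_R X R R') {m. right_morphism X j R R' m}"
proof (rule inj_onI, clarsimp)
  fix c \<rho> c2 \<rho>2
  assume m: "right_morphism X j R R' (c, \<rho>)" "right_morphism X j R R' (c2, \<rho>2)"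
    and eq: "Lambda_R X R R' (c, \<rho>) = Lambda_R X R R' (c2, \<rho>2)"
  note d = right_morphismD[OF m(1)] and d2 = right_morphismD[OF m(2)]
  have "app c \<omega> = app c2 \<omega>"
    using right_morphism_app[OF m(1)] right_morphism_app[OF m(2)] eq by (simp only:)
  then have c: "c = c2"
    using mediator_c[OF d(1,2)] mediator_c[OF d2(1,2)] d(4) d2(4) by metis
  have "ccomp X (hat v (r' \<cdot> c) \<rho>) k [] = ccomp X (hat v (r' \<cdot> c2) \<rho>2) k []"
    using hat_Lambda_R(1)[OF m(1)] hat_Lambda_R(1)[OF m(2)] eq by (simp only:)
  then have "hat v (r' \<cdot> c) \<rho> = hat v (r' \<cdot> c) \<rho>2"
    using tight2_extension_unique[OF T(1) K ob(2) _ _ _ _ _ _ d(9) d2(9)[folded c]] d(1-3) v_factor ty ty'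
    unfolding c by simp
  then show "c = c2 \<and> \<rho> = \<rho>2"
    using d(8) d2(8) c by metis
qed

private lemma T': "globular X (ext T') [hom X j t'] (hom X t' t')" "tight2 X (eta T') j t'" "carr T' = t'"
  "eta T' = radj_unit X j R'"
  "T' = \<lparr>carr = t', ext = lift t' t' (tid X A) (tid X A) (app r' (ladj_act j l' r' (hat l' (tid X C') (flat R')))),
    eta = radj_unit X j R'\<rparr>"
proof -
  show e: "T' = \<lparr>carr = t', ext = lift t' t' (tid X A) (tid X A) (app r' (ladj_act j l' r' (hat l' (tid X C') (flat R')))),
    eta = radj_unit X j R'\<rparr>"
    using induced_rmonad_eq[OF R'] ob' ty' by simp
  then show "carr T' = t'" "eta T' = radj_unit X j R'" by simp_all
  then show "globular X (ext T') [hom X j t'] (hom X t' t')" "tight2 X (eta T') j t'"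
    using rel_monadD[OF rel_monad_induced_rmonad[OF R'(1)]] ob' by simp_all
qed

lemma Lambda_R_surj:
  assumes \<tau>: "rmonad_morphism X j T T' \<tau>"
  shows "\<exists>c \<rho>. right_morphism X j R R' (c, \<rho>) \<and> Lambda_R X R R' (c, \<rho>) = \<tau>"
proof -
  note vf = v_factor
  define W where "W = ladj_act j l' r' (hat l' (tid X C') (flat R'))"
  define h where "h = hat j t' (radj_unit X j R')"
  define q where "q = hat t t' \<tau>"
  have u: "unit_adj j l' r' h (hat l' (tid X C') (flat R'))"
    using rel_adj_unit_adj(1)[OF R'] ob' by (simp add: h_def)
  note w' = ladj_act[OF u ob(1) ob'(1) ob(3), folded W_def, unfolded ob'(2)]
  have W: "W \<in> cells X" "cdom X W = [hom X j t']" "ccod X W = uid X C'" "cleft X W = l'" "cright X W = l'"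
    using w'(1) by (simp_all add: framed_def)
  have h: "h \<in> cells X" "cdom X h = []" "ccod X h = uid X E" "cleft X h = j" "cright X h = t'"
    using u ob ob' by (simp_all add: unit_adj_def framed_def)
  have t2: "tight2 X \<tau> t t'"
    using \<tau> T(2) T'(3) by (simp add: rmonad_morphism_def Let_def)
  note q' = tight2D[OF t2]
  have q: "q \<in> cells X" "cdom X q = []" "ccod X q = uid X E" "cleft X q = t" "cright X q = t'"
    using q' ty ty' by (simp_all add: q_def)
  have \<tau>q: "\<tau> = lift t t' (tid X A) (tid X A) q"
    using q' ty ty' by (simp add: q_def)
  have hat': "hat t' t' (ext T') = app r' W"
    unfolding T'(5) W_def[symmetric] using ty ty' W ob' by simp
  have m: "mult E \<eta> q = h"
    "mult E \<delta> q = mult E q (ccomp X (app r' W) (tid X A) [lift j t' (tid X A) (tid X A) (mult E (hom_cell X j t) q)])"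
    using \<tau> unfolding rmonad_morphism_iff[OF monad_cells(1,2) T(2) T'(1-3) t2 ty(8)] hat' T'(4)
    using ty ty' by (simp_all add: h_def q_def hats)
  \<comment> \<open>The structure on \<open>l'\<close> obtained from its action of \<open>T'\<close>
    by change of monad along \<open>\<tau>\<close>. By \<open>right_morphism_app\<close>, the
    \<open>c\<close> to be found has to satisfy \<open>app c \<omega> = w\<close>.\<close>
  define w where "w = ccomp X W (tid X A) [lift j t' (tid X A) (tid X A) (mult E (hom_cell X j t) q)]"
  have w: "w \<in> cells X" "cdom X w = [hom X j t]" "ccod X w = uid X C'" "cleft X w = l'" "cright X w = l'"
    using ty ty' q W by (simp_all add: w_def)
  have m2: "mult E \<delta> q = mult E q (app r' w)"
    unfolding m(2) w_def using ty ty' q W ob' by simp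
  have "opalgebra X j T l' (lift l' l' (tid X A) (tid X A) w)"
  proof (rule opalgebraI[where B=C'])
    have "ccomp X w (tid X A) [eta T] = ccomp X W (tid X A) [lift j t' (tid X A) (tid X A) (mult E \<eta> q)]"
      unfolding w_def eta_lift using ty ty' q W cells by simp
    then show "ccomp X w (tid X A) [eta T] = tunit l'"
      unfolding m(1) w'(3) .
    have "ccomp X w (tid X A) [lift j t (tid X A) (tid X A) (mult E (hom_cell X j t) \<delta>)] =
      ccomp X W (tid X A) [lift j t' (tid X A) (tid X A) (mult E (hom_cell X j t) (mult E \<delta> q))]"
      unfolding w_def using ty ty' q W cells by simp
    \<comment> \<open>Compatibility of \<open>\<tau>\<close> with the extension operators, in the
      form \<open>m2\<close>, moves \<open>\<delta>\<close> across \<open>\<tau>\<close>; naturality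
      of \<open>W\<close> then splits off the factor \<open>w\<close>.\<close>
    also have "\<dots> = ccomp X W (tid X A) [lift j t' (tid X A) (tid X A)
        (mult E (mult E (hom_cell X j t) q) (app r' w))]"
      unfolding m2 using ty ty' q w ob' by simp
    also have "\<dots> = mult C' (ccomp X W (tid X A) [lift j t' (tid X A) (tid X A)
        (mult E (hom_cell X j t) q)]) w"
      by (rule w'(4)) (use ty ty' q w in simp_all)
    also have "\<dots> = mult C' w w"
      unfolding w_def[symmetric] ..
    finally show "mult C' w w = ccomp X w (tid X A) [lift j t (tid X A) (tid X A) (mult E (hom_cell X j t) \<delta>)]"
      by (rule sym)
  qed (use ty' w in \<open>simp_all add: framed_def\<close>)
  then obtain c where c0: "opalg_factor X k wk l' (lift l' l' (tid X A) (tid X A) w) c"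
    using K unfolding opalgebra_object_def by blast
  then have c: "c \<in> tights X" "tdom X c = C" "tcod X c = C'" "c \<cdot> k = l'"
    using ty ty' by (simp_all add: opalg_factor_def)
  have "lift l' l' (tid X A) (tid X A) w = lift l' l' (tid X A) (tid X A) (app c \<omega>)"
    using c0 frown_at_paste[OF monad_cells(3) ty(3) c(1)] c ty ty' by (simp add: opalg_factor_def hats)
  then have "ccomp X (hom_cell X l' l') (tid X A) [lift l' l' (tid X A) (tid X A) w] =
    ccomp X (hom_cell X l' l') (tid X A) [lift l' l' (tid X A) (tid X A) (app c \<omega>)]"
    by simp
  then have cw: "w = app c \<omega>"
    using ty ty' c w cells by simp
  have rck: "(r' \<cdot> c) \<cdot> k = t'"
    using c ty ty' ob' by simp
  have rc: "r' \<cdot> c \<in> tights X" "tdom X (r' \<cdot> c) = C" "tcod X (r' \<cdot> c) = E"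
    using c ty ty' by simp_all
  let ?i = "tid X E"
  \<comment> \<open>The morphism \<open>\<tau>\<close> in the form
    \<open>E(1,t) \<Rightarrow> E(1,t')\<close>, which does have a loose-cell along which to
    extend.\<close>
  define \<gamma> where "\<gamma> = mult E (hom_cell X ?i t) q"
  obtain \<beta> where \<beta>: "framed X \<beta> [hom X ?i v] (uid X E) ?i (r' \<cdot> c)"
    "ccomp X \<beta> ?i [hom_res X ?i v ?i k] = \<gamma>"
  proof (rule opalg_extension[OF T(1) K ob(2), where x="?i" and D=E and B=E and f="?i" and B'=E and b=v
        and b'="r' \<cdot> c" and \<gamma>=\<gamma>])
    \<comment> \<open>Equivariance of \<open>\<gamma>\<close> is \<open>m2\<close> multiplied on the
      left by the cartesian 2-cell, as \<open>w = app c \<omega>\<close>.\<close>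
    have "ccomp X \<gamma> ?i [lift ?i t ?i (tid X A) (mult E (hom_cell X ?i t) \<delta>)] =
      mult E (hom_cell X ?i t) (mult E \<delta> q)"
      using ty ty' q cells by (simp add: \<gamma>_def)
    also have "\<dots> = mult E \<gamma> (app r' (app c \<omega>))"
      unfolding m2 cw using ty ty' q cells c ob' by (simp add: \<gamma>_def)
    also have "app r' (app c \<omega>) = app (r' \<cdot> c) \<omega>"
      using ty ty' c cells by simp
    finally show "ccomp X \<gamma> ?i [lift ?i (v \<cdot> k) ?i (tid X (tdom X k))
        (mult E (hom_cell X ?i (v \<cdot> k)) (app v (hat k k wk)))] =
      mult E \<gamma> (app (r' \<cdot> c) (hat k k wk))"
      unfolding hats(3)[symmetric] vf(4,5) ty(6) .
    show "framed X \<gamma> [hom X ?i (v \<cdot> k)] (uid X E) ?i ((r' \<cdot> c) \<cdot> k)"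
      unfolding rck vf(4) using ty q by (simp add: \<gamma>_def framed_def)
  qed (use ty vf rc in simp_all)
  note \<beta>' = \<beta>(1)[unfolded framed_def]
  \<comment> \<open>The 2-cell \<open>v \<Rightarrow> r'c\<close> is read off from
    \<open>\<beta>\<close> at the identity of \<open>v\<close>.\<close>
  define p where "p = ccomp X \<beta> v [lift ?i v v (tid X C) (tunit v)]"
  have p: "p \<in> cells X" "cdom X p = []" "ccod X p = uid X E" "cleft X p = v" "cright X p = r' \<cdot> c"
    using ty vf rc \<beta>' by (simp_all add: p_def)
  define \<rho> where "\<rho> = lift v (r' \<cdot> c) (tid X C) (tid X C) p"
  have hat\<rho>: "hat v (r' \<cdot> c) \<rho> = p"
    using ty vf rc p by (simp add: \<rho>_def)
  \<comment> \<open>Whiskering by \<open>k\<close> evaluates \<open>\<beta>\<close> at the identity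
    of \<open>vk = t\<close>, which passes through the restriction \<open>\<gamma>\<close> and
    therefore gives \<open>q\<close>.\<close>
  have "ccomp X p k [] = ccomp X \<beta> t [lift ?i v t k (tunit t)]"
    using ty vf rc \<beta>' by (simp add: p_def)
  also have "\<dots> = ccomp X (ccomp X \<beta> ?i [hom_res X ?i v ?i k]) t [lift ?i t t (tid X A) (tunit t)]"
    using ty vf rc \<beta>' by (simp add: hom_res_eq)
  also have "\<dots> = q"
    unfolding \<beta>(2) using ty ty' q by (simp add: \<gamma>_def)
  finally have pk: "ccomp X p k [] = q" .
  have "tight2 X \<rho> v (r' \<cdot> c)"
    using tight2_lift1[of v "r' \<cdot> c" E p] vf rc p by (simp add: \<rho>_def)
  then have rm: "right_morphism X j R R' (c, \<rho>)"
    unfolding right_morphism_iff[OF R(1-3) R' ob(1,2) ob'(1) ob(3)] R(4) vf(4) ob'(2) hat\<rho> pk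
    using c m(1) by (simp add: hats h_def)
  have "Lambda_R X R R' (c, \<rho>) = \<tau>"
    unfolding hat_Lambda_R(2)[OF rm] hat\<rho> pk \<tau>q ..
  with rm show ?thesis by blast
qed

lemma Lambda_R_bij:
  "bij_betw (Lambda_R X R R') {m. right_morphism X j R R' m} {\<tau>. rmonad_morphism X j T T' \<tau>}"
  unfolding bij_betw_def
proof (intro conjI Lambda_R_inj set_eqI iffI)
  fix \<tau> assume "\<tau> \<in> Lambda_R X R R' ` {m. right_morphism X j R R' m}"
  then obtain c \<rho> where "right_morphism X j R R' (c, \<rho>)" "\<tau> = Lambda_R X R R' (c, \<rho>)" by auto
  then show "\<tau> \<in> {\<tau>. rmonad_morphism X j T T' \<tau>}"
    using Lambda_R_rmonad_morphism[OF R(1-3) R' ob(1,2) ob'(1) ob(3), of c \<rho>] R(5) ob' by simp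
next
  fix \<tau> assume "\<tau> \<in> {\<tau>. rmonad_morphism X j T T' \<tau>}"
  then obtain c \<rho> where "right_morphism X j R R' (c, \<rho>)" "Lambda_R X R R' (c, \<rho>) = \<tau>"
    using Lambda_R_surj by blast
  then show "\<tau> \<in> Lambda_R X R R' ` {m. right_morphism X j R R' m}"
    by force
qed

text \<open>Both notions of identity include equality of the underlying data. The link is
  \<open>(r'c)\<omega> = \<dagger>'(1 \<cdot> \<rho>k)\<close>: for strict morphisms it equates the
  two extension operators, and conversely it gives \<open>(r'c)\<omega> = v\<omega>\<close>, whence
  \<open>r'c = v\<close> by uniqueness of mediators.\<close>

lemma strict_right_morphism_iff:
  assumes m: "right_morphism X j R R' (c, \<rho>)"
  shows "strict_right_morphism X R R' (c, \<rho>) \<longleftrightarrow> is_rmonad_id X T T' (Lambda_R X R R' (c, \<rho>))"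
proof -
  note vf = v_factor and d = right_morphismD[OF m]
  define W where "W = ladj_act j l' r' (hat l' (tid X C') (flat R'))"
  have u: "unit_adj j l' r' (hat j t' (radj_unit X j R')) (hat l' (tid X C') (flat R'))"
    using rel_adj_unit_adj(1)[OF R'] ob' by simp
  note w' = ladj_act[OF u ob(1) ob'(1) ob(3), folded W_def, unfolded ob'(2)]
  have W: "W \<in> cells X" "cdom X W = [hom X j t']" "ccod X W = uid X C'" "cleft X W = l'" "cright X W = l'"
    using w'(1) by (simp_all add: framed_def)
  have rc: "r' \<cdot> c \<in> tights X" "tdom X (r' \<cdot> c) = C" "tcod X (r' \<cdot> c) = E"
    using d ty ty' by simp_all
  define p where "p = hat v (r' \<cdot> c) \<rho>"
  have p: "p \<in> cells X" "cdom X p = []" "ccod X p = uid X E" "cleft X p = v" "cright X p = r' \<cdot> c"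
    using d(9) by (simp_all add: p_def framed_def)
  have rap: "app (r' \<cdot> c) \<omega> = ccomp X (app r' W) (tid X A)
    [lift j t' (tid X A) (tid X A) (mult E (hom_cell X j t) (ccomp X p k []))]"
  proof -
    have "ccomp X p k [] \<in> cells X" "cdom X (ccomp X p k []) = []" "ccod X (ccomp X p k []) = uid X E"
      "cleft X (ccomp X p k []) = t" "cright X (ccomp X p k []) = t'"
      using p vf ty rc d(7) by simp_all
    note pk = this
    have "app (r' \<cdot> c) \<omega> = app r' (app c \<omega>)"
      using d ty ty' cells by simp
    also have "app c \<omega> = ccomp X W (tid X A)
        [lift j t' (tid X A) (tid X A) (mult E (hom_cell X j t) (ccomp X p k []))]"
      using right_morphism_app[OF m] hat_Lambda_R(1)[OF m] by (simp only: W_def p_def)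
    finally show ?thesis
      using ty ty' W pk by simp
  qed
  have lam: "Lambda_R X R R' (c, \<rho>) = lift t t' (tid X A) (tid X A) (ccomp X p k [])"
    using hat_Lambda_R(2)[OF m] by (simp only: p_def)
  have ext': "ext T' = lift t' t' (tid X A) (tid X A) (app r' W)"
    by (simp add: T'(5) W_def)
  show ?thesis
  proof
    assume "strict_right_morphism X R R' (c, \<rho>)"
    then have s: "v = r' \<cdot> c" "\<rho> = frown X v"
      using R(3) R'(3) by (simp_all add: strict_right_morphism_def is_tight2_id_def)
    have tt: "t' = t"
      using d(7) vf(4) s(1) by simp
    have "p = tunit v"
      unfolding p_def s(1)[symmetric] s(2) using vf ty by (simp add: frown_eq)
    then have pk: "ccomp X p k [] = tunit t"
      using vf ty by simp
    \<comment> \<open>The condition \<open>\<eta> \<cdot> \<rho>k = \<eta>'\<close> of a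
      right-morphism, with \<open>\<rho>k\<close> a unit.\<close>
    have e: "eta T' = eta T"
    proof -
      have "hat j t (radj_unit X j R') = \<eta>"
        using d(6)[folded p_def] cells ty by (simp add: pk tt)
      moreover have "radj_unit X j R' = lift j t (tid X A) (tid X A) (hat j t (radj_unit X j R'))"
        using tight2D[OF T'(2)[unfolded T'(4) tt]] ty by simp
      ultimately show ?thesis
        unfolding T'(4) eta_lift by (simp only:)
    qed
    have "\<delta> = app r' W"
      using rap[unfolded pk s(1)[symmetric] vf(5)] ty ty' W by (simp add: tt)
    then have "ext T' = ext T"
      unfolding ext' ext_lift tt by simp
    then have "T = T'"
      using e T(2) T'(3) tt by (intro rmonad.equality) simp_all
    moreover have "Lambda_R X R R' (c, \<rho>) = frown X t"
      unfolding lam pk tt using ty by (simp add: frown_eq)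
    ultimately show "is_rmonad_id X T T' (Lambda_R X R R' (c, \<rho>))"
      using T(2) by (simp add: is_rmonad_id_def is_tight2_id_def)
  next
    assume "is_rmonad_id X T T' (Lambda_R X R R' (c, \<rho>))"
    then have TT: "T' = T" and id: "Lambda_R X R R' (c, \<rho>) = frown X t"
      using T(2) by (simp_all add: is_rmonad_id_def is_tight2_id_def)
    have tt: "t' = t"
      using TT T(2) T'(3) by simp
    have pk: "ccomp X p k [] = tunit t"
      using hat_Lambda_R(1)[OF m] ty unfolding id tt p_def by (simp add: frown_eq)
    have "\<delta> = hat t t (ext T')"
      unfolding TT hats ..
    also have "\<dots> = app r' W"
      unfolding ext' tt using ty ty' W ob' tt by simp
    finally have \<delta>: "\<delta> = app r' W" .
    have "app (r' \<cdot> c) \<omega> = \<delta>"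
      unfolding rap pk tt \<delta> using ty ty' W ob' tt by simp
    then have "r' \<cdot> c = v"
      using mediator_c[OF rc(1,2)] mediator_c[OF vf(1,2)] unfolding d(7) tt vf(4,5) by simp
    then have s: "v = r' \<cdot> c" by simp
    \<comment> \<open>Both 2-cells whisker along \<open>k\<close> to the unit of
      \<open>t\<close>.\<close>
    have "p = tunit v"
      by (rule tight2_extension_unique[OF T(1) K ob(2), of v v E])
        (use vf ty pk p s[symmetric] in \<open>simp_all add: framed_def\<close>)
    then have "\<rho> = frown X v"
      using d(8)[folded p_def] vf by (simp add: frown_eq s[symmetric])
    then show "strict_right_morphism X R R' (c, \<rho>)"
      using s R(3) R'(3) by (simp add: strict_right_morphism_def is_tight2_id_def)
  qed
qed

end

end

end

theorem theorem6p49: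
  fixes X :: "('o, 't, 'l, 'c) vdc"
    and j k :: 't and T :: "('t, 'c) rmonad" and wk :: 'c
  assumes "virtual_equipment X"
    and "j \<in> tights X"
    and "rel_monad X j T"
    and "opalgebra_object X j T k wk"
  shows "\<exists>R. rel_adj X j R \<and>
      ladj R = k \<and> radj R = opalg_mediator X k wk (carr T) (ext T) \<and>
      radj_unit X j R = eta T \<and>
      induced_rmonad X j R = T \<and>
      (\<forall>R'. rel_adj X j R' \<longrightarrow>
        rel_monad X j (induced_rmonad X j R') \<and>
        bij_betw (Lambda_R X R R')
          {m. right_morphism X j R R' m}
          {\<tau>. rmonad_morphism X j T (induced_rmonad X j R') \<tau>} \<and>
        (\<forall>m. right_morphism X j R R' m \<longrightarrow>
          (strict_right_morphism X R R' m \<longleftrightarrow>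
           is_rmonad_id X T (induced_rmonad X j R') (Lambda_R X R R' m))))"
proof -
  interpret virtual_equipment X by fact
  \<comment> \<open>The reflexivities instantiate the names of the context: the carrier, the
    mediator \<open>v\<close>, the three objects and the three transposes.\<close>
  note object = assms(3) refl assms(4) refl refl refl refl refl refl refl
  obtain R where R: "rel_adj X j R" "ladj R = k" "radj R = opalg_mediator X k wk (carr T) (ext T)"
    "radj_unit X j R = eta T" "induced_rmonad X j R = T"
    "ladj_act j k (opalg_mediator X k wk (carr T) (ext T)) (hat k (tid X (tcod X k)) (flat R)) = hat k k wk"
    using ex_opalg_object_rel_adj[OF object] by blast
  show ?thesis
  proof (intro exI[of _ R] conjI allI impI R(1-5))
    fix R' assume R': "rel_adj X j R'"
    show "rel_monad X j (induced_rmonad X j R')"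
      by (rule rel_monad_induced_rmonad[OF R'])
    show "bij_betw (Lambda_R X R R') {m. right_morphism X j R R' m}
        {\<tau>. rmonad_morphism X j T (induced_rmonad X j R') \<tau>}"
      by (rule Lambda_R_bij[OF object R R' refl refl refl refl refl])
    fix m assume "right_morphism X j R R' m"
    then show "strict_right_morphism X R R' m \<longleftrightarrow>
      is_rmonad_id X T (induced_rmonad X j R') (Lambda_R X R R' m)"
      using strict_right_morphism_iff[OF object R R' refl refl refl refl refl] by (cases m) simp
  qed
qed

end
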